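(* Let $n\ge3$, and let $\Sigma$ be a compact orientable surface of positive genus without boundary. It is not possible to extend the length function $\lambda:B_n\to\mathbb Z$ to $B_n(\Sigma)$. In other words, there do not exist a group $F$, a surjective homomorphism $\lambda_\Sigma:B_n(\Sigma)\to F$ and an injective homomorphism $j:\mathbb Z\to F$ such that $\lambda_\Sigma\circ\iota=j\circ\lambda$, where $\iota:B_n\to B_n(\Sigma)$ is the homomorphism induced by an embedding of a disc in $\Sigma$.
   Context: For a connected surface $\Sigma$, $B_n(\Sigma)=\pi_1(\mathbb F_n(\Sigma)/S_n)$, where $\mathbb F_n(\Sigma)=\{(x_1,\dots,x_n)\in\Sigma^n: x_i\neq x_j\ (i\ne j)\}$; $B_n=B_n(\mathbb D^2)$ is the Artin braid group with standard generators $\sigma_1,\dots,\sigma_{n-1}$. The length function $\lambda:B_n\to\mathbb Z$ is the homomorphism with $\lambda(\sigma_i)=1$ for all $i$ (the Abelianisation of $B_n$). Surfaces are connected. *)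

theory Defs
  imports "HOL-Analysis.Analysis" "HOL-Homology.Homology" "HOL-Combinatorics.Permutations"
begin

section \<open>The fundamental group of a topology\<close>

definition loops_at :: "'a topology \<Rightarrow> 'a \<Rightarrow> (real \<Rightarrow> 'a) set" where
  "loops_at X a = {f. pathin X f \<and> f 0 = a \<and> f 1 = a}"

text \<open>Homotopy relative to the end points. The values of loops outside the unit interval are
  irrelevant for it.\<close>

definition loop_homotopic :: "'a topology \<Rightarrow> 'a \<Rightarrow> (real \<Rightarrow> 'a) \<Rightarrow> (real \<Rightarrow> 'a) \<Rightarrow> bool" where
  "loop_homotopic X a =
     homotopic_with (\<lambda>f. f 0 = a \<and> f 1 = a) (top_of_set {0..1}) X"

text \<open>The library operation \<open>+++\<close> is restricted to types in class \<open>topological_space\<close>.\<close>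

definition loop_join :: "(real \<Rightarrow> 'a) \<Rightarrow> (real \<Rightarrow> 'a) \<Rightarrow> real \<Rightarrow> 'a" where
  "loop_join f g = (\<lambda>t. if t \<le> 1/2 then f (2 * t) else g (2 * t - 1))"

definition loop_class :: "'a topology \<Rightarrow> 'a \<Rightarrow> (real \<Rightarrow> 'a) \<Rightarrow> (real \<Rightarrow> 'a) set" where
  "loop_class X a f = {g \<in> loops_at X a. loop_homotopic X a f g}"

definition fundamental_group :: "'a topology \<Rightarrow> 'a \<Rightarrow> (real \<Rightarrow> 'a) set monoid" where
  "fundamental_group X a =
     \<lparr>carrier = loop_class X a ` loops_at X a,
      monoid.mult = (\<lambda>A B. \<Union>f\<in>A. \<Union>g\<in>B. loop_class X a (loop_join f g)),
      one = loop_class X a (\<lambda>_. a)\<rparr>"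

definition pi1_map :: "'b topology \<Rightarrow> ('a \<Rightarrow> 'b) \<Rightarrow> 'a \<Rightarrow> (real \<Rightarrow> 'a) set \<Rightarrow> (real \<Rightarrow> 'b) set"
  where "pi1_map Y \<phi> a A = (\<Union>f\<in>A. loop_class Y (\<phi> a) (\<phi> \<circ> f))"

section \<open>Configuration spaces and surface braid groups\<close>

definition quotient_topology :: "'a topology \<Rightarrow> ('a \<Rightarrow> 'b) \<Rightarrow> 'b topology" where
  "quotient_topology X f =
     topology (\<lambda>U. U \<subseteq> f ` topspace X \<and> openin X {x \<in> topspace X. f x \<in> U})"

lemma openin_quotient_topology:
  "openin (quotient_topology X f) U \<longleftrightarrow>
     U \<subseteq> f ` topspace X \<and> openin X {x \<in> topspace X. f x \<in> U}"
proof -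
  have "istopology (\<lambda>U. U \<subseteq> f ` topspace X \<and> openin X {x \<in> topspace X. f x \<in> U})"
    unfolding istopology_def
  proof (intro conjI allI impI; (elim conjE)?)
    fix S T
    assume "openin X {x \<in> topspace X. f x \<in> S}" "openin X {x \<in> topspace X. f x \<in> T}"
    moreover have "{x \<in> topspace X. f x \<in> S \<inter> T} =
        {x \<in> topspace X. f x \<in> S} \<inter> {x \<in> topspace X. f x \<in> T}"
      by auto
    ultimately show "openin X {x \<in> topspace X. f x \<in> S \<inter> T}"
      by auto
  next
    fix \<K>
    assume *: "\<forall>K\<in>\<K>. K \<subseteq> f ` topspace X \<and> openin X {x \<in> topspace X. f x \<in> K}"
    have "{x \<in> topspace X. f x \<in> \<Union>\<K>} = (\<Union>K\<in>\<K>. {x \<in> topspace X. f x \<in> K})"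
      by auto
    then show "openin X {x \<in> topspace X. f x \<in> \<Union>\<K>}"
      using * by auto
  qed auto
  then show ?thesis
    by (simp add: quotient_topology_def)
qed

lemma quotient_map_quotient_topology: "quotient_map X (quotient_topology X f) f"
proof -
  have "{x \<in> topspace X. f x \<in> f ` topspace X} = topspace X"
    by auto
  then have "openin (quotient_topology X f) (f ` topspace X)"
    by (simp add: openin_quotient_topology)
  then have "topspace (quotient_topology X f) = f ` topspace X"
    by (metis openin_quotient_topology openin_subset openin_topspace subset_antisym)
  then show ?thesis
    by (auto simp: quotient_map_def openin_quotient_topology)
qed

text \<open>An \<open>n\<close>-tuple of points is an extensional function on \<open>{1..n}\<close>.\<close>

definition ordered_conf :: "nat \<Rightarrow> 'a topology \<Rightarrow> (nat \<Rightarrow> 'a) topology" where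
  "ordered_conf n X = subtopology (product_topology (\<lambda>_. X) {1..n}) {x. inj_on x {1..n}}"

definition sym_orbit :: "nat \<Rightarrow> (nat \<Rightarrow> 'a) \<Rightarrow> (nat \<Rightarrow> 'a) set" where
  "sym_orbit n x = {x \<circ> p | p. p permutes {1..n}}"

definition unordered_conf :: "nat \<Rightarrow> 'a topology \<Rightarrow> (nat \<Rightarrow> 'a) set topology" where
  "unordered_conf n X = quotient_topology (ordered_conf n X) (sym_orbit n)"

definition braid_group ::
  "nat \<Rightarrow> 'a topology \<Rightarrow> (nat \<Rightarrow> 'a) \<Rightarrow> (real \<Rightarrow> (nat \<Rightarrow> 'a) set) set monoid" where
  "braid_group n X x = fundamental_group (unordered_conf n X) (sym_orbit n x)"

definition conf_map :: "nat \<Rightarrow> ('a \<Rightarrow> 'b) \<Rightarrow> (nat \<Rightarrow> 'a) \<Rightarrow> nat \<Rightarrow> 'b" where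
  "conf_map n e x = (\<lambda>k\<in>{1..n}. e (x k))"

text \<open>The map on orbit spaces induced by \<open>e\<close> sends the orbit \<open>Q\<close> to \<open>conf_map n e ` Q\<close>.\<close>

definition braid_map ::
  "nat \<Rightarrow> 'b topology \<Rightarrow> ('a \<Rightarrow> 'b) \<Rightarrow> (nat \<Rightarrow> 'a) \<Rightarrow>
     (real \<Rightarrow> (nat \<Rightarrow> 'a) set) set \<Rightarrow> (real \<Rightarrow> (nat \<Rightarrow> 'b) set) set" where
  "braid_map n Y e x = pi1_map (unordered_conf n Y) (\<lambda>Q. conf_map n e ` Q) (sym_orbit n x)"

section \<open>The Artin braid group\<close>

abbreviation disc :: "complex topology" where
  "disc \<equiv> top_of_set (cball 0 1)"

text \<open>The base configuration: \<open>n\<close> points on the real diameter, in increasing order and at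
  distance \<open>2 / (n + 1)\<close> from their neighbours.\<close>

definition disc_base :: "nat \<Rightarrow> nat \<Rightarrow> complex" where
  "disc_base n = (\<lambda>k\<in>{1..n}. of_real ((2 * real k - real n - 1) / (real n + 1)))"

abbreviation artin_braid_group :: "nat \<Rightarrow> (real \<Rightarrow> (nat \<Rightarrow> complex) set) set monoid" where
  "artin_braid_group n \<equiv> braid_group n disc (disc_base n)"

text \<open>The points \<open>i\<close> and \<open>i + 1\<close> are exchanged by a half turn about their midpoint, anticlockwise
  (the opposite convention replaces all the generators by their inverses); the other points
  do not move.\<close>

definition half_twist :: "nat \<Rightarrow> nat \<Rightarrow> real \<Rightarrow> nat \<Rightarrow> complex" where
  "half_twist n i t =
     (let m = (disc_base n i + disc_base n (Suc i)) / 2;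
          r = (disc_base n (Suc i) - disc_base n i) / 2
      in (\<lambda>k\<in>{1..n}. if k = i then m - r * cis (pi * t)
                     else if k = Suc i then m + r * cis (pi * t)
                     else disc_base n k))"

definition artin_gen :: "nat \<Rightarrow> nat \<Rightarrow> (real \<Rightarrow> (nat \<Rightarrow> complex) set) set" where
  "artin_gen n i =
     loop_class (unordered_conf n disc) (sym_orbit n (disc_base n))
       (\<lambda>t. sym_orbit n (half_twist n i t))"

definition is_length_function ::
  "nat \<Rightarrow> ((real \<Rightarrow> (nat \<Rightarrow> complex) set) set \<Rightarrow> int) \<Rightarrow> bool" where
  "is_length_function n l \<longleftrightarrow>
     l \<in> hom (artin_braid_group n) integer_group \<and> (\<forall>i\<in>{1..<n}. l (artin_gen n i) = 1)"

section \<open>Surfaces\<close>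

definition surface_without_boundary :: "'a topology \<Rightarrow> bool" where
  "surface_without_boundary X \<longleftrightarrow>
     connected_space X \<and> Hausdorff_space X \<and> second_countable X \<and> topspace X \<noteq> {} \<and>
     (\<forall>x\<in>topspace X. \<exists>U. openin X U \<and> x \<in> U \<and>
        subtopology X U homeomorphic_space (euclidean :: complex topology))"

text \<open>\<open>H\<^sub>2(X, X - A)\<close>\<close>

abbreviation local_homology :: "'a topology \<Rightarrow> 'a set \<Rightarrow> 'a chain set monoid" where
  "local_homology X A \<equiv> relative_homology_group 2 X (topspace X - A)"

text \<open>A locally consistent choice of generators of the infinite cyclic groups \<open>H\<^sub>2(X, X - {x})\<close>.\<close>

definition orientable_surface :: "'a topology \<Rightarrow> bool" where
  "orientable_surface X \<longleftrightarrow> surface_without_boundary X \<and>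
     (\<exists>\<mu>. (\<forall>x\<in>topspace X. \<mu> x \<in> carrier (local_homology X {x}) \<and>
               generate (local_homology X {x}) {\<mu> x} = carrier (local_homology X {x})) \<and>
          (\<forall>x\<in>topspace X. \<exists>U c. openin X U \<and> x \<in> U \<and> c \<in> carrier (local_homology X U) \<and>
             (\<forall>y\<in>U. hom_induced 2 X (topspace X - U) X (topspace X - {y}) id c = \<mu> y)))"

text \<open>The standard model of the closed orientable surface of genus \<open>g \<ge> 1\<close>: the boundary circle
  of the disc is divided into \<open>4 g\<close> sides, and the sides are identified in pairs according to the
  word \<open>a\<^sub>1 b\<^sub>1 a\<^sub>1\<inverse> b\<^sub>1\<inverse> \<dots> a\<^sub>g b\<^sub>g a\<^sub>g\<inverse> b\<^sub>g\<inverse>\<close>. For real \<open>u\<close> between \<open>j\<close> and \<open>j + 1\<close>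
  the point \<open>rim g u\<close> runs along side number \<open>j\<close>. A quotient map from the disc whose fibres
  are the classes of the identification exhibits a space as this model.\<close>

definition rim :: "nat \<Rightarrow> real \<Rightarrow> complex" where
  "rim g u = cis (2 * pi * u / (4 * real g))"

inductive side_pairing :: "nat \<Rightarrow> complex \<Rightarrow> complex \<Rightarrow> bool" for g where
  side_a: "k < g \<Longrightarrow> 0 \<le> t \<Longrightarrow> t \<le> 1 \<Longrightarrow>
     side_pairing g (rim g (4 * real k + t)) (rim g (4 * real k + 3 - t))"
| side_b: "k < g \<Longrightarrow> 0 \<le> t \<Longrightarrow> t \<le> 1 \<Longrightarrow>
     side_pairing g (rim g (4 * real k + 1 + t)) (rim g (4 * real k + 4 - t))"

definition has_genus :: "'a topology \<Rightarrow> nat \<Rightarrow> bool" where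
  "has_genus X g \<longleftrightarrow>
     (if g = 0 then X homeomorphic_space (nsphere 2)
      else \<exists>q. quotient_map disc X q \<and>
             (\<forall>z\<in>cball 0 1. \<forall>w\<in>cball 0 1. q z = q w \<longleftrightarrow> equivclp (side_pairing g) z w))"

end

theory Submission
  imports Defs "HOL-Complex_Analysis.Complex_Analysis"
begin

text \<open>The homomorphism given by an extension is turned into a functor \<open>\<Phi>\<close> on all paths of
  configurations whose values on motions inside the embedded disc are integers. If \<open>T\<close> is the value of a
  full turn of one point around another, then \<open>T \<noteq> 0\<close>. Let one point move in the polygon model: its crossings
  \<open>X\<^sub>k\<close>, \<open>Y\<^sub>k\<close> of the two sides of a handle commute with the integers (as \<open>n \<ge> 3\<close>, two other points
  can be exchanged far away), and moving two points across two crossing chords gives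
  \<open>X\<^sub>k Y\<^sub>k = Y\<^sub>k X\<^sub>k (- T)\<close>. Following the point along the boundary of the polygon, the \<open>g\<close> commutators
  contribute \<open>- g T\<close>, but the same loop encircles the \<open>n - 1\<close> other points and contributes
  \<open>(n - 1) T\<close>. Hence \<open>(n - 1 + g) T = 0\<close>, a contradiction.\<close>

section \<open>Paths up to homotopy in abstract topologies\<close>

text \<open>Two obstacles shape the argument. The image of the integers is not known to be central
  in the target group, so commutation has to be earned for every element that occurs. And the
  embedding of the disc is arbitrary, without any normal position relative to the polygon. The
  polygon is therefore reparametrised by a self-map that fixes its boundary and squeezes everything
  within radius 9/10 into the embedded disc; the two charts are then compared through winding
  numbers only. This makes 2, the degree of a full turn in the chart of the embedding, a multiple of
  \<open>T\<close>, whence \<open>T \<noteq> 0\<close>. Working with paths instead of loops avoids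
  base points and generators of the surface braid group: each relation says that the two ways round
  a square of configurations agree. The sign of the commutator matters: with the opposite sign the
  final relation would read \<open>(n - 1 - g) T = 0\<close>, which says nothing for
  \<open>g = n - 1\<close>. It is decided by the orientation in which the two chords of a handle
  cross.\<close>

definition path_homotopic :: "'a topology \<Rightarrow> (real \<Rightarrow> 'a) \<Rightarrow> (real \<Rightarrow> 'a) \<Rightarrow> bool" where
  "path_homotopic X p q =
     homotopic_with (\<lambda>f. f 0 = p 0 \<and> f 1 = p 1) (top_of_set {0..1}) X p q"

definition path_rev :: "(real \<Rightarrow> 'a) \<Rightarrow> real \<Rightarrow> 'a" where
  "path_rev p = (\<lambda>t. p (1 - t))"

lemma path_homotopic_ends:
  assumes "path_homotopic X p q"
  shows "q 0 = p 0" "q 1 = p 1"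
  using homotopic_with_imp_property[OF assms[unfolded path_homotopic_def]] by auto

lemma path_homotopic_pathin:
  assumes "path_homotopic X p q"
  shows "pathin X p" "pathin X q"
  using homotopic_with_imp_continuous_maps[OF assms[unfolded path_homotopic_def]]
  by (auto simp: pathin_def)

lemma path_homotopic_refl: "pathin X p \<Longrightarrow> path_homotopic X p p"
  by (simp add: path_homotopic_def pathin_def)

lemma path_homotopic_eq:
  assumes "pathin X p" "\<And>t. t \<in> {0..1} \<Longrightarrow> p t = q t"
  shows "path_homotopic X p q"
  unfolding path_homotopic_def
  by (rule homotopic_with_equal) (use assms in \<open>auto simp: pathin_def\<close>)

lemma path_homotopic_sym: "path_homotopic X p q \<Longrightarrow> path_homotopic X q p"
  using path_homotopic_ends[of X p q] unfolding path_homotopic_def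
  by (simp add: homotopic_with_sym)

lemma path_homotopic_trans:
  "path_homotopic X p q \<Longrightarrow> path_homotopic X q r \<Longrightarrow> path_homotopic X p r"
  using path_homotopic_ends[of X p q] unfolding path_homotopic_def
  by (auto intro: homotopic_with_trans)

lemma path_homotopicE:
  assumes "path_homotopic X p q"
  obtains h where "continuous_map (top_of_set ({0..1::real} \<times> {0..1::real})) X h"
    "\<And>t. h (0, t) = p t" "\<And>t. h (1, t) = q t"
    "\<And>s. s \<in> {0..1} \<Longrightarrow> h (s, 0) = p 0" "\<And>s. s \<in> {0..1} \<Longrightarrow> h (s, 1) = p 1"
  using assms unfolding path_homotopic_def homotopic_with_def by (auto simp del: atLeastAtMost_iff)

lemma path_homotopicI:
  assumes "continuous_map (top_of_set ({0..1::real} \<times> {0..1::real})) X h"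
    "\<And>t. h (0, t) = p t" "\<And>t. h (1, t) = q t"
    "\<And>s. s \<in> {0..1} \<Longrightarrow> h (s, 0) = p 0" "\<And>s. s \<in> {0..1} \<Longrightarrow> h (s, 1) = p 1"
  shows "path_homotopic X p q"
  unfolding path_homotopic_def homotopic_with_def
  by (rule exI[of _ h]) (use assms in auto)

text \<open>The straight-line homotopy between \<open>u\<close> and \<open>v\<close> stays in the
  convex set \<open>K\<close> and is then mapped by \<open>h\<close>. The reparametrisation lemmas
  below, and later the fact that a motion in a convex family depends only on its end parameters, are
  instances.\<close>

lemma path_homotopic_in_convex:
  fixes K :: "'v::real_normed_vector set"
  assumes K: "convex K" and h: "continuous_map (top_of_set K) X h"
    and u: "continuous_on {0..1} u" "u ` {0..1} \<subseteq> K"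
    and v: "continuous_on {0..1} v" "v ` {0..1} \<subseteq> K"
    and ends: "u 0 = v 0" "u 1 = v 1"
  shows "path_homotopic X (h \<circ> u) (h \<circ> v)"
proof (rule path_homotopicI)
  let ?g = "\<lambda>(s, t). (1 - s) *\<^sub>R u t + s *\<^sub>R v t"
  have "continuous_on ({0..1} \<times> {0..1}) ?g"
    unfolding case_prod_unfold
    by (intro continuous_intros continuous_on_compose2[OF u(1)] continuous_on_compose2[OF v(1)]) auto
  moreover have "?g \<in> {0..1} \<times> {0..1} \<rightarrow> K"
    using u v K by (auto intro!: convexD)
  ultimately have "continuous_map (top_of_set ({0..1} \<times> {0..1})) (top_of_set K) ?g"
    by (simp add: continuous_map_in_subtopology image_subset_iff_funcset)
  from continuous_map_compose[OF this h]
  show "continuous_map (top_of_set ({0..1} \<times> {0..1})) X (h \<circ> ?g)" .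
  show "(h \<circ> ?g) (s, 0) = (h \<circ> u) 0" "(h \<circ> ?g) (s, 1) = (h \<circ> u) 1" for s
    using ends by (simp_all add: algebra_simps flip: scaleR_add_left)
qed auto

lemma loop_join_ends [simp]: "loop_join p q 0 = p 0" "loop_join p q 1 = q 1"
  by (auto simp: loop_join_def)

lemma path_rev_ends [simp]: "path_rev p 0 = p 1" "path_rev p 1 = p 0"
  by (auto simp: path_rev_def)

lemma comp_loop_join: "h \<circ> loop_join p q = loop_join (h \<circ> p) (h \<circ> q)"
  by (auto simp: loop_join_def)

lemma comp_path_rev: "h \<circ> path_rev p = path_rev (h \<circ> p)"
  by (auto simp: path_rev_def)

lemma pathin_comp:
  assumes "continuous_map (top_of_set K) X h" "continuous_on {0..1} u" "u ` {0..1} \<subseteq> K"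
  shows "pathin X (h \<circ> u)"
  unfolding pathin_def
  by (rule continuous_map_compose[OF _ assms(1)])
    (use assms in \<open>auto simp: continuous_map_in_subtopology\<close>)

lemma continuous_map_join_pieces:
  fixes S :: "'v::real_normed_vector set" and f :: "'v \<Rightarrow> real"
  assumes f: "continuous_on S f"
    and g: "continuous_map (top_of_set {x \<in> S. f x \<le> c}) X g"
    and h: "continuous_map (top_of_set {x \<in> S. c \<le> f x}) X h"
    and gh: "\<And>x. x \<in> S \<Longrightarrow> f x = c \<Longrightarrow> g x = h x"
  shows "continuous_map (top_of_set S) X (\<lambda>x. if f x \<le> c then g x else h x)"
proof (rule continuous_map_cases_le)
  show "continuous_map (top_of_set S) euclideanreal f"
    using f by simp
qed (use g h gh in \<open>auto simp: subtopology_subtopology Int_def conj_assoc\<close>)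

lemma continuous_map_top_of_set_compose:
  assumes "continuous_map (top_of_set K) X h" "continuous_on S u" "\<And>x. x \<in> S \<Longrightarrow> u x \<in> K"
  shows "continuous_map (top_of_set S) X (\<lambda>x. h (u x))"
  using continuous_map_compose[of "top_of_set S" "top_of_set K" u X h] assms
  by (auto simp: continuous_map_in_subtopology o_def)

lemma pathin_path_rev: "pathin X p \<Longrightarrow> pathin X (path_rev p)"
  unfolding pathin_def path_rev_def
  by (rule continuous_map_top_of_set_compose[where h = p and K = "{0..1}"])
    (auto intro!: continuous_intros)

lemma pathin_loop_join:
  assumes "pathin X p" "pathin X q" "p 1 = q 0"
  shows "pathin X (loop_join p q)"
  unfolding pathin_def loop_join_def
proof (rule continuous_map_join_pieces)
  show "continuous_map (top_of_set {t \<in> {0..1}. t \<le> 1/2}) X (\<lambda>t. p (2 * t))"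
    using assms(1) unfolding pathin_def
    by (rule continuous_map_top_of_set_compose) (auto intro!: continuous_intros)
  show "continuous_map (top_of_set {t \<in> {0..1}. 1/2 \<le> t}) X (\<lambda>t. q (2 * t - 1))"
    using assms(2) unfolding pathin_def
    by (rule continuous_map_top_of_set_compose) (auto intro!: continuous_intros)
  show "p (2 * t) = q (2 * t - 1)" if "t = 1/2" for t
    unfolding that using assms by simp
qed auto

lemma path_homotopic_join:
  assumes "path_homotopic X p p'" "path_homotopic X q q'" "p 1 = q 0"
  shows "path_homotopic X (loop_join p q) (loop_join p' q')"
proof -
  obtain h where h: "continuous_map (top_of_set ({0..1::real} \<times> {0..1::real})) X h"
    "\<And>t. h (0::real, t) = p t" "\<And>t. h (1, t) = p' t"
    "\<And>s. s \<in> {0..1} \<Longrightarrow> h (s, 0) = p 0" "\<And>s. s \<in> {0..1} \<Longrightarrow> h (s, 1) = p 1"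
    using path_homotopicE[OF assms(1)] by metis
  obtain k where k: "continuous_map (top_of_set ({0..1::real} \<times> {0..1::real})) X k"
    "\<And>t. k (0::real, t) = q t" "\<And>t. k (1, t) = q' t"
    "\<And>s. s \<in> {0..1} \<Longrightarrow> k (s, 0) = q 0" "\<And>s. s \<in> {0..1} \<Longrightarrow> k (s, 1) = q 1"
    using path_homotopicE[OF assms(2)] by metis
  let ?m = "\<lambda>x. if snd x \<le> 1/2 then h (fst x, 2 * snd x) else k (fst x, 2 * snd x - 1)"
  show ?thesis
  proof (rule path_homotopicI)
    show "continuous_map (top_of_set ({0..1} \<times> {0..1})) X ?m"
    proof (rule continuous_map_join_pieces)
      show "continuous_map (top_of_set {x \<in> {0..1} \<times> {0..1}. snd x \<le> 1/2}) X (\<lambda>x. h (fst x, 2 * snd x))"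
        using h(1) by (rule continuous_map_top_of_set_compose) (auto intro!: continuous_intros)
      show "continuous_map (top_of_set {x \<in> {0..1} \<times> {0..1}. 1/2 \<le> snd x}) X (\<lambda>x. k (fst x, 2 * snd x - 1))"
        using k(1) by (rule continuous_map_top_of_set_compose) (auto intro!: continuous_intros)
      show "h (fst x, 2 * snd x) = k (fst x, 2 * snd x - 1)"
        if "x \<in> {0..1} \<times> {0..1}" "snd x = 1/2" for x
        unfolding that(2) using that(1) h k assms(3) by auto
    qed (auto intro!: continuous_intros)
  qed (use h k in \<open>auto simp: loop_join_def\<close>)
qed

lemma path_homotopic_reparam:
  assumes "pathin X p" "continuous_on {0..1} u" "u ` {0..1} \<subseteq> {0..1}"
    "continuous_on {0..1} v" "v ` {0..1} \<subseteq> {0..1}" "u 0 = v 0" "u 1 = v 1"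
  shows "path_homotopic X (p \<circ> u) (p \<circ> v)"
  using assms by (intro path_homotopic_in_convex[of "{0..1::real}"]) (auto simp: pathin_def)

lemma path_homotopic_assoc:
  assumes "pathin X p" "pathin X q" "pathin X r" "p 1 = q 0" "q 1 = r 0"
  shows "path_homotopic X (loop_join (loop_join p q) r) (loop_join p (loop_join q r))"
proof -
  let ?P = "loop_join p (loop_join q r)"
  \<comment> \<open>Piecewise linear with slopes 2, 1, 1/2: it carries the times 1/4 and 1/2 of
    \<open>(p q) r\<close> to the times 1/2 and 3/4 of \<open>p (q r)\<close>. Being concave, it is
    a minimum of three lines.\<close>
  let ?u = "\<lambda>t::real. min (2 * t) (min (t + 1/4) ((t + 1) / 2))"
  have P: "pathin X ?P"
    using assms by (intro pathin_loop_join) auto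
  have "path_homotopic X (?P \<circ> ?u) (?P \<circ> (\<lambda>t. t))"
    by (rule path_homotopic_reparam[OF P])
      (auto intro!: continuous_intros simp: min_le_iff_disj)
  moreover have "?P \<circ> ?u = loop_join (loop_join p q) r"
  proof
    fix t :: real
    consider "t \<le> 1/4" | "1/4 < t" "t \<le> 1/2" | "1/2 < t" by linarith
    then show "(?P \<circ> ?u) t = loop_join (loop_join p q) r t"
      by cases (auto simp: loop_join_def min_def intro!: arg_cong[where f = p] arg_cong[where f = q]
          arg_cong[where f = r])
  qed
  ultimately show ?thesis
    by (simp add: o_def)
qed

lemma path_homotopic_const_left:
  assumes "pathin X p" "c = p 0"
  shows "path_homotopic X (loop_join (\<lambda>_. c) p) p"
proof -
  let ?u = "\<lambda>t::real. max 0 (2 * t - 1)"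
  have "path_homotopic X (p \<circ> ?u) (p \<circ> (\<lambda>t. t))"
    by (rule path_homotopic_reparam[OF assms(1)])
      (auto intro!: continuous_intros)
  moreover have "p \<circ> ?u = loop_join (\<lambda>_. c) p"
    by (auto simp: loop_join_def assms max_def min_def o_def fun_eq_iff intro!: arg_cong[where f = p])
  ultimately show ?thesis
    by (simp add: o_def)
qed

lemma path_homotopic_const_right:
  assumes "pathin X p" "c = p 1"
  shows "path_homotopic X (loop_join p (\<lambda>_. c)) p"
proof -
  let ?u = "\<lambda>t::real. min (2 * t) 1"
  have "path_homotopic X (p \<circ> ?u) (p \<circ> (\<lambda>t. t))"
    by (rule path_homotopic_reparam[OF assms(1)])
      (auto intro!: continuous_intros)
  moreover have "p \<circ> ?u = loop_join p (\<lambda>_. c)"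
    by (auto simp: loop_join_def assms max_def min_def o_def fun_eq_iff intro!: arg_cong[where f = p])
  ultimately show ?thesis
    by (simp add: o_def)
qed

lemma path_homotopic_rev_left:
  assumes "pathin X p"
  shows "path_homotopic X (loop_join (path_rev p) p) (\<lambda>_. p 1)"
proof -
  \<comment> \<open>The folded parameter runs from 1 to 0 and back, so it can be deformed to the
    constant 1.\<close>
  let ?u = "\<lambda>t::real. \<bar>2 * t - 1\<bar>"
  have "path_homotopic X (p \<circ> ?u) (p \<circ> (\<lambda>t. 1))"
    by (rule path_homotopic_reparam[OF assms(1)])
      (auto intro!: continuous_intros)
  moreover have "p \<circ> ?u = loop_join (path_rev p) p"
    by (auto simp: loop_join_def path_rev_def abs_if o_def fun_eq_iff intro!: arg_cong[where f = p])
  ultimately show ?thesis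
    by (simp add: o_def)
qed

section \<open>From homomorphisms of the fundamental group to functors on paths\<close>

lemma loop_homotopic_iff:
  "f \<in> loops_at X a \<Longrightarrow> loop_homotopic X a f g \<longleftrightarrow> path_homotopic X f g"
  by (simp add: loop_homotopic_def path_homotopic_def loops_at_def)

lemma loop_class_iff:
  "f \<in> loops_at X a \<Longrightarrow> g \<in> loop_class X a f \<longleftrightarrow> path_homotopic X f g"
  using path_homotopic_ends[of X f g] path_homotopic_pathin[of X f g]
  by (auto simp: loop_class_def loop_homotopic_iff) (auto simp: loops_at_def)

lemma loop_class_eqI:
  assumes "f \<in> loops_at X a" "path_homotopic X f g"
  shows "loop_class X a f = loop_class X a g"
proof -
  have g: "g \<in> loops_at X a"
    using assms path_homotopic_ends[of X f g] path_homotopic_pathin[of X f g]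
    by (auto simp: loops_at_def)
  have "path_homotopic X f h \<longleftrightarrow> path_homotopic X g h" for h
    using path_homotopic_trans[OF assms(2), of h]
      path_homotopic_trans[OF path_homotopic_sym[OF assms(2)], of h] by blast
  then show ?thesis
    by (simp add: set_eq_iff loop_class_iff[OF g] loop_class_iff[OF assms(1)])
qed

lemma loop_class_self: "f \<in> loops_at X a \<Longrightarrow> f \<in> loop_class X a f"
  by (simp add: loop_class_iff path_homotopic_refl) (simp add: loops_at_def path_homotopic_refl)

lemma loop_join_loops_at:
  "f \<in> loops_at X a \<Longrightarrow> g \<in> loops_at X a \<Longrightarrow> loop_join f g \<in> loops_at X a"
  by (simp add: loops_at_def pathin_loop_join)

lemma loop_class_mult:
  assumes f: "f \<in> loops_at X a" and g: "g \<in> loops_at X a"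
  shows "loop_class X a f \<otimes>\<^bsub>fundamental_group X a\<^esub> loop_class X a g
       = loop_class X a (loop_join f g)"
proof -
  have "loop_class X a (loop_join f' g') = loop_class X a (loop_join f g)"
    if "f' \<in> loop_class X a f" "g' \<in> loop_class X a g" for f' g'
  proof -
    have "path_homotopic X (loop_join f g) (loop_join f' g')"
      using that f g unfolding loop_class_iff[OF f] loop_class_iff[OF g]
      by (intro path_homotopic_join) (simp_all add: loops_at_def)
    then show ?thesis
      using loop_class_eqI[OF loop_join_loops_at[OF f g]] by simp
  qed
  then have "(\<Union>f'\<in>loop_class X a f. \<Union>g'\<in>loop_class X a g. loop_class X a (loop_join f' g'))
      = loop_class X a (loop_join f g)"
    using loop_class_self[OF f] loop_class_self[OF g] by blast
  then show ?thesis
    by (simp add: fundamental_group_def)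
qed

lemma pi1_map_loop_class:
  assumes f: "f \<in> loops_at X a" and c: "continuous_map X Y c"
  shows "pi1_map Y c a (loop_class X a f) = loop_class Y (c a) (c \<circ> f)"
proof -
  have cf: "c \<circ> f \<in> loops_at Y (c a)"
    using f continuous_map_compose[OF _ c, of _ f] by (auto simp: loops_at_def pathin_def)
  have "loop_class Y (c a) (c \<circ> f') = loop_class Y (c a) (c \<circ> f)" if "f' \<in> loop_class X a f" for f'
  proof (rule loop_class_eqI[OF cf, symmetric])
    have "path_homotopic X f f'"
      using that f by (simp add: loop_class_iff)
    then show "path_homotopic Y (c \<circ> f) (c \<circ> f')"
      unfolding path_homotopic_def by (rule homotopic_with_compose_continuous_map_left[OF _ c]) auto
  qed
  then show ?thesis
    using loop_class_self[OF f] unfolding pi1_map_def by blast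
qed

lemma path_homotopic_cancel:
  assumes g: "pathin X g" and r: "pathin X r" and gr: "g 1 = r 0"
  shows "path_homotopic X (loop_join (path_rev g) (loop_join g r)) r"
proof -
  have "path_homotopic X (loop_join (loop_join (path_rev g) g) r) (loop_join (\<lambda>_. g 1) r)"
    using assms by (intro path_homotopic_join path_homotopic_rev_left path_homotopic_refl) auto
  then have "path_homotopic X (loop_join (loop_join (path_rev g) g) r) r"
    using path_homotopic_const_left[OF r gr] path_homotopic_trans by blast
  moreover have "path_homotopic X (loop_join (loop_join (path_rev g) g) r)
      (loop_join (path_rev g) (loop_join g r))"
    using assms by (intro path_homotopic_assoc) (auto intro: pathin_path_rev)
  ultimately show ?thesis
    by (rule path_homotopic_trans[OF path_homotopic_sym, rotated])
qed

lemma path_homotopic_conjugate_join: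
  assumes paths: "pathin X p" "pathin X q" "pathin X g0" "pathin X g1" "pathin X g2"
    and ends: "g0 1 = p 0" "p 1 = q 0" "g1 1 = q 0" "g2 1 = q 1" "g0 0 = g1 0" "g1 0 = g2 0"
  shows "path_homotopic X
    (loop_join (loop_join g0 (loop_join p (path_rev g1))) (loop_join g1 (loop_join q (path_rev g2))))
    (loop_join g0 (loop_join (loop_join p q) (path_rev g2)))"
proof -
  note [simp] = pathin_loop_join pathin_path_rev path_homotopic_refl
  let ?z = "loop_join q (path_rev g2)"
  have z: "pathin X ?z"
    using paths ends by simp
  have "path_homotopic X (loop_join (loop_join g0 (loop_join p (path_rev g1))) (loop_join g1 ?z))
      (loop_join g0 (loop_join (loop_join p (path_rev g1)) (loop_join g1 ?z)))"
    using paths ends by (intro path_homotopic_assoc) simp_all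
  moreover have "path_homotopic X (loop_join g0 (loop_join (loop_join p (path_rev g1)) (loop_join g1 ?z)))
      (loop_join g0 (loop_join p (loop_join (path_rev g1) (loop_join g1 ?z))))"
    using paths ends by (intro path_homotopic_join path_homotopic_assoc) simp_all
  moreover have "path_homotopic X (loop_join g0 (loop_join p (loop_join (path_rev g1) (loop_join g1 ?z))))
      (loop_join g0 (loop_join p ?z))"
    using paths ends z by (intro path_homotopic_join path_homotopic_cancel) simp_all
  moreover have "path_homotopic X (loop_join g0 (loop_join p ?z))
      (loop_join g0 (loop_join (loop_join p q) (path_rev g2)))"
    using paths ends by (intro path_homotopic_join path_homotopic_sym[OF path_homotopic_assoc]) simp_all
  ultimately show ?thesis
    by (rule path_homotopic_trans[OF path_homotopic_trans[OF path_homotopic_trans]])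
qed

text \<open>A path is closed up to a loop by chosen base paths to its two ends, and
  \<open>\<phi>\<close> is applied to the loop; in a product the inner base paths cancel. The base
  paths \<open>\<gamma>\<close> over \<open>R\<close> are prescribed, so that later a path inside
  the embedded disc can be closed up inside it.\<close>

lemma pi1_hom_extends_to_paths:
  fixes F (structure)
  assumes F: "group F" and \<phi>: "\<phi> \<in> hom (fundamental_group X b) F"
    and R: "\<And>c. c \<in> R \<Longrightarrow> pathin X (\<gamma> c) \<and> \<gamma> c 0 = b \<and> \<gamma> c 1 = c"
  obtains \<Phi> where
    "\<And>p. pathin X p \<Longrightarrow> \<Phi> p \<in> carrier F"
    "\<And>p q. pathin X p \<Longrightarrow> pathin X q \<Longrightarrow> p 1 = q 0 \<Longrightarrow> \<Phi> (loop_join p q) = \<Phi> p \<otimes> \<Phi> q"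
    "\<And>p q. path_homotopic X p q \<Longrightarrow> \<Phi> p = \<Phi> q"
    "\<And>p. pathin X p \<Longrightarrow> p 0 \<in> R \<Longrightarrow> p 1 \<in> R \<Longrightarrow>
       \<Phi> p = \<phi> (loop_class X b (loop_join (\<gamma> (p 0)) (loop_join p (path_rev (\<gamma> (p 1))))))"
proof -
  interpret group F by fact
  define good where "good c g \<longleftrightarrow> pathin X g \<and> g 0 = b \<and> g 1 = c" for c g
  define \<delta> where "\<delta> c = (if c \<in> R then \<gamma> c else SOME g. good c g)" for c
  have \<delta>: "good c (\<delta> c)" if "\<exists>g. good c g" for c
    using R[of c] someI_ex[OF that] by (cases "c \<in> R") (simp_all add: \<delta>_def good_def[of c "\<gamma> c"])
  define lift where "lift p = loop_join (\<delta> (p 0)) (loop_join p (path_rev (\<delta> (p 1))))" for p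
  \<comment> \<open>Paths that cannot be reached from \<open>b\<close> get the value
    \<open>\<one>\<close>. Both ends of a path lie in the same path component, so this default is
    compatible with joins.\<close>
  define \<Phi> where "\<Phi> p = (if \<exists>g. good (p 0) g then \<phi> (loop_class X b (lift p)) else \<one>)" for p
  have good_iff: "(\<exists>g. good (p 0) g) \<longleftrightarrow> (\<exists>g. good (p 1) g)" if "pathin X p" for p
  proof
    assume "\<exists>g. good (p 0) g"
    then obtain g where "good (p 0) g" ..
    then have "good (p 1) (loop_join g p)"
      using that by (auto simp: good_def pathin_loop_join)
    then show "\<exists>g. good (p 1) g"
      by auto
  next
    assume "\<exists>g. good (p 1) g"
    then obtain g where "good (p 1) g" ..
    then have "good (p 0) (loop_join g (path_rev p))"
      using that by (auto simp: good_def pathin_loop_join pathin_path_rev)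
    then show "\<exists>g. good (p 0) g"
      by auto
  qed
  have lift: "lift p \<in> loops_at X b" if "pathin X p" "\<exists>g. good (p 0) g" for p
    using \<delta>[OF that(2)] \<delta>[of "p 1"] that good_iff[OF that(1)]
    unfolding lift_def loops_at_def good_def
    by (auto intro!: pathin_loop_join pathin_path_rev)
  have closed: "\<Phi> p \<in> carrier F" if "pathin X p" for p
    using hom_in_carrier[OF \<phi>] lift[OF that] by (auto simp: \<Phi>_def fundamental_group_def)
  have mult: "\<Phi> (loop_join p q) = \<Phi> p \<otimes> \<Phi> q" if pq: "pathin X p" "pathin X q" "p 1 = q 0" for p q
  proof (cases "\<exists>g. good (p 0) g")
    case True
    then have True': "\<exists>g. good (q 0) g"
      using good_iff[OF pq(1)] pq(3) by simp
    have "path_homotopic X (loop_join (lift p) (lift q)) (lift (loop_join p q))"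
      unfolding lift_def pq(3) loop_join_ends
      using \<delta>[OF True] \<delta>[OF True'] \<delta>[of "q 1"] True' good_iff[OF pq(2)] pq
      by (intro path_homotopic_conjugate_join) (auto simp: good_def)
    then have "\<phi> (loop_class X b (lift (loop_join p q))) = \<phi> (loop_class X b (loop_join (lift p) (lift q)))"
      using loop_class_eqI[OF loop_join_loops_at[OF lift[OF pq(1) True] lift[OF pq(2) True']]] by simp
    also have "\<dots> = \<phi> (loop_class X b (lift p)) \<otimes> \<phi> (loop_class X b (lift q))"
      unfolding loop_class_mult[OF lift[OF pq(1) True] lift[OF pq(2) True'], symmetric]
      using lift pq True True' by (intro hom_mult[OF \<phi>]) (auto simp: fundamental_group_def)
    finally show ?thesis
      using True True' by (simp add: \<Phi>_def)
  next
    case False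
    then show ?thesis
      using good_iff[OF pq(1)] pq(3) by (simp add: \<Phi>_def)
  qed
  have homotopic: "\<Phi> p = \<Phi> q" if "path_homotopic X p q" for p q
  proof (cases "\<exists>g. good (p 0) g")
    case True
    note paths = path_homotopic_pathin[OF that] and ends = path_homotopic_ends[OF that]
    have "path_homotopic X (lift p) (lift q)"
      unfolding lift_def ends
      using that \<delta>[OF True] \<delta>[of "p 1"] True good_iff[OF paths(1)] paths
      by (intro path_homotopic_join path_homotopic_refl) (auto simp: good_def pathin_path_rev)
    then show ?thesis
      using loop_class_eqI[OF lift[OF paths(1) True]] True ends by (simp add: \<Phi>_def)
  qed (use path_homotopic_ends[OF that] in \<open>simp add: \<Phi>_def\<close>)
  have base: "\<Phi> p = \<phi> (loop_class X b (loop_join (\<gamma> (p 0)) (loop_join p (path_rev (\<gamma> (p 1))))))"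
    if "pathin X p" "p 0 \<in> R" "p 1 \<in> R" for p
  proof -
    have "good (p 0) (\<gamma> (p 0))"
      using R[OF that(2)] by (simp add: good_def)
    then show ?thesis
      using that unfolding \<Phi>_def lift_def by (auto simp: \<delta>_def)
  qed
  show thesis
    by (rule that[of \<Phi>]) (fact closed mult homotopic base)+
qed

section \<open>Unordered configurations as finite sets\<close>

text \<open>An orbit of tuples is the set of all enumerations of one finite set. This passes from
  the set to the orbit, so that configurations can be written as sets without labels.\<close>

definition conf_of :: "nat \<Rightarrow> 'a set \<Rightarrow> (nat \<Rightarrow> 'a) set" where
  "conf_of n A = {x \<in> extensional {1..n}. bij_betw x {1..n} A}"

lemma sym_orbit_eq_conf_of:
  assumes x: "x \<in> extensional {1..n}" "inj_on x {1..n}"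
  shows "sym_orbit n x = conf_of n (x ` {1..n})"
proof (intro equalityI subsetI)
  fix y assume "y \<in> sym_orbit n x"
  then obtain p where p: "p permutes {1..n}" "y = x \<circ> p"
    by (auto simp: sym_orbit_def)
  have "y k = undefined" if "k \<notin> {1..n}" for k
    by (simp only: p(2) o_apply permutes_not_in[OF p(1) that] extensional_arb[OF x(1) that])
  then show "y \<in> conf_of n (x ` {1..n})"
    using bij_betw_trans[OF permutes_imp_bij[OF p(1)] inj_on_imp_bij_betw[OF x(2)]] p(2)
    by (simp add: conf_of_def extensional_def)
next
  fix y assume "y \<in> conf_of n (x ` {1..n})"
  then have y: "y \<in> extensional {1..n}" "bij_betw y {1..n} (x ` {1..n})"
    by (auto simp: conf_of_def)
  define p where "p = (\<lambda>k. if k \<in> {1..n} then inv_into {1..n} x (y k) else k)"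
  have "bij_betw (inv_into {1..n} x) (x ` {1..n}) {1..n}"
    by (rule bij_betw_inv_into[OF inj_on_imp_bij_betw[OF x(2)]])
  from bij_betw_trans[OF y(2) this] have "bij_betw p {1..n} {1..n}"
    by (rule bij_betw_cong[THEN iffD1, rotated]) (simp add: p_def)
  then have "p permutes {1..n}"
    by (rule bij_imp_permutes) (auto simp: p_def)
  moreover have "y = x \<circ> p"
  proof
    fix k
    show "y k = (x \<circ> p) k"
    proof (cases "k \<in> {1..n}")
      case True
      then have yk: "y k \<in> x ` {1..n}" and pk: "p k = inv_into {1..n} x (y k)"
        using bij_betwE[OF y(2)] by (blast, simp only: p_def if_True)
      show ?thesis
        by (simp only: o_apply pk f_inv_into_f[OF yk])
    next
      case False
      then have pk: "p k = k"
        unfolding p_def by (rule if_not_P)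
      show ?thesis
        by (simp only: o_apply pk extensional_arb[OF x(1) False] extensional_arb[OF y(1) False])
    qed
  qed
  ultimately show "y \<in> sym_orbit n x"
    by (auto simp: sym_orbit_def)
qed

text \<open>A labelling of the moving points lifts the map to ordered configurations, where
  continuity is coordinatewise.\<close>

lemma continuous_map_conf_of:
  assumes I: "finite I" "card I = n"
    and x: "\<And>i. i \<in> I \<Longrightarrow> continuous_map T X (\<lambda>u. x u i)"
    and inj: "\<And>u. u \<in> topspace T \<Longrightarrow> inj_on (x u) I"
  shows "continuous_map T (unordered_conf n X) (\<lambda>u. conf_of n (x u ` I))"
proof -
  obtain b where b: "bij_betw b {1..n} I"
    using ex_bij_betw_nat_finite_1[OF I(1)] I(2) by auto
  define z where "z u = (\<lambda>k\<in>{1..n}. x u (b k))" for u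
  have z_inj: "inj_on (z u) {1..n}" if "u \<in> topspace T" for u
  proof -
    have "inj_on (x u \<circ> b) {1..n}"
      using comp_inj_on[OF bij_betw_imp_inj_on[OF b]] inj[OF that] bij_betw_imp_surj_on[OF b] by metis
    then show ?thesis
      by (rule inj_on_cong[THEN iffD1, rotated]) (simp add: z_def)
  qed
  have "continuous_map T (product_topology (\<lambda>_. X) {1..n}) z"
    unfolding continuous_map_componentwise
  proof (intro conjI ballI)
    fix k assume "k \<in> {1..n}"
    then have "b k \<in> I" "(\<lambda>u. z u k) = (\<lambda>u. x u (b k))"
      using b by (auto simp: bij_betw_def z_def)
    then show "continuous_map T X (\<lambda>u. z u k)"
      using x by simp
  qed (auto simp: z_def)
  then have "continuous_map T (ordered_conf n X) z"
    using z_inj by (auto simp: ordered_conf_def continuous_map_in_subtopology)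
  then have "continuous_map T (unordered_conf n X) (sym_orbit n \<circ> z)"
    using quotient_imp_continuous_map[OF quotient_map_quotient_topology]
    unfolding unordered_conf_def by (rule continuous_map_compose)
  moreover have "(sym_orbit n \<circ> z) u = conf_of n (x u ` I)" if "u \<in> topspace T" for u
  proof -
    have "z u ` {1..n} = x u ` I"
      using bij_betw_imp_surj_on[OF b] by (auto simp: z_def)
    moreover have "z u \<in> extensional {1..n}"
      unfolding z_def by (rule restrict_extensional)
    ultimately show ?thesis
      using sym_orbit_eq_conf_of[OF _ z_inj[OF that]] by (simp only: o_apply)
  qed
  ultimately show ?thesis
    by (rule continuous_map_eq)
qed

section \<open>Functors on paths of configurations\<close>

text \<open>A functor from the fundamental groupoid of \<open>X\<close> to the group
  \<open>F\<close>, stated on paths.\<close>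

locale path_rep = group F for F :: "'f monoid" (structure) and X :: "'a topology" and \<Phi> :: "(real \<Rightarrow> 'a) \<Rightarrow> 'f" +
  assumes \<Phi>_closed: "pathin X p \<Longrightarrow> \<Phi> p \<in> carrier F"
    and \<Phi>_join: "pathin X p \<Longrightarrow> pathin X q \<Longrightarrow> p 1 = q 0 \<Longrightarrow> \<Phi> (loop_join p q) = \<Phi> p \<otimes> \<Phi> q"
    and \<Phi>_homotopic: "path_homotopic X p q \<Longrightarrow> \<Phi> p = \<Phi> q"
begin

definition seg :: "('v::real_normed_vector \<Rightarrow> 'a) \<Rightarrow> 'v \<Rightarrow> 'v \<Rightarrow> 'f" where
  "seg h u v = \<Phi> (\<lambda>t. h ((1 - t) *\<^sub>R u + t *\<^sub>R v))"

lemma \<Phi>_cong: "pathin X p \<Longrightarrow> (\<And>t. t \<in> {0..1} \<Longrightarrow> p t = q t) \<Longrightarrow> \<Phi> p = \<Phi> q"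
  by (rule \<Phi>_homotopic) (rule path_homotopic_eq)

context
  fixes K :: "'v::real_normed_vector set" and h
  assumes K: "convex K" and h: "continuous_map (top_of_set K) X h"
begin

lemma segment_in_convex:
  assumes "u \<in> K" "v \<in> K"
  shows "continuous_on {0..1::real} (\<lambda>t. (1 - t) *\<^sub>R u + t *\<^sub>R v)"
    "(\<lambda>t. (1 - t) *\<^sub>R u + t *\<^sub>R v) ` {0..1::real} \<subseteq> K"
  using assms K by (auto intro!: continuous_intros convexD)

lemma pathin_seg: "u \<in> K \<Longrightarrow> v \<in> K \<Longrightarrow> pathin X (\<lambda>t. h ((1 - t) *\<^sub>R u + t *\<^sub>R v))"
  using pathin_comp[OF h segment_in_convex] by (simp add: o_def)

text \<open>In a family over a convex set, two parameter paths with the same ends are homotopic, so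
  the value depends on the end parameters alone. Thus \<open>seg\<close> is a cocycle on
  \<open>K\<close>, the form in which most homotopies are used from here on.\<close>

lemma \<Phi>_path:
  assumes u: "continuous_on {0..1} u" "u ` {0..1} \<subseteq> K"
  shows "\<Phi> (h \<circ> u) = seg h (u 0) (u 1)"
proof -
  have "u 0 \<in> K" "u 1 \<in> K"
    using u by auto
  then have "path_homotopic X (h \<circ> u) (h \<circ> (\<lambda>t. (1 - t) *\<^sub>R u 0 + t *\<^sub>R u 1))"
    by (intro path_homotopic_in_convex[OF K h u segment_in_convex]) auto
  then show ?thesis
    using \<Phi>_homotopic by (auto simp: seg_def o_def)
qed

lemma seg_closed: "u \<in> K \<Longrightarrow> v \<in> K \<Longrightarrow> seg h u v \<in> carrier F"
  unfolding seg_def by (intro \<Phi>_closed pathin_seg)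

lemma seg_mult:
  assumes "u \<in> K" "v \<in> K" "w \<in> K"
  shows "seg h u v \<otimes> seg h v w = seg h u w"
proof -
  let ?p = "\<lambda>u v t. (1 - t) *\<^sub>R u + t *\<^sub>R v :: 'v"
  have "seg h u v \<otimes> seg h v w = \<Phi> (loop_join (h \<circ> ?p u v) (h \<circ> ?p v w))"
    using pathin_seg assms by (subst \<Phi>_join) (auto simp: seg_def o_def)
  also have "\<dots> = \<Phi> (h \<circ> (?p u v +++ ?p v w))"
    by (simp add: loop_join_def joinpaths_def o_def if_distrib)
  also have "\<dots> = seg h ((?p u v +++ ?p v w) 0) ((?p u v +++ ?p v w) 1)"
  proof (rule \<Phi>_path)
    have path: "path (?p a b)" if "a \<in> K" "b \<in> K" for a b
      using segment_in_convex[OF that] by (simp add: path_def)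
    have "path (?p u v +++ ?p v w)"
      using path assms by (intro path_join_imp) (auto simp: pathfinish_def pathstart_def)
    then show "continuous_on {0..1} (?p u v +++ ?p v w)"
      by (simp add: path_def)
    show "(?p u v +++ ?p v w) ` {0..1} \<subseteq> K"
      using segment_in_convex(2) assms path_image_join_subset[of "?p u v" "?p v w"]
      unfolding path_image_def by blast
  qed
  finally show ?thesis
    by (simp add: joinpaths_def)
qed

lemma seg_refl: "u \<in> K \<Longrightarrow> seg h u u = \<one>"
  using seg_mult[of u u u] seg_closed[of u u] by (metis r_cancel_one)

lemma seg_inv:
  assumes "u \<in> K" "v \<in> K"
  shows "seg h v u = inv (seg h u v)"
  using seg_mult[of v u v] seg_refl assms seg_closed by (metis inv_equality)

end

lemma seg_cong:
  assumes "convex K" "continuous_map (top_of_set K) X h" "u \<in> K" "v \<in> K"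
    and "\<And>t. t \<in> {0..1} \<Longrightarrow> h ((1 - t) *\<^sub>R u + t *\<^sub>R v) = h' ((1 - t) *\<^sub>R u' + t *\<^sub>R v')"
  shows "seg h u v = seg h' u' v'"
  unfolding seg_def by (rule \<Phi>_cong[OF pathin_seg]) (use assms in auto)

end

section \<open>Moving finite sets of points\<close>

text \<open>The labelling is hidden on purpose: a family can return to the same set of points with
  the points exchanged, as the period of a half turn requires.\<close>

definition moving_set :: "'a topology \<Rightarrow> nat \<Rightarrow> 'v topology \<Rightarrow> ('v \<Rightarrow> 'a set) \<Rightarrow> bool" where
  "moving_set X m T A \<longleftrightarrow> (\<exists>(I::nat set) x. finite I \<and> card I = m \<and>
     (\<forall>i\<in>I. continuous_map T X (\<lambda>u. x u i)) \<and>
     (\<forall>u\<in>topspace T. inj_on (x u) I \<and> A u = x u ` I))"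

lemma moving_setI:
  assumes "finite (I::nat set)" "card I = m" "\<And>i. i \<in> I \<Longrightarrow> continuous_map T X (\<lambda>u. x u i)"
    "\<And>u. u \<in> topspace T \<Longrightarrow> inj_on (x u) I" "\<And>u. u \<in> topspace T \<Longrightarrow> A u = x u ` I"
  shows "moving_set X m T A"
  unfolding moving_set_def using assms by (intro exI[of _ I] exI[of _ x]) blast

lemma moving_setE:
  assumes "moving_set X m T A"
  obtains I :: "nat set" and x where "finite I" "card I = m"
    "\<And>i. i \<in> I \<Longrightarrow> continuous_map T X (\<lambda>u. x u i)"
    "\<And>u. u \<in> topspace T \<Longrightarrow> inj_on (x u) I" "\<And>u. u \<in> topspace T \<Longrightarrow> A u = x u ` I"
  using assms unfolding moving_set_def by blast

lemma moving_set_const: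
  assumes "finite Q" "card Q = m" "Q \<subseteq> topspace X"
  shows "moving_set X m T (\<lambda>_. Q)"
proof -
  obtain b where b: "bij_betw b {0..<m} Q"
    using ex_bij_betw_nat_finite[OF assms(1)] assms(2) by blast
  show ?thesis
  proof (rule moving_setI[of "{0..<m}" _ _ _ "\<lambda>_. b"])
    show "continuous_map T X (\<lambda>u. b i)" if "i \<in> {0..<m}" for i
      using bij_betwE[OF b] that assms(3) by auto
  qed (use b in \<open>simp_all add: bij_betw_imp_inj_on bij_betw_imp_surj_on\<close>)
qed

lemma moving_set_insert:
  assumes "moving_set X m T A" and p: "continuous_map T X p"
    and pA: "\<And>u. u \<in> topspace T \<Longrightarrow> p u \<notin> A u"
  shows "moving_set X (Suc m) T (\<lambda>u. insert (p u) (A u))"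
proof -
  obtain I :: "nat set" and x where x: "finite I" "card I = m"
    "\<And>i. i \<in> I \<Longrightarrow> continuous_map T X (\<lambda>u. x u i)"
    "\<And>u. u \<in> topspace T \<Longrightarrow> inj_on (x u) I" "\<And>u. u \<in> topspace T \<Longrightarrow> A u = x u ` I"
    using assms(1) by (rule moving_setE) blast
  let ?y = "\<lambda>u i. case i of 0 \<Rightarrow> p u | Suc k \<Rightarrow> x u k"
  show ?thesis
  proof (rule moving_setI[of "insert 0 (Suc ` I)" _ _ _ ?y])
    show "card (insert 0 (Suc ` I)) = Suc m"
      using x(1,2) by (subst card_insert_disjoint) (auto simp: card_image)
    show "continuous_map T X (\<lambda>u. ?y u i)" if "i \<in> insert 0 (Suc ` I)" for i
      using that x(3) p by auto
    show "inj_on (?y u) (insert 0 (Suc ` I))" if "u \<in> topspace T" for u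
      using x(4)[OF that] x(5)[OF that] pA[OF that] by (auto simp: inj_on_def intro: rev_image_eqI)
    show "insert (p u) (A u) = ?y u ` insert 0 (Suc ` I)" if "u \<in> topspace T" for u
      using x(5)[OF that] by (simp add: image_image)
  qed (use x(1) in simp)
qed

lemma moving_set_image:
  assumes "moving_set X m T A" and f: "continuous_map X Y f" "inj_on f (topspace X)"
  shows "moving_set Y m T (\<lambda>u. f ` A u)"
proof -
  obtain I :: "nat set" and x where x: "finite I" "card I = m"
    "\<And>i. i \<in> I \<Longrightarrow> continuous_map T X (\<lambda>u. x u i)"
    "\<And>u. u \<in> topspace T \<Longrightarrow> inj_on (x u) I" "\<And>u. u \<in> topspace T \<Longrightarrow> A u = x u ` I"
    using assms(1) by (rule moving_setE) blast
  have xX: "x u ` I \<subseteq> topspace X" if "u \<in> topspace T" for u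
    using x(3) that by (auto simp: continuous_map_def)
  show ?thesis
  proof (rule moving_setI[of I _ _ _ "\<lambda>u i. f (x u i)"])
    show "continuous_map T Y (\<lambda>u. f (x u i))" if "i \<in> I" for i
      using continuous_map_compose[OF x(3)[OF that] f(1)] by (simp add: o_def)
    show "inj_on (\<lambda>i. f (x u i)) I" if "u \<in> topspace T" for u
      using comp_inj_on[OF x(4)[OF that] inj_on_subset[OF f(2) xX[OF that]]] by (simp add: o_def)
    show "f ` A u = (\<lambda>i. f (x u i)) ` I" if "u \<in> topspace T" for u
      using x(5)[OF that] by (simp add: image_image)
  qed (use x in auto)
qed

lemma moving_set_compose:
  assumes "moving_set X m T A" and g: "continuous_map S T g"
  shows "moving_set X m S (\<lambda>u. A (g u))"
proof -
  obtain I :: "nat set" and x where x: "finite I" "card I = m"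
    "\<And>i. i \<in> I \<Longrightarrow> continuous_map T X (\<lambda>u. x u i)"
    "\<And>u. u \<in> topspace T \<Longrightarrow> inj_on (x u) I" "\<And>u. u \<in> topspace T \<Longrightarrow> A u = x u ` I"
    using assms(1) by (rule moving_setE) blast
  have gT: "g u \<in> topspace T" if "u \<in> topspace S" for u
    using g that by (auto simp: continuous_map_def)
  show ?thesis
  proof (rule moving_setI[of I _ _ _ "\<lambda>u i. x (g u) i"])
    show "continuous_map S X (\<lambda>u. x (g u) i)" if "i \<in> I" for i
      using continuous_map_compose[OF g x(3)[OF that]] by (simp add: o_def)
  qed (use x gT in auto)
qed

lemma continuous_map_moving_set:
  assumes "moving_set X n T A"
  shows "continuous_map T (unordered_conf n X) (\<lambda>u. conf_of n (A u))"
proof -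
  obtain I :: "nat set" and x where x: "finite I" "card I = n"
    "\<And>i. i \<in> I \<Longrightarrow> continuous_map T X (\<lambda>u. x u i)"
    "\<And>u. u \<in> topspace T \<Longrightarrow> inj_on (x u) I" "\<And>u. u \<in> topspace T \<Longrightarrow> A u = x u ` I"
    using assms by (rule moving_setE) blast
  have "continuous_map T (unordered_conf n X) (\<lambda>u. conf_of n (x u ` I))"
    by (rule continuous_map_conf_of) (use x in auto)
  then show ?thesis
    by (rule continuous_map_eq) (simp add: x(5))
qed

section \<open>Integer degrees of local motions\<close>

text \<open>\<open>W\<close> will be the embedded open disc. Its motions come from the Artin braid
  group, so an extension of the length function gives them values in \<open>range j\<close>; about
  motions that leave \<open>W\<close> only membership in \<open>F\<close> is known.\<close>

locale conf_rep = path_rep F "unordered_conf n S" \<Phi>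
  for F :: "'f monoid" (structure) and n and S :: "'a topology" and \<Phi> +
  fixes W :: "'a set" and j :: "int \<Rightarrow> 'f"
  assumes j: "j \<in> mon integer_group F"
    and \<Phi>_local: "moving_set S n (top_of_set {0..1}) A \<Longrightarrow> (\<And>t. t \<in> {0..1} \<Longrightarrow> A t \<subseteq> W) \<Longrightarrow>
      \<Phi> (\<lambda>t. conf_of n (A t)) \<in> range j"
begin

abbreviation moving :: "'v::real_normed_vector set \<Rightarrow> ('v \<Rightarrow> 'a set) \<Rightarrow> bool" where
  "moving K A \<equiv> moving_set S n (top_of_set K) A"

definition local_on :: "'v::real_normed_vector set \<Rightarrow> ('v \<Rightarrow> 'a set) \<Rightarrow> bool" where
  "local_on K A \<longleftrightarrow> moving K A \<and> (\<forall>u\<in>K. A u \<subseteq> W)"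

definition motion :: "('v::real_normed_vector \<Rightarrow> 'a set) \<Rightarrow> 'v \<Rightarrow> 'v \<Rightarrow> 'f" where
  "motion A = seg (\<lambda>u. conf_of n (A u))"

text \<open>The integer represented by a motion. It is meaningful if the value of the motion lies in
  \<open>range j\<close>, which \<open>j_degree\<close> ensures for local families.\<close>

definition degree :: "('v::real_normed_vector \<Rightarrow> 'a set) \<Rightarrow> 'v \<Rightarrow> 'v \<Rightarrow> int" where
  "degree A u v = inv_into UNIV j (motion A u v)"

lemma j_hom: "j \<in> hom integer_group F"
  using j by (simp add: mon_def)

lemma j_eq_iff: "j a = j b \<longleftrightarrow> a = b"
  using j by (auto simp: mon_def inj_on_def)

lemma j_closed [simp]: "j a \<in> carrier F"
  using hom_in_carrier[OF j_hom] by simp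

lemma j_add: "j (a + b) = j a \<otimes> j b"
  using hom_mult[OF j_hom, of a b] by simp

lemma j_0: "j 0 = \<one>"
  using j_add[of 0 0] by (metis add_0 j_closed r_cancel_one)

lemma moving_continuous: "moving K A \<Longrightarrow> continuous_map (top_of_set K) (unordered_conf n S) (\<lambda>u. conf_of n (A u))"
  by (rule continuous_map_moving_set)

lemma moving_subset: "moving K A \<Longrightarrow> L \<subseteq> K \<Longrightarrow> moving L A"
  using moving_set_compose[of S n "top_of_set K" A "top_of_set L" "\<lambda>x. x"] by auto

lemma moving_compose:
  "moving K A \<Longrightarrow> continuous_on L g \<Longrightarrow> g ` L \<subseteq> K \<Longrightarrow> moving L (\<lambda>u. A (g u))"
  by (rule moving_set_compose[where T = "top_of_set K"]) auto

lemma local_on_compose: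
  "local_on K A \<Longrightarrow> continuous_on L g \<Longrightarrow> g ` L \<subseteq> K \<Longrightarrow> local_on L (\<lambda>u. A (g u))"
  unfolding local_on_def using moving_compose by blast

context
  fixes K :: "'v::real_normed_vector set" and A
  assumes K: "convex K" and A: "moving K A"
begin

lemmas motion_closed = seg_closed[OF K moving_continuous[OF A], folded motion_def]
  and motion_mult = seg_mult[OF K moving_continuous[OF A], folded motion_def]
  and motion_refl = seg_refl[OF K moving_continuous[OF A], folded motion_def]
  and motion_inv = seg_inv[OF K moving_continuous[OF A], folded motion_def]
  and \<Phi>_motion = \<Phi>_path[OF K moving_continuous[OF A], folded motion_def, unfolded o_def]

lemma motion_cong:
  "u \<in> K \<Longrightarrow> v \<in> K \<Longrightarrow>
   (\<And>t. t \<in> {0..1} \<Longrightarrow> A ((1 - t) *\<^sub>R u + t *\<^sub>R v) = B ((1 - t) *\<^sub>R u' + t *\<^sub>R v')) \<Longrightarrow>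
   motion A u v = motion B u' v'"
  unfolding motion_def by (rule seg_cong[OF K moving_continuous[OF A]]) auto

lemma motion_compose:
  assumes "convex L" "continuous_on L g" "g ` L \<subseteq> K" "u \<in> L" "v \<in> L"
  shows "motion (\<lambda>u. A (g u)) u v = motion A (g u) (g v)"
proof -
  have "continuous_on {0..1::real} (\<lambda>t. g ((1 - t) *\<^sub>R u + t *\<^sub>R v))"
    by (rule continuous_on_compose2[OF assms(2)])
      (use assms in \<open>auto intro!: continuous_intros convexD\<close>)
  moreover have "(\<lambda>t. g ((1 - t) *\<^sub>R u + t *\<^sub>R v)) ` {0..1::real} \<subseteq> K"
    using assms(3) convexD[OF assms(1,4,5)] by fastforce
  ultimately show ?thesis
    using \<Phi>_motion[of "\<lambda>t. g ((1 - t) *\<^sub>R u + t *\<^sub>R v)"] by (simp add: motion_def seg_def)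
qed

end

context
  fixes K :: "'v::real_normed_vector set" and A
  assumes K: "convex K" and A: "local_on K A"
begin

lemma local_moving: "moving K A"
  using A by (simp add: local_on_def)

lemma j_degree:
  assumes "u \<in> K" "v \<in> K"
  shows "j (degree A u v) = motion A u v"
proof -
  let ?s = "\<lambda>t::real. (1 - t) *\<^sub>R u + t *\<^sub>R v"
  have "local_on {0..1} (\<lambda>t. A (?s t))"
    using assms K by (intro local_on_compose[OF A]) (auto intro!: continuous_intros convexD)
  then have "motion A u v \<in> range j"
    unfolding motion_def seg_def by (intro \<Phi>_local) (auto simp: local_on_def)
  then show ?thesis
    unfolding degree_def by (rule f_inv_into_f)
qed

lemma degree_add:
  "u \<in> K \<Longrightarrow> v \<in> K \<Longrightarrow> w \<in> K \<Longrightarrow> degree A u v + degree A v w = degree A u w"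
  using motion_mult[OF K local_moving] by (simp add: j_degree j_add flip: j_eq_iff)

lemma degree_refl: "u \<in> K \<Longrightarrow> degree A u u = 0"
  using degree_add[of u u u] by simp

lemma degree_swap: "u \<in> K \<Longrightarrow> v \<in> K \<Longrightarrow> degree A v u = - degree A u v"
  using degree_add[of u v u] degree_refl[of u] by simp

lemma \<Phi>_degree:
  assumes "continuous_on {0..1} u" "u ` {0..1} \<subseteq> K"
  shows "\<Phi> (\<lambda>t. conf_of n (A (u t))) = j (degree A (u 0) (u 1))"
proof -
  have "u 0 \<in> K" "u 1 \<in> K"
    using assms(2) by auto
  then show ?thesis
    using \<Phi>_motion[OF K local_moving assms] by (simp add: j_degree)
qed

lemma degree_cong:
  "u \<in> K \<Longrightarrow> v \<in> K \<Longrightarrow>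
   (\<And>t. t \<in> {0..1} \<Longrightarrow> A ((1 - t) *\<^sub>R u + t *\<^sub>R v) = B ((1 - t) *\<^sub>R u' + t *\<^sub>R v')) \<Longrightarrow>
   degree A u v = degree B u' v'"
  unfolding degree_def using motion_cong[OF K local_moving] by metis

lemma degree_compose:
  assumes "convex L" "continuous_on L g" "g ` L \<subseteq> K" "u \<in> L" "v \<in> L"
  shows "degree (\<lambda>u. A (g u)) u v = degree A (g u) (g v)"
  using motion_compose[OF K local_moving assms] by (simp add: degree_def)

text \<open>Moving the start from \<open>u\<close> to \<open>v\<close> is the same motion as moving
  the end from \<open>u + \<tau>\<close> to \<open>v + \<tau>\<close>, so the two contributions
  cancel.\<close>

lemma degree_period:
  assumes per: "\<And>x. x \<in> K \<Longrightarrow> A (x + \<tau>) = A x"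
    and uv: "u \<in> K" "v \<in> K" "u + \<tau> \<in> K" "v + \<tau> \<in> K"
  shows "degree A u (u + \<tau>) = degree A v (v + \<tau>)"
proof -
  have "degree A u v = degree A (u + \<tau>) (v + \<tau>)"
  proof (rule degree_cong[OF uv(1,2)])
    fix t :: real assume "t \<in> {0..1}"
    then have "(1 - t) *\<^sub>R u + t *\<^sub>R v \<in> K"
      using K uv by (auto intro: convexD)
    from per[OF this] show "A ((1 - t) *\<^sub>R u + t *\<^sub>R v) = A ((1 - t) *\<^sub>R (u + \<tau>) + t *\<^sub>R (v + \<tau>))"
      by (simp add: algebra_simps)
  qed
  then show ?thesis
    using degree_add[of u "u + \<tau>" "v + \<tau>"] degree_add[of u v "v + \<tau>"] uv by linarith
qed

lemma degree_multiple:
  assumes per: "\<And>x. x \<in> K \<Longrightarrow> A (x + \<tau>) = A x"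
    and closed: "\<And>x m. x \<in> K \<Longrightarrow> x + of_int m *\<^sub>R \<tau> \<in> K" and u: "u \<in> K"
  shows "degree A u (u + of_int m *\<^sub>R \<tau>) = m * degree A u (u + \<tau>)"
proof -
  have step: "degree A u (u + of_int (k + 1) *\<^sub>R \<tau>) = degree A u (u + of_int k *\<^sub>R \<tau>) + degree A u (u + \<tau>)" for k
  proof -
    let ?v = "u + of_int k *\<^sub>R \<tau>"
    have v: "?v \<in> K" "?v + \<tau> = u + of_int (k + 1) *\<^sub>R \<tau>" "u + \<tau> \<in> K"
      using closed[OF u] closed[OF u, of 1] by (auto simp: algebra_simps)
    then have "degree A u ?v + degree A ?v (?v + \<tau>) = degree A u (?v + \<tau>)"
      using closed[OF u, of "k + 1"] u by (intro degree_add) (simp_all only: v)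
    moreover have "degree A ?v (?v + \<tau>) = degree A u (u + \<tau>)"
      using v closed[OF u, of "k + 1"] u by (intro degree_period per) (simp_all only: v)
    ultimately show ?thesis
      using v(2) by simp
  qed
  show ?thesis
  proof (induction m rule: int_induct[of _ 0])
    case base
    then show ?case
      using degree_refl[OF u] by simp
  next
    case (step1 i)
    then show ?case
      using step[of i] by (simp add: algebra_simps)
  next
    case (step2 i)
    then show ?case
      using step[of "i - 1"] by (simp add: algebra_simps)
  qed
qed

end

end

section \<open>Connectedness of configuration spaces of planar domains\<close>

definition motion_between ::
  "complex set \<Rightarrow> nat set \<Rightarrow> (nat \<Rightarrow> complex) \<Rightarrow> (nat \<Rightarrow> complex) \<Rightarrow> (real \<Rightarrow> nat \<Rightarrow> complex) \<Rightarrow> bool" where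
  "motion_between D I y y' Y \<longleftrightarrow> (\<forall>i\<in>I. continuous_on {0..1} (\<lambda>t. Y t i)) \<and>
     (\<forall>t\<in>{0..1}. inj_on (Y t) I \<and> Y t ` I \<subseteq> D) \<and> (\<forall>i\<in>I. Y 0 i = y i \<and> Y 1 i = y' i)"

lemma motion_between_trans:
  assumes "motion_between D I y y' Y" "motion_between D I y' y'' Z"
  shows "motion_between D I y y'' (\<lambda>t i. ((\<lambda>t. Y t i) +++ (\<lambda>t. Z t i)) t)"
  unfolding motion_between_def
proof (intro conjI ballI)
  fix i assume i: "i \<in> I"
  have "path ((\<lambda>t. Y t i) +++ (\<lambda>t. Z t i))"
    using assms i by (intro path_join_imp) (auto simp: motion_between_def path_def pathfinish_def pathstart_def)
  then show "continuous_on {0..1} (\<lambda>t. ((\<lambda>t. Y t i) +++ (\<lambda>t. Z t i)) t)"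
    by (simp add: path_def)
next
  fix t :: real assume t: "t \<in> {0..1}"
  have "inj_on (Y (2 * t)) I \<and> Y (2 * t) ` I \<subseteq> D" if "t \<le> 1/2"
    using assms(1) t that by (simp add: motion_between_def)
  moreover have "inj_on (Z (2 * t - 1)) I \<and> Z (2 * t - 1) ` I \<subseteq> D" if "\<not> t \<le> 1/2"
    using assms(2) t that by (simp add: motion_between_def)
  ultimately show "inj_on (\<lambda>i. ((\<lambda>t. Y t i) +++ (\<lambda>t. Z t i)) t) I"
    "(\<lambda>i. ((\<lambda>t. Y t i) +++ (\<lambda>t. Z t i)) t) ` I \<subseteq> D"
    by (cases "t \<le> 1/2"; simp add: joinpaths_def)+
qed (use assms in \<open>auto simp: motion_between_def joinpaths_def\<close>)

lemma motion_between_sym: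
  assumes "motion_between D I y y' Y"
  shows "motion_between D I y' y (\<lambda>t. Y (1 - t))"
  using assms unfolding motion_between_def
  by (auto intro!: continuous_on_compose2[where g = "\<lambda>t. Y t _" and f = "\<lambda>t. 1 - t" and t = "{0..1}"]
      continuous_intros)

text \<open>An open connected planar set stays path connected when the finitely many other points
  are removed.\<close>

lemma motion_between_move_one:
  assumes D: "open D" "connected D" and I: "finite I" and y: "inj_on y I" "y ` I \<subseteq> D"
    and i: "i \<in> I" and p: "p \<in> D" "p \<notin> y ` (I - {i})"
  obtains Y where "motion_between D I y (y(i := p)) Y"
proof -
  have "path_connected (D - y ` (I - {i}))"
    using I D by (intro path_connected_open_diff_countable) (auto simp: countable_finite)
  moreover have "y i \<in> D - y ` (I - {i})"
    using y i by (auto simp: inj_on_def)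
  ultimately obtain g where g: "path g" "path_image g \<subseteq> D - y ` (I - {i})" "g 0 = y i" "g 1 = p"
    using p unfolding path_connected_def pathstart_def pathfinish_def by blast
  have gt: "g t \<in> D" "g t \<notin> y ` (I - {i})" if "t \<in> {0..1}" for t
  proof -
    have "g t \<in> D - y ` (I - {i})"
      using g(2) that unfolding path_image_def by blast
    then show "g t \<in> D" "g t \<notin> y ` (I - {i})"
      by simp_all
  qed
  have "motion_between D I y (y(i := p)) (\<lambda>t. y(i := g t))"
    unfolding motion_between_def
  proof (intro conjI ballI)
    fix k assume "k \<in> I"
    then show "continuous_on {0..1} (\<lambda>t. (y(i := g t)) k)"
      using g(1) by (cases "k = i") (auto simp: path_def)
  next
    fix t :: real assume "t \<in> {0..1}"
    note gt = gt[OF this]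
    have *: "I = insert i (I - {i})"
      using i by blast
    have im: "(y(i := g t)) ` (I - {i}) = y ` (I - {i})"
      by (rule image_cong) auto
    have "inj_on (y(i := g t)) (I - {i})"
      by (rule inj_on_cong[THEN iffD2, OF _ inj_on_subset[OF y(1)]]) auto
    then show "inj_on (y(i := g t)) I"
      using gt(2) im by (subst *, subst inj_on_insert) simp
    show "(y(i := g t)) ` I \<subseteq> D"
      using gt(1) y(2) by (subst *, subst image_insert, subst im) auto
  qed (use g(3,4) in simp_all)
  then show thesis
    by (rule that)
qed

text \<open>Both configurations are moved, one point at a time, to a third one that is disjoint from
  both. Going directly from \<open>y\<close> to \<open>y'\<close> point by point could fail, as a
  place of \<open>y'\<close> may still be occupied by a point of \<open>y\<close>.\<close>

lemma motion_between_exists: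
  assumes D: "open D" "connected D" and I: "finite I"
    and y: "inj_on y I" "y ` I \<subseteq> D" and y': "inj_on y' I" "y' ` I \<subseteq> D"
  obtains Y where "motion_between D I y y' Y"
proof (cases "I = {}")
  case True
  then show ?thesis
    using that by (simp add: motion_between_def)
next
  case False
  then have "infinite D"
    using y(2) finite_imp_not_open[of D] D(1) by auto
  then have "infinite (D - (y ` I \<union> y' ` I))"
    using I by (intro Diff_infinite_finite) auto
  then obtain z :: "nat \<Rightarrow> complex" where z: "inj z" "range z \<subseteq> D - (y ` I \<union> y' ` I)"
    by (auto simp: infinite_iff_countable_subset)
  have to_z: "\<exists>Y. motion_between D I x z Y"
    if x: "inj_on x I" "x ` I \<subseteq> D" "range z \<inter> x ` I = {}" for x
  proof -
    \<comment> \<open>\<open>J\<close> is the set of labels whose points have already reached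
      \<open>z\<close>.\<close>
    have "\<exists>Y. motion_between D I x (\<lambda>i. if i \<in> J then z i else x i) Y" if "J \<subseteq> I" for J
      using finite_subset[OF that I] that
    proof (induction J rule: finite_induct)
      case empty
      show ?case
        by (rule exI[of _ "\<lambda>_. x"]) (use x in \<open>auto simp: motion_between_def\<close>)
    next
      case (insert i J)
      let ?x = "\<lambda>i. if i \<in> J then z i else x i"
      have zx: "z a \<noteq> x b" if "b \<in> I" for a b
        using x(3) that by blast
      have zD: "z a \<in> D" for a
        using z(2) by blast
      have inj: "inj_on ?x I"
      proof (rule inj_onI)
        fix a b assume "a \<in> I" "b \<in> I" "?x a = ?x b"
        then show "a = b"
          using zx[of b a] zx[of a b] inj_eq[OF z(1)] inj_on_eq_iff[OF x(1)]
          by (cases "a \<in> J"; cases "b \<in> J") simp_all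
      qed
      have sub: "?x ` I \<subseteq> D"
        using x(2) zD by (simp add: image_subset_iff)
      have "z i \<noteq> ?x k" if "k \<in> I - {i}" for k
        using zx[of k i] that inj_eq[OF z(1)] by auto
      then have zi: "z i \<notin> ?x ` (I - {i})" "z i \<in> D"
        using zD by blast+
      obtain Z where Z: "motion_between D I ?x (?x(i := z i)) Z"
        using motion_between_move_one[OF D I inj sub _ zi(2,1)] insert.prems by auto
      have "?x(i := z i) = (\<lambda>k. if k \<in> insert i J then z k else x k)"
        by auto
      then show ?case
        using insert.IH insert.prems motion_between_trans Z by (metis insert_subset)
    qed
    from this[of I] obtain Y where "motion_between D I x (\<lambda>i. if i \<in> I then z i else x i) Y"
      by auto
    then have "motion_between D I x z Y"
      by (simp add: motion_between_def)
    then show ?thesis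
      by blast
  qed
  obtain Y Z where Y: "motion_between D I y z Y" and Z: "motion_between D I y' z Z"
    using to_z[of y] to_z[of y'] y y' z(2) by blast
  show ?thesis
    by (rule that[OF motion_between_trans[OF Y motion_between_sym[OF Z]]])
qed

section \<open>Points circling around points\<close>

lemma moving_set_sub: "moving_set X m T A \<Longrightarrow> u \<in> topspace T \<Longrightarrow> A u \<subseteq> topspace X"
  by (erule moving_setE) (auto simp: continuous_map_def)

text \<open>For \<open>s = 0\<close> one point circles around the fixed point \<open>w\<close>; for \<open>s = 1\<close> two points rotate
  around their midpoint \<open>w\<close>. The motion is parametrised by the logarithm \<open>z\<close> of the relative position.\<close>

definition pair :: "real \<Rightarrow> complex \<Rightarrow> complex set \<Rightarrow> complex \<Rightarrow> complex set" where
  "pair s w R z = insert (w - of_real s * exp z) (insert (w + exp z) R)"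

text \<open>For positive \<open>\<delta>\<close> a half plane: the exponential map makes it the
  universal cover of the punctured disc of radius \<open>\<delta>\<close>. Its convexity makes the
  degree of a circling motion depend on the end points of the logarithm only.\<close>

definition log_disc :: "real \<Rightarrow> complex set" where
  "log_disc \<delta> = {z. exp (Re z) \<le> \<delta>}"

lemma convex_log_disc: "0 < \<delta> \<Longrightarrow> convex (log_disc \<delta>)"
proof -
  assume "0 < \<delta>"
  then have "log_disc \<delta> = {z. Re z \<le> ln \<delta>}"
    by (auto simp: log_disc_def ln_ge_iff)
  then show ?thesis
    by (simp add: convex_halfspace_Re_le)
qed

lemma ln_log_disc: "0 < \<delta> \<Longrightarrow> \<delta> \<le> \<delta>' \<Longrightarrow> Re \<tau> = 0 \<Longrightarrow> of_real (ln \<delta>) + \<tau> \<in> log_disc \<delta>'"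
  by (simp add: log_disc_def)

text \<open>\<open>R\<close> holds the resting points. The pair that moves near \<open>w\<close>
  supplies the other two of the \<open>n\<close> points, hence
  \<open>card R + 2 = n\<close>.\<close>

definition isolated :: "complex set \<Rightarrow> nat \<Rightarrow> complex set \<Rightarrow> complex \<Rightarrow> real \<Rightarrow> bool" where
  "isolated D n R w \<delta> \<longleftrightarrow> finite R \<and> card R + 2 = n \<and> R \<subseteq> D \<and> 0 < \<delta> \<and> cball w \<delta> \<subseteq> D \<and> cball w \<delta> \<inter> R = {}"

lemma isolated_exists:
  assumes "open D" "finite R" "card R + 2 = n" "R \<subseteq> D" "w \<in> D" "w \<notin> R"
  obtains \<delta> where "isolated D n R w \<delta>"
proof -
  have "open (D - R)" "w \<in> D - R"
    using assms by (auto intro: open_Diff finite_imp_closed)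
  then obtain \<delta> where "\<delta> > 0" "cball w \<delta> \<subseteq> D - R"
    using open_contains_cball by blast
  then have "isolated D n R w \<delta>"
    using assms unfolding isolated_def by blast
  then show thesis
    by (rule that)
qed

text \<open>For \<open>s\<close> between 0 and 1 both points stay within distance
  \<open>exp (Re z)\<close> of \<open>w\<close>, and they differ by \<open>(s + 1) * exp z\<close>,
  which is not 0. Letting \<open>s\<close>, \<open>w\<close> and \<open>R\<close> vary provides the
  deformations used below.\<close>

lemma moving_set_pair:
  assumes A: "moving_set (top_of_set D) m (top_of_set K) R" and w: "continuous_on K w"
    and z: "continuous_on K z" and s: "continuous_on K s"
    and s01: "\<And>u. u \<in> K \<Longrightarrow> s u \<in> {0..1}"
    and iso: "\<And>u. u \<in> K \<Longrightarrow> cball (w u) (exp (Re (z u))) \<subseteq> D - R u"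
  shows "moving_set (top_of_set D) (m + 2) (top_of_set K) (\<lambda>u. pair (s u) (w u) (R u) (z u))"
proof -
  have near: "w u - of_real (s u) * exp (z u) \<in> D - R u" "w u + exp (z u) \<in> D - R u"
    "w u - of_real (s u) * exp (z u) \<noteq> w u + exp (z u)" if "u \<in> K" for u
  proof -
    have "\<bar>s u\<bar> * exp (Re (z u)) \<le> 1 * exp (Re (z u))"
      using s01[OF that] by (intro mult_right_mono) auto
    then have "w u - of_real (s u) * exp (z u) \<in> cball (w u) (exp (Re (z u)))"
      "w u + exp (z u) \<in> cball (w u) (exp (Re (z u)))"
      by (auto simp: dist_norm norm_mult)
    then show "w u - of_real (s u) * exp (z u) \<in> D - R u" "w u + exp (z u) \<in> D - R u"
      using iso[OF that] by blast+
    have "of_real (s u + 1) * exp (z u) \<noteq> 0"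
      using s01[OF that] by (simp del: of_real_add)
    then show "w u - of_real (s u) * exp (z u) \<noteq> w u + exp (z u)"
      by (auto simp: algebra_simps)
  qed
  have "continuous_on K (\<lambda>u. w u + exp (z u))"
    "continuous_on K (\<lambda>u. w u - of_real (s u) * exp (z u))"
    by (intro continuous_intros w z s)+
  then have "continuous_map (top_of_set K) (top_of_set D) (\<lambda>u. w u + exp (z u))"
    "continuous_map (top_of_set K) (top_of_set D) (\<lambda>u. w u - of_real (s u) * exp (z u))"
    using near by (auto simp: continuous_map_in_subtopology)
  then have "moving_set (top_of_set D) (Suc (Suc m)) (top_of_set K) (\<lambda>u. pair (s u) (w u) (R u) (z u))"
    unfolding pair_def using near by (intro moving_set_insert A) auto
  then show ?thesis
    by simp
qed

context conf_rep
begin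

definition chart :: "complex set \<Rightarrow> (complex \<Rightarrow> 'a) \<Rightarrow> bool" where
  "chart D f \<longleftrightarrow> open D \<and> connected D \<and> continuous_map (top_of_set D) S f \<and> inj_on f D \<and> f ` D \<subseteq> W"

lemma chart_local_on:
  assumes "chart D f" "moving_set (top_of_set D) n (top_of_set K) B"
  shows "local_on K (\<lambda>u. f ` B u)"
proof -
  have "moving K (\<lambda>u. f ` B u)"
    using assms by (intro moving_set_image[OF assms(2)]) (auto simp: chart_def)
  moreover have "f ` B u \<subseteq> W" if "u \<in> K" for u
    using moving_set_sub[OF assms(2), of u] that assms(1) by (auto simp: chart_def)
  ultimately show ?thesis
    by (auto simp: local_on_def)
qed

lemma pair_local_on:
  assumes D: "chart D f" and iso: "isolated D n R w \<delta>" and s: "s \<in> {0..1}"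
  shows "local_on (log_disc \<delta>) (\<lambda>z. f ` pair s w R z)"
proof (rule chart_local_on[OF D])
  have "moving_set (top_of_set D) (card R + 2) (top_of_set (log_disc \<delta>)) (\<lambda>z. pair s w R z)"
  proof (rule moving_set_pair[OF moving_set_const])
    show "cball w (exp (Re z)) \<subseteq> D - R" if "z \<in> log_disc \<delta>" for z
      using iso that subset_cball[of "exp (Re z)" \<delta> w] by (auto simp: isolated_def log_disc_def)
  qed (use iso s in \<open>auto simp: isolated_def\<close>)
  then show "moving_set (top_of_set D) n (top_of_set (log_disc \<delta>)) (\<lambda>z. pair s w R z)"
    using iso by (simp add: isolated_def)
qed

text \<open>With \<open>s = 0\<close> and period \<open>2 * pi * \<i>\<close> one point goes once
  around another; with \<open>s = 1\<close> and period \<open>pi * \<i>\<close> two points are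
  exchanged by a half turn.\<close>

definition orbit_degree :: "(complex \<Rightarrow> 'a) \<Rightarrow> real \<Rightarrow> complex \<Rightarrow> complex set \<Rightarrow> complex \<Rightarrow> real \<Rightarrow> int" where
  "orbit_degree f s \<tau> R w \<delta> =
     degree (\<lambda>z. f ` pair s w R z) (of_real (ln \<delta>)) (of_real (ln \<delta>) + \<tau>)"

lemma orbit_degree_radius:
  assumes D: "chart D f" and iso: "isolated D n R w \<delta>" and s: "s \<in> {0..1}"
    and per: "\<And>z. pair s w R (z + \<tau>) = pair s w R z" "Re \<tau> = 0" and u: "u \<in> log_disc \<delta>"
  shows "degree (\<lambda>z. f ` pair s w R z) u (u + \<tau>) = orbit_degree f s \<tau> R w \<delta>"
  unfolding orbit_degree_def
proof (rule degree_period[OF convex_log_disc pair_local_on[OF D iso s]])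
  have "0 < \<delta>"
    using iso by (simp add: isolated_def)
  then show "0 < \<delta>" "of_real (ln \<delta>) \<in> log_disc \<delta>" "of_real (ln \<delta>) + \<tau> \<in> log_disc \<delta>"
    using ln_log_disc[of \<delta> \<delta> 0] ln_log_disc[of \<delta> \<delta> \<tau>] per(2) by auto
  show "u + \<tau> \<in> log_disc \<delta>"
    using u per(2) by (simp add: log_disc_def)
qed (use per u in auto)

text \<open>The centre and the resting points are carried to their new places by a motion in
  \<open>D\<close>, while the pair turns in a disc so small that it meets nothing during the whole
  motion. The degree over one period does not change with time.\<close>

lemma orbit_degree_const:
  assumes D: "chart D f" and iso: "isolated D n R w \<delta>" "isolated D n R' w' \<delta>'" and s: "s \<in> {0..1}"
    and per: "\<And>w R z. pair s w R (z + \<tau>) = pair s w R z" "Re \<tau> = 0"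
  shows "orbit_degree f s \<tau> R w \<delta> = orbit_degree f s \<tau> R' w' \<delta>'"
proof -
  \<comment> \<open>The resting points carry the labels below \<open>?m\<close>, the centre carries
    the label \<open>?m\<close>.\<close>
  let ?m = "n - 2"
  have tau: "\<And>a. 0 < a \<Longrightarrow> of_real (ln a) \<in> log_disc a" "\<And>a. 0 < a \<Longrightarrow> of_real (ln a) + \<tau> \<in> log_disc a"
    using ln_log_disc[of _ _ 0] ln_log_disc[of _ _ \<tau>] per(2) by auto
  have labels: "\<exists>y. inj_on y {0..?m} \<and> y ` {0..?m} \<subseteq> D \<and> y ?m = w \<and> y ` {0..<?m} = R"
    if "isolated D n R w \<delta>" for R w \<delta>
  proof -
    have "w \<in> cball w \<delta>"
      using that by (simp add: isolated_def)
    then have w: "w \<in> D" "w \<notin> R"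
      using that unfolding isolated_def by blast+
    have R: "finite R" "card R = ?m" "R \<subseteq> D"
      using that unfolding isolated_def by linarith+
    obtain b where b: "bij_betw b {0..<?m} R"
      using ex_bij_betw_nat_finite[OF R(1)] R(2) by auto
    have *: "{0..?m} = insert ?m {0..<?m}"
      by auto
    have b': "(b(?m := w)) ` {0..<?m} = R"
      using bij_betw_imp_surj_on[OF b] by auto
    moreover have "inj_on (b(?m := w)) {0..<?m}"
      using bij_betw_imp_inj_on[OF b] by (auto simp: inj_on_def)
    ultimately have "inj_on (b(?m := w)) {0..?m}" "(b(?m := w)) ` {0..?m} \<subseteq> D"
      unfolding * using R w by auto
    then show ?thesis
      using b' by (intro exI[of _ "b(?m := w)"]) auto
  qed
  obtain y where y: "inj_on y {0..?m}" "y ` {0..?m} \<subseteq> D" "y ?m = w" "y ` {0..<?m} = R"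
    using labels[OF iso(1)] by blast
  obtain y' where y': "inj_on y' {0..?m}" "y' ` {0..?m} \<subseteq> D" "y' ?m = w'" "y' ` {0..<?m} = R'"
    using labels[OF iso(2)] by blast
  have D': "open D" "connected D"
    using D by (auto simp: chart_def)
  obtain Y where Y: "motion_between D {0..?m} y y' Y"
    using motion_between_exists[OF D' _ y(1,2) y'(1,2)] by blast
  have Yc: "continuous_on {0..1} (\<lambda>t. Y t i)" if "i \<le> ?m" for i
    using Y that by (simp add: motion_between_def)
  have Yi: "inj_on (Y t) {0..?m}" "Y t ` {0..?m} \<subseteq> D" if "t \<in> {0..1}" for t
    using Y that by (simp_all add: motion_between_def)
  have YD: "Y t i \<in> D" if "t \<in> {0..1}" "i \<le> ?m" for t i
    using Yi(2)[OF that(1)] that(2) by (auto simp: image_subset_iff)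
  have Yne: "Y t i \<noteq> Y t ?m" if "t \<in> {0..1}" "i < ?m" for t i
    using inj_on_eq_iff[OF Yi(1)[OF that(1)], of i ?m] that(2) by simp
  have "compact ((\<lambda>t. Y t ?m) ` {0..1})" "(\<lambda>t. Y t ?m) ` {0..1} \<subseteq> D"
    using YD by (auto intro!: compact_continuous_image Yc)
  then obtain d1 where d1: "d1 > 0" "(\<Union>x\<in>(\<lambda>t. Y t ?m) ` {0..1}. cball x d1) \<subseteq> D"
    using compact_subset_open_imp_cball_epsilon_subset[OF _ D'(1)] by metis
  \<comment> \<open>The differences between the resting points and the centre form a compact set
    that misses 0; this gives one radius \<open>d2\<close> for the whole time interval.\<close>
  let ?C = "\<Union>i\<in>{0..<?m}. (\<lambda>t. Y t i - Y t ?m) ` {0..1}"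
  have "compact ?C"
    by (intro compact_UN compact_continuous_image continuous_intros Yc) auto
  moreover have "?C \<subseteq> - {0}"
    using Yne by auto
  moreover have "open (- {0::complex})"
    by (rule open_Compl) (rule closed_singleton)
  ultimately obtain d2 where d2: "d2 > 0" "(\<Union>x\<in>?C. cball x d2) \<subseteq> - {0}"
    using compact_subset_open_imp_cball_epsilon_subset[of ?C "- {0}"] by blast
  define d where "d = min (min d1 d2) (min \<delta> \<delta>')"
  have d: "d > 0" "d \<le> d1" "d \<le> d2" "d \<le> \<delta>" "d \<le> \<delta>'"
    using d1 d2 iso by (auto simp: d_def isolated_def)
  have ball: "cball (Y t ?m) r \<subseteq> D - Y t ` {0..<?m}" if t: "t \<in> {0..1}" and r: "r \<le> d" for t r
  proof -
    have "cball (Y t ?m) d1 \<subseteq> D"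
      using d1(2) t by blast
    moreover have "dist (Y t ?m) (Y t i) > d2" if "i < ?m" for i
    proof (rule ccontr)
      assume "\<not> dist (Y t ?m) (Y t i) > d2"
      then have "0 \<in> cball (Y t i - Y t ?m) d2"
        by (simp add: dist_norm norm_minus_commute)
      moreover have "Y t i - Y t ?m \<in> ?C"
        using that t by (intro UN_I[of i] image_eqI[of _ _ t]) auto
      ultimately show False
        using d2(2) by blast
    qed
    then have "Y t i \<notin> cball (Y t ?m) r" if "i < ?m" for i
      using that r d(3) by force
    ultimately show ?thesis
      using r d(2) subset_cball[of r d1 "Y t ?m"] by fastforce
  qed
  let ?K = "{0..1::real} \<times> log_disc d"
  let ?B = "\<lambda>(t, z). pair s (Y t ?m) (Y t ` {0..<?m}) z"
  have loc: "local_on ?K (\<lambda>x. f ` ?B x)"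
  proof (rule chart_local_on[OF D])
    have "moving_set (top_of_set D) ?m (top_of_set ?K) (\<lambda>x. Y (fst x) ` {0..<?m})"
    proof (rule moving_setI[of "{0..<?m}" _ _ _ "\<lambda>x. Y (fst x)"])
      show "continuous_map (top_of_set ?K) (top_of_set D) (\<lambda>x. Y (fst x) i)" if "i \<in> {0..<?m}" for i
        using that YD by (auto simp: continuous_map_in_subtopology
          intro!: continuous_on_compose2[OF Yc] continuous_intros)
      show "inj_on (Y (fst x)) {0..<?m}" if "x \<in> topspace (top_of_set ?K)" for x
        using that by (intro inj_on_subset[OF Yi(1)]) auto
    qed auto
    then have "moving_set (top_of_set D) (?m + 2) (top_of_set ?K)
        (\<lambda>x. pair s (Y (fst x) ?m) (Y (fst x) ` {0..<?m}) (snd x))"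
    proof (rule moving_set_pair)
      show "cball (Y (fst u) ?m) (exp (Re (snd u))) \<subseteq> D - Y (fst u) ` {0..<?m}"
        if "u \<in> ?K" for u
        using that by (intro ball) (auto simp: log_disc_def)
    qed (use s in \<open>auto intro!: continuous_on_compose2[OF Yc] continuous_intros\<close>)
    moreover have "?m + 2 = n"
      using iso(1) by (auto simp: isolated_def)
    ultimately show "moving_set (top_of_set D) n (top_of_set ?K) ?B"
      by (simp add: case_prod_unfold)
  qed
  have K: "convex ?K"
    using d(1) by (intro convex_Times convex_log_disc convex_real_interval)
  have "degree (\<lambda>x. f ` ?B x) (0, of_real (ln d)) ((0, of_real (ln d)) + (0, \<tau>))
      = degree (\<lambda>x. f ` ?B x) (1, of_real (ln d)) ((1, of_real (ln d)) + (0, \<tau>))"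
    using per tau[OF d(1)] by (intro degree_period[OF K loc]) auto
  moreover have "degree (\<lambda>x. f ` ?B x) (t, of_real (ln d)) ((t, of_real (ln d)) + (0, \<tau>))
      = orbit_degree f s \<tau> (Y t ` {0..<?m}) (Y t ?m) d" if "t \<in> {0..1}" for t
  proof -
    have "continuous_on (log_disc d) (Pair t)" "Pair t ` log_disc d \<subseteq> ?K"
      using that by (auto intro!: continuous_intros)
    from degree_compose[OF K loc convex_log_disc[OF d(1)] this tau[OF d(1)]]
    show ?thesis
      by (simp add: orbit_degree_def)
  qed
  moreover have "Y 0 ?m = w" "Y 1 ?m = w'" "Y 0 ` {0..<?m} = R" "Y 1 ` {0..<?m} = R'"
    using Y y(3,4) y'(3,4) by (auto simp: motion_between_def intro!: image_cong[THEN trans])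
  ultimately have "orbit_degree f s \<tau> R w d = orbit_degree f s \<tau> R' w' d"
    by simp
  moreover have "orbit_degree f s \<tau> R w d = orbit_degree f s \<tau> R w \<delta>"
    using d tau by (subst orbit_degree_def) (intro orbit_degree_radius[OF D iso(1) s per], auto simp: log_disc_def)
  moreover have "orbit_degree f s \<tau> R' w' d = orbit_degree f s \<tau> R' w' \<delta>'"
    using d tau by (subst orbit_degree_def) (intro orbit_degree_radius[OF D iso(2) s per], auto simp: log_disc_def)
  ultimately show ?thesis
    by simp
qed

end

section \<open>Full turns, half turns and winding numbers\<close>

lemma pair_0: "pair 0 w R z = insert w (insert (w + exp z) R)"
  by (simp add: pair_def)

lemma pair_full_turn: "pair s w R (z + 2 * of_real pi * \<i>) = pair s w R z"
  by (simp add: pair_def exp_add)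

lemma pair_half_turn: "pair 1 w R (z + of_real pi * \<i>) = pair 1 w R z"
  by (simp add: pair_def exp_add insert_commute)

lemma isolated_cball:
  assumes "isolated D n R w \<delta>" "r \<le> \<delta>"
  shows "cball w r \<subseteq> D - R"
proof -
  have "cball w \<delta> \<subseteq> D - R"
    using assms(1) unfolding isolated_def by blast
  then show ?thesis
    using subset_cball[OF assms(2), of w] by blast
qed

lemma isolated_centre:
  assumes "isolated D n R w \<delta>"
  shows "w \<in> D" "w \<notin> R"
proof -
  have "w \<in> cball w \<delta>"
    using assms by (simp add: isolated_def)
  then show "w \<in> D" "w \<notin> R"
    using isolated_cball[OF assms order_refl] by blast+
qed

context conf_rep
begin

abbreviation "circling f \<equiv> orbit_degree f 0 (2 * of_real pi * \<i>)"

abbreviation "exchange f \<equiv> orbit_degree f 1 (of_real pi * \<i>)"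

lemma circling_const:
  "chart D f \<Longrightarrow> isolated D n R w \<delta> \<Longrightarrow> isolated D n R' w' \<delta>' \<Longrightarrow> circling f R w \<delta> = circling f R' w' \<delta>'"
  by (rule orbit_degree_const) (auto simp: pair_full_turn)

lemma exchange_const:
  "chart D f \<Longrightarrow> isolated D n R w \<delta> \<Longrightarrow> isolated D n R' w' \<delta>' \<Longrightarrow> exchange f R w \<delta> = exchange f R' w' \<delta>'"
  by (rule orbit_degree_const) (auto simp: pair_half_turn)

text \<open>Letting \<open>s\<close> grow from 0 to 1 deforms a point circling around a fixed one
  into a full rotation of two points about their midpoint, which is two half turns.\<close>

lemma circling_eq_twice_exchange:
  assumes D: "chart D f" and iso: "isolated D n R w \<delta>"
  shows "circling f R w \<delta> = 2 * exchange f R w \<delta>"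
proof -
  let ?K = "{0..1::real} \<times> log_disc \<delta>" and ?A = "\<lambda>x::real \<times> complex. f ` pair (fst x) w R (snd x)"
  let ?l = "of_real (ln \<delta>) :: complex" and ?\<tau> = "2 * of_real pi * \<i>"
  have \<delta>: "0 < \<delta>"
    using iso by (simp add: isolated_def)
  have mem: "?l \<in> log_disc \<delta>" "?l + ?\<tau> \<in> log_disc \<delta>" "?l + of_real pi * \<i> \<in> log_disc \<delta>"
    "?l + of_real pi * \<i> + of_real pi * \<i> \<in> log_disc \<delta>"
    using \<delta> by (auto simp: log_disc_def)
  have "moving_set (top_of_set D) (card R + 2) (top_of_set ?K) (\<lambda>x. pair (fst x) w R (snd x))"
  proof (rule moving_set_pair[OF moving_set_const])
    show "cball w (exp (Re (snd x))) \<subseteq> D - R" if "x \<in> ?K" for x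
      using that by (intro isolated_cball[OF iso]) (auto simp: log_disc_def)
  qed (use iso in \<open>auto simp: isolated_def intro!: continuous_intros\<close>)
  then have "moving_set (top_of_set D) n (top_of_set ?K) (\<lambda>x. pair (fst x) w R (snd x))"
    using iso by (simp add: isolated_def)
  note loc = chart_local_on[OF D this]
  have K: "convex ?K"
    by (intro convex_Times convex_log_disc convex_real_interval \<delta>)
  have "degree ?A (0, ?l) ((0, ?l) + (0, ?\<tau>)) = degree ?A (1, ?l) ((1, ?l) + (0, ?\<tau>))"
    using mem by (intro degree_period[OF K loc]) (auto simp: pair_full_turn)
  moreover have slice: "degree ?A (s, u) (s, v) = degree (\<lambda>z. f ` pair s w R z) u v"
    if "s \<in> {0..1}" "u \<in> log_disc \<delta>" "v \<in> log_disc \<delta>" for s u v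
  proof -
    have "continuous_on (log_disc \<delta>) (Pair s)" "Pair s ` log_disc \<delta> \<subseteq> ?K"
      using that by (auto intro!: continuous_intros)
    from degree_compose[OF K loc convex_log_disc[OF \<delta>] this that(2,3)] show ?thesis
      by simp
  qed
  ultimately have "circling f R w \<delta> = degree (\<lambda>z. f ` pair 1 w R z) ?l (?l + ?\<tau>)"
    using mem by (simp add: orbit_degree_def)
  also have "?l + ?\<tau> = ?l + of_real pi * \<i> + of_real pi * \<i>"
    by simp
  also have "degree (\<lambda>z. f ` pair 1 w R z) ?l \<dots> = exchange f R w \<delta> + exchange f R w \<delta>"
  proof -
    note loc1 = pair_local_on[OF D iso, of 1] and cv = convex_log_disc[OF \<delta>]
    have "degree (\<lambda>z. f ` pair 1 w R z) ?l (?l + of_real pi * \<i>)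
        + degree (\<lambda>z. f ` pair 1 w R z) (?l + of_real pi * \<i>) (?l + of_real pi * \<i> + of_real pi * \<i>)
        = degree (\<lambda>z. f ` pair 1 w R z) ?l (?l + of_real pi * \<i> + of_real pi * \<i>)"
      using mem by (intro degree_add[OF cv loc1]) auto
    moreover have "degree (\<lambda>z. f ` pair 1 w R z) (?l + of_real pi * \<i>) (?l + of_real pi * \<i> + of_real pi * \<i>)
        = exchange f R w \<delta>"
      using mem by (intro orbit_degree_radius[OF D iso]) (auto simp: pair_half_turn)
    ultimately show ?thesis
      by (simp add: orbit_degree_def)
  qed
  finally show ?thesis
    by simp
qed

text \<open>The homothety with centre \<open>w\<close> shrinks the loop, inside the convex set
  \<open>C\<close>, into the isolated disc. There it lifts to the logarithm, whose total increment
  is \<open>k\<close> periods.\<close>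

lemma \<Phi>_winding:
  assumes D: "chart D f" and C: "convex C" "C \<subseteq> D" and Q: "finite Q" "Suc (card Q) = n" "Q \<subseteq> D"
    and w: "C \<inter> Q = {w}" and iso: "isolated D n (Q - {w}) w \<delta>"
    and p: "path p" "pathfinish p = pathstart p" "path_image p \<subseteq> C - {w}" "winding_number p w = of_int k"
  shows "\<Phi> (\<lambda>t. conf_of n (f ` insert (p t) Q)) = j (k * circling f (Q - {w}) w \<delta>)"
proof -
  have wC: "w \<in> C" and wQ: "w \<in> Q"
    using w by auto
  have \<delta>: "0 < \<delta>"
    using iso by (simp add: isolated_def)
  have pc: "continuous_on {0..1} p"
    using p(1) by (simp add: path_def)
  have pt: "p t \<in> C" "p t \<noteq> w" if "t \<in> {0..1}" for t
  proof -
    have "p t \<in> C - {w}"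
      using p(3) that unfolding path_image_def by blast
    then show "p t \<in> C" "p t \<noteq> w"
      by auto
  qed
  have "bounded (path_image p)"
    using p(1) by (rule bounded_path_image)
  then have "bounded ((\<lambda>x. x - w) ` path_image p)"
    by (rule bounded_translation_minus)
  then obtain b where b: "\<And>x. x \<in> path_image p \<Longrightarrow> norm (x - w) \<le> b" "b > 0"
    unfolding bounded_pos by auto
  \<comment> \<open>\<open>b\<close> bounds the distance of the loop from \<open>w\<close>, so the
    factor \<open>\<epsilon>\<close> brings the loop into the disc of radius
    \<open>\<delta>\<close>.\<close>
  define \<epsilon> where "\<epsilon> = min 1 (\<delta> / b)"
  have \<epsilon>: "0 < \<epsilon>" "\<epsilon> \<le> 1" "\<epsilon> * b \<le> \<delta>"
    using \<delta> b(2) by (auto simp: \<epsilon>_def min_def field_simps)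
  let ?K = "{\<epsilon>..1} \<times> {0..1::real}"
  let ?q = "\<lambda>x. w + of_real (fst x) * (p (snd x) - w)"
  have q: "?q x \<in> C - {w}" if "x \<in> ?K" for x
  proof -
    have "?q x = (1 - fst x) *\<^sub>R w + fst x *\<^sub>R p (snd x)"
      by (simp add: scaleR_conv_of_real algebra_simps)
    also have "\<dots> \<in> C"
      using that \<epsilon> C(1) wC pt by (intro convexD) auto
    finally show ?thesis
      using that \<epsilon> pt(2)[of "snd x"] by auto
  qed
  have loc: "local_on ?K (\<lambda>x. f ` insert (?q x) Q)"
  proof (rule chart_local_on[OF D])
    have "moving_set (top_of_set D) (Suc (card Q)) (top_of_set ?K) (\<lambda>x. insert (?q x) Q)"
    proof (rule moving_set_insert[OF moving_set_const])
      have "continuous_on ?K ?q"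
        by (intro continuous_intros continuous_on_compose2[OF pc]) auto
      moreover have "?q x \<in> D" if "x \<in> ?K" for x
        using q[OF that] C(2) by blast
      ultimately show "continuous_map (top_of_set ?K) (top_of_set D) ?q"
        by (auto simp: continuous_map_in_subtopology)
      show "?q x \<notin> Q" if "x \<in> topspace (top_of_set ?K)" for x
      proof
        assume "?q x \<in> Q"
        moreover have "?q x \<in> C - {w}"
          using that by (intro q) simp
        ultimately show False
          using w by blast
      qed
    qed (use Q in auto)
    then show "moving_set (top_of_set D) n (top_of_set ?K) (\<lambda>x. insert (?q x) Q)"
      using Q(2) by simp
  qed
  have K: "convex ?K"
    by (intro convex_Times convex_real_interval)
  have p01: "p 1 = p 0"
    using p(2) by (simp add: pathfinish_def pathstart_def)
  let ?d = "degree (\<lambda>x. f ` insert (?q x) Q)"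
  \<comment> \<open>As the loop is closed, the radial edges at its start and at its end are the same
    motion and cancel.\<close>
  have "?d (1, 0) (1, 1) = ?d (\<epsilon>, 0) (\<epsilon>, 1)"
  proof -
    have "?d (1, 0) (\<epsilon>, 0) = ?d (1, 1) (\<epsilon>, 1)"
      using \<epsilon> p01 by (intro degree_cong[OF K loc]) auto
    moreover have "?d (1, 0) (1, 1) + ?d (1, 1) (\<epsilon>, 1) = ?d (1, 0) (\<epsilon>, 1)"
      "?d (1, 0) (\<epsilon>, 0) + ?d (\<epsilon>, 0) (\<epsilon>, 1) = ?d (1, 0) (\<epsilon>, 1)"
      using \<epsilon> by (intro degree_add[OF K loc]; simp)+
    ultimately show ?thesis
      by linarith
  qed
  moreover have "\<Phi> (\<lambda>t. conf_of n (f ` insert (p t) Q)) = j (?d (1, 0) (1, 1))"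
  proof -
    have "continuous_on {0..1} (\<lambda>t. (1::real, t::real))" "(\<lambda>t. (1, t)) ` {0..1} \<subseteq> ?K"
      using \<epsilon> by (auto intro!: continuous_intros)
    from \<Phi>_degree[OF K loc this] show ?thesis
      by simp
  qed
  moreover have "j (?d (\<epsilon>, 0) (\<epsilon>, 1)) = j (k * circling f (Q - {w}) w \<delta>)"
  proof -
    obtain g where g: "path g" "pathfinish g - pathstart g = 2 * of_real pi * \<i> * of_int k"
      "\<And>t. t \<in> {0..1} \<Longrightarrow> p t = w + exp (g t)"
      using winding_number_as_continuous_log[of p w] p by auto
    let ?u = "\<lambda>t. of_real (ln \<epsilon>) + g t"
    have u: "w + exp (?u t) = ?q (\<epsilon>, t)" if "t \<in> {0..1}" for t
      using g(3)[OF that] \<epsilon>(1) by (simp add: exp_add exp_of_real)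
    have uK: "?u ` {0..1} \<subseteq> log_disc \<delta>"
    proof
      fix z assume "z \<in> ?u ` {0..1}"
      then obtain t where t: "t \<in> {0..1}" "z = ?u t"
        by auto
      have "exp (Re z) = norm (exp z)"
        by simp
      also have "exp z = of_real \<epsilon> * (p t - w)"
        using u[OF t(1)] t(2) by (simp add: algebra_simps)
      also have "norm \<dots> \<le> \<epsilon> * b"
        using b(1)[of "p t"] t(1) \<epsilon>(1) by (auto simp: norm_mult path_image_def)
      finally show "z \<in> log_disc \<delta>"
        using \<epsilon>(3) by (simp add: log_disc_def)
    qed
    let ?P = "\<lambda>z. f ` pair 0 w (Q - {w}) z"
    have locP: "local_on (log_disc \<delta>) ?P"
      by (rule pair_local_on[OF D iso]) simp
    note cv = convex_log_disc[OF \<delta>]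
    have pair_eq: "pair 0 w (Q - {w}) z = insert (w + exp z) Q" for z
      using wQ by (auto simp: pair_0)
    have "j (?d (\<epsilon>, 0) (\<epsilon>, 1)) = \<Phi> (\<lambda>t. conf_of n (f ` insert (?q (\<epsilon>, t)) Q))"
    proof -
      have "continuous_on {0..1} (\<lambda>t. (\<epsilon>, t::real))" "(\<lambda>t. (\<epsilon>, t)) ` {0..1} \<subseteq> ?K"
        using \<epsilon> by (auto intro!: continuous_intros)
      from \<Phi>_degree[OF K loc this] show ?thesis
        by simp
    qed
    also have "\<dots> = \<Phi> (\<lambda>t. conf_of n (?P (?u t)))"
    proof (rule \<Phi>_cong)
      have "continuous_on {0..1} (\<lambda>t. (\<epsilon>, t::real))" "(\<lambda>t. (\<epsilon>, t)) ` {0..1} \<subseteq> ?K"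
        using \<epsilon> by (auto intro!: continuous_intros)
      from local_on_compose[OF loc this]
      have "moving {0..1} (\<lambda>t. f ` insert (?q (\<epsilon>, t)) Q)"
        unfolding local_on_def by (rule conjunct1)
      from moving_continuous[OF this]
      show "pathin (unordered_conf n S) (\<lambda>t. conf_of n (f ` insert (?q (\<epsilon>, t)) Q))"
        unfolding pathin_def .
      show "conf_of n (f ` insert (?q (\<epsilon>, t)) Q) = conf_of n (?P (?u t))" if "t \<in> {0..1}" for t
        unfolding pair_eq u[OF that] by (rule refl)
    qed
    also have "\<dots> = j (degree ?P (?u 0) (?u 1))"
    proof (rule \<Phi>_degree[OF cv locP _ uK])
      show "continuous_on {0..1} ?u"
        using g(1) unfolding path_def by (intro continuous_intros)
    qed
    also have "?u 1 = ?u 0 + of_int k *\<^sub>R (2 * of_real pi * \<i>)"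
      using g(2) by (simp add: pathfinish_def pathstart_def scaleR_conv_of_real algebra_simps)
    also have "degree ?P (?u 0) (?u 0 + of_int k *\<^sub>R (2 * of_real pi * \<i>))
        = k * degree ?P (?u 0) (?u 0 + 2 * of_real pi * \<i>)"
    proof (rule degree_multiple[OF cv locP])
      show "?u 0 \<in> log_disc \<delta>"
        using uK by (rule subsetD) simp
    qed (simp_all add: pair_full_turn log_disc_def)
    also have "degree ?P (?u 0) (?u 0 + 2 * of_real pi * \<i>) = circling f (Q - {w}) w \<delta>"
    proof (rule orbit_degree_radius[OF D iso])
      show "?u 0 \<in> log_disc \<delta>"
        using uK by (rule subsetD) simp
    qed (simp_all add: pair_full_turn)
    finally show ?thesis .
  qed
  ultimately show ?thesis
    by simp
qed

text \<open>A small circle around \<open>\<psi> w\<close> in the second chart pulls back to a loop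
  around \<open>w\<close> in the first one, whose winding number is the factor \<open>m\<close>.
  Invariance of domain supplies the inverse of \<open>\<psi>\<close> on a ball. The purpose is to
  pass non-vanishing from the second chart to the first.\<close>

lemma circling_chart_change:
  assumes D: "chart D f" and D': "chart D' f'"
    and \<psi>: "continuous_on D \<psi>" "inj_on \<psi> D" "\<psi> ` D \<subseteq> D'" "\<And>x. x \<in> D \<Longrightarrow> f x = f' (\<psi> x)"
    and iso: "isolated D n R w \<delta>" and iso': "isolated D' n R' w' \<delta>'"
  shows "\<exists>m. circling f' R' w' \<delta>' = m * circling f R w \<delta>"
proof -
  let ?B = "ball w \<delta>" and ?Q = "insert w R"
  have \<delta>: "0 < \<delta>" "?B \<subseteq> D" "finite R" "R \<subseteq> D" "w \<in> D" "w \<notin> R" "?B \<inter> R = {}" "card R + 2 = n"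
    using iso isolated_centre[OF iso] isolated_cball[OF iso order_refl] ball_subset_cball[of w \<delta>]
    unfolding isolated_def by blast+
  have B: "continuous_on ?B \<psi>" "inj_on \<psi> ?B"
    using \<psi>(1,2) \<delta>(2) by (auto intro: continuous_on_subset inj_on_subset)
  obtain g where g: "homeomorphism ?B (\<psi> ` ?B) \<psi> g"
    using invariance_of_domain_homeomorphism[OF open_ball B(1) _ B(2)] by auto
  have "open (\<psi> ` ?B)" "\<psi> w \<in> \<psi> ` ?B"
    using invariance_of_domain[OF B(1) open_ball B(2)] \<delta>(1) by auto
  then obtain \<epsilon> where \<epsilon>: "0 < \<epsilon>" "cball (\<psi> w) \<epsilon> \<subseteq> \<psi> ` ?B"
    using open_contains_cball by metis
  have inj: "\<psi> x = \<psi> y \<longleftrightarrow> x = y" if "x \<in> D" "y \<in> D" for x y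
    using \<psi>(2) that by (auto simp: inj_on_def)
  have disj: "\<psi> ` ?B \<inter> \<psi> ` R = {}"
    using \<delta>(2,4,7) inj by blast
  have isoe: "isolated D' n (\<psi> ` R) (\<psi> w) \<epsilon>"
    unfolding isolated_def
  proof (intro conjI)
    show "card (\<psi> ` R) + 2 = n"
      using card_image[OF inj_on_subset[OF \<psi>(2) \<delta>(4)]] \<delta>(8) by simp
    show "\<psi> ` R \<subseteq> D'" "cball (\<psi> w) \<epsilon> \<subseteq> D'" "cball (\<psi> w) \<epsilon> \<inter> \<psi> ` R = {}"
      using \<delta>(2,4) \<epsilon>(2) \<psi>(3) disj by blast+
  qed (use \<delta>(3) \<epsilon>(1) in simp_all)
  let ?c = "\<lambda>t. of_real (ln \<epsilon>) + of_real t * (2 * of_real pi * \<i>) :: complex"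
  let ?p = "\<lambda>t. g (\<psi> w + exp (?c t))"
  have c: "\<psi> w + exp (?c t) \<in> \<psi> ` ?B" "\<psi> w + exp (?c t) \<noteq> \<psi> w" for t
    using \<epsilon> by (auto simp: dist_norm subset_iff)
  have \<psi>p: "\<psi> (?p t) = \<psi> w + exp (?c t)" "?p t \<in> ?B - {w}" for t
  proof -
    show *: "\<psi> (?p t) = \<psi> w + exp (?c t)"
      using g c(1)[of t] unfolding homeomorphism_def by blast
    have "?p t \<in> ?B"
      using g c(1)[of t] unfolding homeomorphism_def by blast
    moreover have "?p t \<noteq> w"
      using * c(2)[of t] by metis
    ultimately show "?p t \<in> ?B - {w}"
      by blast
  qed
  have p: "path ?p" "pathfinish ?p = pathstart ?p" "path_image ?p \<subseteq> ?B - {w}"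
  proof -
    have "continuous_on (\<psi> ` ?B) g"
      using g by (simp add: homeomorphism_def)
    then show "path ?p"
      unfolding path_def by (rule continuous_on_compose2) (use c in \<open>auto intro!: continuous_intros\<close>)
    show "pathfinish ?p = pathstart ?p"
      by (simp add: pathfinish_def pathstart_def exp_add)
    show "path_image ?p \<subseteq> ?B - {w}"
      unfolding path_image_def by (rule image_subsetI) (rule \<psi>p(2))
  qed
  obtain k where k: "winding_number ?p w = of_int k"
    using integer_winding_number[OF p(1,2), of w] p(3) by (auto simp: Ints_def)
  have "?Q - {w} = R"
    using \<delta>(6) by blast
  have "\<Phi> (\<lambda>t. conf_of n (f ` insert (?p t) ?Q)) = j (k * circling f (?Q - {w}) w \<delta>)"
  proof (rule \<Phi>_winding[OF D convex_ball \<delta>(2) _ _ _ _ _ p k])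
    show "?B \<inter> ?Q = {w}"
      using \<delta> by auto
  qed (use \<delta> iso \<open>?Q - {w} = R\<close> in auto)
  moreover have "f ` insert (?p t) ?Q = f' ` pair 0 (\<psi> w) (\<psi> ` R) (?c t)" for t
  proof -
    have "?p t \<in> D"
      using \<psi>p(2)[of t] \<delta>(2) by blast
    then have "f ` insert (?p t) ?Q = f' ` \<psi> ` insert (?p t) ?Q"
      using \<psi>(4) \<delta>(4,5) unfolding image_image by (intro image_cong) auto
    also have "\<psi> ` insert (?p t) ?Q = pair 0 (\<psi> w) (\<psi> ` R) (?c t)"
      by (simp only: image_insert \<psi>p(1) pair_0 insert_commute)
    finally show ?thesis .
  qed
  moreover have "\<Phi> (\<lambda>t. conf_of n (f' ` pair 0 (\<psi> w) (\<psi> ` R) (?c t))) = j (circling f' (\<psi> ` R) (\<psi> w) \<epsilon>)"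
  proof -
    have "\<Phi> (\<lambda>t. conf_of n (f' ` pair 0 (\<psi> w) (\<psi> ` R) (?c t)))
        = j (degree (\<lambda>z. f' ` pair 0 (\<psi> w) (\<psi> ` R) z) (?c 0) (?c 1))"
      using \<epsilon>(1) by (intro \<Phi>_degree[OF convex_log_disc[OF \<epsilon>(1)] pair_local_on[OF D' isoe]])
        (auto intro!: continuous_intros simp: log_disc_def)
    then show ?thesis
      by (simp add: orbit_degree_def)
  qed
  ultimately have "k * circling f R w \<delta> = circling f' (\<psi> ` R) (\<psi> w) \<epsilon>"
    using \<open>?Q - {w} = R\<close> by (simp add: j_eq_iff)
  also have "\<dots> = circling f' R' w' \<delta>'"
    by (rule circling_const[OF D' isoe iso'])
  finally show ?thesis
    by metis
qed

end

section \<open>Points crossing the sides of the polygon\<close>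

lemma moving_set_card:
  assumes "moving_set X m T A" "u \<in> topspace T"
  shows "finite (A u)" "card (A u) = m"
proof -
  obtain I :: "nat set" and x where x: "finite I" "card I = m"
    "\<And>u. u \<in> topspace T \<Longrightarrow> inj_on (x u) I" "\<And>u. u \<in> topspace T \<Longrightarrow> A u = x u ` I"
    using assms(1) by (rule moving_setE) blast
  then show "finite (A u)" "card (A u) = m"
    using x(3,4)[OF assms(2)] by (auto simp: card_image)
qed

text \<open>\<open>W\<close> is the image of the embedded disc \<open>e\<close>, and \<open>\<psi>\<close> is the polygon chart \<open>q\<close> in the
  coordinates of \<open>e\<close>.\<close>

locale polygon_rep = conf_rep F n S \<Phi> W j
  for F :: "'f monoid" (structure) and n and S :: "'a topology" and \<Phi> W j +
  fixes q e :: "complex \<Rightarrow> 'a" and \<psi> :: "complex \<Rightarrow> complex" and g :: nat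
  assumes n: "n \<ge> 3" and g: "g > 0"
    and e: "chart (ball 0 1) e"
    and e_exchange: "\<exists>R w \<delta>. isolated (ball 0 1) n R w \<delta> \<and> exchange e R w \<delta> = 1"
    and q_cont: "continuous_map (top_of_set (cball 0 1)) S q"
    and q_inj: "inj_on q (ball 0 1)"
    and q_sphere: "z \<in> ball 0 1 \<Longrightarrow> w \<in> sphere 0 1 \<Longrightarrow> q z \<noteq> q w"
    and \<psi>: "continuous_on (ball 0 (9/10)) \<psi>" "\<psi> ` ball 0 (9/10) \<subseteq> ball 0 1"
    and q_eq_e: "z \<in> ball 0 (9/10) \<Longrightarrow> q z = e (\<psi> z)"
    and side_a: "k < g \<Longrightarrow> 0 \<le> t \<Longrightarrow> t \<le> 1 \<Longrightarrow> q (rim g (4 * real k + t)) = q (rim g (4 * real k + 3 - t))"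
    and side_b: "k < g \<Longrightarrow> 0 \<le> t \<Longrightarrow> t \<le> 1 \<Longrightarrow> q (rim g (4 * real k + 1 + t)) = q (rim g (4 * real k + 4 - t))"
    and sides_differ: "k < g \<Longrightarrow> q (rim g (4 * real k + 1/2)) \<noteq> q (rim g (4 * real k + 3/2))"
begin

text \<open>The part of the polygon that lies in \<open>W\<close>. The radii below are nested: a
  cluster of resting points within 1/2, a square with corners closer to 0 than 4/5, the circle of
  radius 4/5 from which points leave for the boundary, and 9/10.\<close>

abbreviation "D \<equiv> ball (0::complex) (9/10)"

lemma chart_q: "chart D q"
  unfolding chart_def
proof (intro conjI)
  show "continuous_map (top_of_set D) S q"
    by (rule continuous_map_top_of_set_compose[OF q_cont, of _ "\<lambda>x. x"]) auto
  show "inj_on q D"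
    by (rule inj_on_subset[OF q_inj]) (simp add: subset_ball)
  have "q ` D \<subseteq> e ` ball 0 1"
    using q_eq_e \<psi>(2) by auto
  then show "q ` D \<subseteq> W"
    using e unfolding chart_def by blast
qed auto

lemma inj_\<psi>: "inj_on \<psi> D"
  using chart_q q_eq_e unfolding chart_def inj_on_def by metis

text \<open>The common value of all full turns in the polygon, called \<open>T\<close> above;
  \<open>circling_const\<close> is the reason why there is such a value.\<close>

definition turn :: int where
  "turn = (SOME T. \<forall>R w \<delta>. isolated D n R w \<delta> \<longrightarrow> circling q R w \<delta> = T)"

lemma isolated_D_exists: "\<exists>R w \<delta>. isolated D n R w \<delta>"
proof -
  have "infinite D"
    using finite_imp_not_open[of D] by auto
  then obtain R where R: "R \<subseteq> D" "finite R" "card R = Suc (n - 2)"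
    using infinite_arbitrarily_large by blast
  then obtain w R' where w: "R = insert w R'" "w \<notin> R'" "card R' = n - 2"
    by (metis card_Suc_eq)
  then obtain \<delta> where "isolated D n R' w \<delta>"
    using R n by (metis isolated_exists[OF open_ball] finite_insert insert_subset le_add_diff_inverse2
        Suc_leD eval_nat_numeral(3))
  then show ?thesis
    by blast
qed

lemma circling_turn: "isolated D n R w \<delta> \<Longrightarrow> circling q R w \<delta> = turn"
proof -
  obtain R0 w0 \<delta>0 where "isolated D n R0 w0 \<delta>0"
    using isolated_D_exists by blast
  then have "\<forall>R w \<delta>. isolated D n R w \<delta> \<longrightarrow> circling q R w \<delta> = circling q R0 w0 \<delta>0"
    using circling_const[OF chart_q] by blast
  then have "\<forall>R w \<delta>. isolated D n R w \<delta> \<longrightarrow> circling q R w \<delta> = turn"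
    unfolding turn_def by (rule someI)
  then show "isolated D n R w \<delta> \<Longrightarrow> circling q R w \<delta> = turn"
    by blast
qed

text \<open>In the chart \<open>e\<close> a half turn has degree 1, so a full turn has degree 2, and
  by the change of charts 2 is a multiple of \<open>turn\<close>.\<close>

lemma turn_nonzero: "turn \<noteq> 0"
proof
  assume 0: "turn = 0"
  obtain R w \<delta> where iso: "isolated D n R w \<delta>"
    using isolated_D_exists by blast
  obtain R' w' \<delta>' where e': "isolated (ball 0 1) n R' w' \<delta>'" "exchange e R' w' \<delta>' = 1"
    using e_exchange by blast
  obtain m where "circling e R' w' \<delta>' = m * circling q R w \<delta>"
    using circling_chart_change[OF chart_q e \<psi>(1) inj_\<psi> \<psi>(2) q_eq_e iso e'(1)] by blast
  then show False
    using circling_eq_twice_exchange[OF e e'(1)] e'(2) circling_turn[OF iso] 0 by simp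
qed

section \<open>Passing through a side commutes with the integers\<close>

definition commutes :: "'f \<Rightarrow> bool" where
  "commutes c \<longleftrightarrow> c \<in> carrier F \<and> (\<forall>m. j m \<otimes> c = c \<otimes> j m)"

text \<open>\<open>range j\<close> is generated by \<open>j 1\<close>.\<close>

lemma commutesI:
  assumes c: "c \<in> carrier F" and "j 1 \<otimes> c = c \<otimes> j 1"
  shows "commutes c"
proof -
  have step: "j (m + 1) \<otimes> c = c \<otimes> j (m + 1) \<longleftrightarrow> j m \<otimes> c = c \<otimes> j m" for m
  proof -
    have "j (m + 1) \<otimes> c = (j m \<otimes> c) \<otimes> j 1"
      using assms by (simp add: j_add m_assoc)
    moreover have "c \<otimes> j (m + 1) = (c \<otimes> j m) \<otimes> j 1"
      using c by (simp add: j_add m_assoc)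
    ultimately show ?thesis
      using c by simp
  qed
  have "j m \<otimes> c = c \<otimes> j m" for m
  proof (induction m rule: int_induct[of _ 0])
    case base
    then show ?case
      using c by (simp add: j_0)
  next
    case (step1 i)
    then show ?case
      using step by simp
  next
    case (step2 i)
    then show ?case
      using step[of "i - 1"] by simp
  qed
  then show ?thesis
    using c by (simp add: commutes_def)
qed

text \<open>A path of one point that may leave the disc, together with a region \<open>U\<close> of
  the disc that it never meets: while one point follows \<open>\<gamma>\<close>, the others can move
  freely in \<open>U\<close>. Both ends of \<open>\<gamma>\<close> lie in the disc, so before and
  after the passage the motions of the others in \<open>U\<close> are local.\<close>

definition gate :: "complex set \<Rightarrow> (real \<Rightarrow> 'a) \<Rightarrow> bool" where
  "gate U \<gamma> \<longleftrightarrow> open U \<and> connected U \<and> U \<noteq> {} \<and> U \<subseteq> D \<and> pathin S \<gamma> \<and> (\<forall>t\<in>{0..1}. \<gamma> t \<notin> q ` U) \<and> \<gamma> 0 \<in> q ` D \<and> \<gamma> 1 \<in> q ` D"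

definition crossing :: "(real \<Rightarrow> 'a) \<Rightarrow> complex set \<Rightarrow> 'f" where
  "crossing \<gamma> Q = \<Phi> (\<lambda>t. conf_of n (insert (\<gamma> t) (q ` Q)))"

lemma qD_W: "q ` D \<subseteq> W"
  using chart_q by (simp add: chart_def)

lemma gate_family:
  fixes K :: "'v::real_normed_vector set"
  assumes \<gamma>: "gate U \<gamma>" and A: "moving_set S (n - 1) (top_of_set K) A" "\<And>x. x \<in> K \<Longrightarrow> A x \<subseteq> q ` U"
  shows "moving ({0..1} \<times> K) (\<lambda>x. insert (\<gamma> (fst x)) (A (snd x)))"
proof -
  have "moving_set S (Suc (n - 1)) (top_of_set ({0..1} \<times> K)) (\<lambda>x. insert (\<gamma> (fst x)) (A (snd x)))"
  proof (rule moving_set_insert)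
    show "moving_set S (n - 1) (top_of_set ({0..1} \<times> K)) (\<lambda>x. A (snd x))"
      by (rule moving_set_compose[OF A(1)]) (auto intro!: continuous_intros)
    have "continuous_map (top_of_set {0..1}) S \<gamma>"
      using \<gamma> by (simp add: gate_def pathin_def)
    then show "continuous_map (top_of_set ({0..1} \<times> K)) S (\<lambda>x. \<gamma> (fst x))"
      by (rule continuous_map_top_of_set_compose) (auto intro!: continuous_intros)
    show "\<gamma> (fst x) \<notin> A (snd x)" if "x \<in> topspace (top_of_set ({0..1} \<times> K))" for x
    proof -
      have "A (snd x) \<subseteq> q ` U" "fst x \<in> {0..1}"
        using that A(2)[of "snd x"] by auto
      then show ?thesis
        using \<gamma> unfolding gate_def by blast
    qed
  qed
  then show ?thesis
    using n by simp
qed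

lemma gate_family_end:
  fixes K :: "'v::real_normed_vector set"
  assumes \<gamma>: "gate U \<gamma>" and A: "moving_set S (n - 1) (top_of_set K) A" "\<And>x. x \<in> K \<Longrightarrow> A x \<subseteq> q ` U"
    and \<tau>: "\<tau> \<in> {0, 1}"
  shows "local_on ({\<tau>} \<times> K) (\<lambda>x. insert (\<gamma> (fst x)) (A (snd x)))"
  unfolding local_on_def
proof (intro conjI ballI)
  show "moving ({\<tau>} \<times> K) (\<lambda>x. insert (\<gamma> (fst x)) (A (snd x)))"
    by (rule moving_subset[OF gate_family[OF \<gamma> A(1)]]) (use \<tau> A(2) in auto)
  fix x assume x: "x \<in> {\<tau>} \<times> K"
  then have "fst x = \<tau>" "snd x \<in> K"
    by auto
  moreover from this have "A (snd x) \<subseteq> q ` U"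
    by (intro A(2))
  moreover have "\<gamma> \<tau> \<in> q ` D"
    using \<gamma> \<tau> unfolding gate_def by blast
  moreover have "q ` U \<subseteq> q ` D"
    using \<gamma> unfolding gate_def by blast
  ultimately show "insert (\<gamma> (fst x)) (A (snd x)) \<subseteq> W"
    using qD_W by blast
qed

text \<open>The product of the gate with a motion of the other points is a family over
  \<open>{0..1} \<times> K\<close>. Two edges of a square in it are crossings, the other two are
  local and contribute integers.\<close>

lemma crossing_square:
  fixes K :: "'v::real_normed_vector set"
  assumes \<gamma>: "gate U \<gamma>" and A: "moving_set S (n - 1) (top_of_set K) A" "\<And>x. x \<in> K \<Longrightarrow> A x \<subseteq> q ` U"
    and K: "convex K" "u \<in> K" "v \<in> K" and Q: "A u = q ` Q" "A v = q ` Q'"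
  shows "crossing \<gamma> Q \<otimes> j (degree (\<lambda>x. insert (\<gamma> 1) (A x)) u v)
       = j (degree (\<lambda>x. insert (\<gamma> 0) (A x)) u v) \<otimes> crossing \<gamma> Q'"
    "crossing \<gamma> Q \<in> carrier F"
proof -
  let ?K = "{0..1::real} \<times> K" and ?A = "\<lambda>x. insert (\<gamma> (fst x)) (A (snd x))"
  have mov: "moving ?K ?A"
    by (rule gate_family[OF \<gamma> A(1)]) (rule A(2))
  have loc: "local_on ({\<tau>} \<times> K) ?A" if "\<tau> \<in> {0, 1}" for \<tau>
    by (rule gate_family_end[OF \<gamma> A(1) _ that]) (rule A(2))
  have cv: "convex ?K" "convex ({\<tau>} \<times> K)" for \<tau> :: real
    by (intro convex_Times convex_real_interval K convex_singleton)+
  have vert: "j (degree (\<lambda>x. insert (\<gamma> \<tau>) (A x)) u v) = motion ?A (\<tau>, u) (\<tau>, v)" if "\<tau> \<in> {0, 1}" for \<tau>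
  proof -
    have "continuous_on K (Pair \<tau>)" "Pair \<tau> ` K \<subseteq> {\<tau>} \<times> K"
      by (auto intro!: continuous_intros)
    from degree_compose[OF cv(2) loc[OF that] K(1) this K(2,3)]
    have "degree (\<lambda>x. insert (\<gamma> \<tau>) (A x)) u v = degree ?A (\<tau>, u) (\<tau>, v)"
      by simp
    also have "j \<dots> = motion ?A (\<tau>, u) (\<tau>, v)"
      using K by (intro j_degree[OF cv(2) loc[OF that]]) auto
    finally show ?thesis .
  qed
  have horiz: "crossing \<gamma> Q = motion ?A (0, x) (1, x)" if "x \<in> K" "A x = q ` Q" for x Q
  proof -
    have "continuous_on {0..1::real} (\<lambda>t. (t, x))" "(\<lambda>t. (t, x)) ` {0..1} \<subseteq> ?K"
      using that(1) by (auto intro!: continuous_intros)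
    from \<Phi>_motion[OF cv(1) mov this] show ?thesis
      using that(2) by (simp add: crossing_def)
  qed
  show "crossing \<gamma> Q \<in> carrier F"
    unfolding horiz[OF K(2) Q(1)] using K by (intro motion_closed[OF cv(1) mov]) auto
  have "motion ?A (0, u) (1, u) \<otimes> motion ?A (1, u) (1, v) = motion ?A (0, u) (1, v)"
    "motion ?A (0, u) (0, v) \<otimes> motion ?A (0, v) (1, v) = motion ?A (0, u) (1, v)"
    using K by (intro motion_mult[OF cv(1) mov]; simp)+
  then show "crossing \<gamma> Q \<otimes> j (degree (\<lambda>x. insert (\<gamma> 1) (A x)) u v)
       = j (degree (\<lambda>x. insert (\<gamma> 0) (A x)) u v) \<otimes> crossing \<gamma> Q'"
    using vert[of 0] vert[of 1] horiz[OF K(2) Q(1)] horiz[OF K(3) Q(2)] by simp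
qed

definition spectators :: "complex set \<Rightarrow> complex set \<Rightarrow> bool" where
  "spectators U Q \<longleftrightarrow> finite Q \<and> card Q = n - 1 \<and> Q \<subseteq> U"

lemma moving_set_q:
  assumes "moving_set (top_of_set U) m T B" and U: "U \<subseteq> D"
  shows "moving_set S m T (\<lambda>x. q ` B x)"
proof (rule moving_set_image[OF assms(1)])
  show "continuous_map (top_of_set U) S q"
    by (rule continuous_map_top_of_set_compose[OF q_cont]) (use U in auto)
  show "inj_on q (topspace (top_of_set U))"
    using chart_q inj_on_subset[of q D, OF _ U] unfolding chart_def by simp
qed

text \<open>Configurations of resting points in \<open>U\<close> can be moved into each other, so
  another choice changes the crossing only by integers on both sides.\<close>

lemma crossing_transport:
  assumes \<gamma>: "gate U \<gamma>" and Q: "spectators U Q" "spectators U Q'"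
  shows "\<exists>a b. crossing \<gamma> Q \<otimes> j a = j b \<otimes> crossing \<gamma> Q'" "crossing \<gamma> Q \<in> carrier F"
proof -
  have U: "open U" "connected U" "U \<subseteq> D"
    using \<gamma> by (auto simp: gate_def)
  obtain y where y: "bij_betw y {0..<n-1} Q"
    using ex_bij_betw_nat_finite[of Q] Q(1) by (auto simp: spectators_def)
  obtain y' where y': "bij_betw y' {0..<n-1} Q'"
    using ex_bij_betw_nat_finite[of Q'] Q(2) by (auto simp: spectators_def)
  have sub: "y ` {0..<n-1} \<subseteq> U" "y' ` {0..<n-1} \<subseteq> U"
    unfolding bij_betw_imp_surj_on[OF y] bij_betw_imp_surj_on[OF y'] using Q by (simp_all add: spectators_def)
  obtain Y where Y: "motion_between U {0..<n-1} y y' Y"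
    using motion_between_exists[OF U(1,2) _ bij_betw_imp_inj_on[OF y] sub(1)
        bij_betw_imp_inj_on[OF y'] sub(2)] by blast
  have mov: "moving_set (top_of_set U) (n - 1) (top_of_set {0..1}) (\<lambda>t. Y t ` {0..<n-1})"
    by (rule moving_setI[of "{0..<n-1}" _ _ _ Y])
      (use Y in \<open>auto simp: motion_between_def continuous_map_in_subtopology image_subset_iff\<close>)
  have "Y 0 ` {0..<n-1} = y ` {0..<n-1}" "Y 1 ` {0..<n-1} = y' ` {0..<n-1}"
    using Y by (auto simp: motion_between_def intro!: image_cong)
  then have ends: "q ` Y 0 ` {0..<n-1} = q ` Q" "q ` Y 1 ` {0..<n-1} = q ` Q'"
    unfolding bij_betw_imp_surj_on[OF y] bij_betw_imp_surj_on[OF y'] by simp_all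
  have "q ` Y t ` {0..<n-1} \<subseteq> q ` U" if "t \<in> {0..1}" for t
    using Y that unfolding motion_between_def by blast
  note sq = crossing_square[OF \<gamma> moving_set_q[OF mov U(3)] this _ _ _ ends]
  show "\<exists>a b. crossing \<gamma> Q \<otimes> j a = j b \<otimes> crossing \<gamma> Q'"
    using sq(1) by (auto intro: convex_real_interval)
  show "crossing \<gamma> Q \<in> carrier F"
    using sq(2) by (auto intro: convex_real_interval)
qed

text \<open>Two of the \<open>n - 1\<close> resting points are exchanged by a half turn in a small
  disc inside \<open>U\<close>. Before and after the passage the point in the gate is merely one
  more resting point of this exchange, so both local edges of the square have degree 1 and the
  crossing commutes with \<open>j 1\<close>.\<close>

lemma spectators_with_central_crossing:
  assumes \<gamma>: "gate U \<gamma>"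
  obtains Q where "spectators U Q" "commutes (crossing \<gamma> Q)"
proof -
  have U: "open U" "U \<noteq> {}" and U_sub: "U \<subseteq> D"
    using \<gamma> by (auto simp: gate_def)
  then have "infinite U"
    using finite_imp_not_open[of U] by auto
  \<comment> \<open>\<open>R0\<close> consists of the centre \<open>w\<close> of the exchange, which
    is not itself a point of the configuration, and of \<open>n - 3\<close> points at rest; with the
    exchanged pair these make \<open>n - 1\<close>.\<close>
  then obtain R0 where R0: "R0 \<subseteq> U" "finite R0" "card R0 = Suc (n - 3)"
    using infinite_arbitrarily_large by blast
  then obtain w R where w: "R0 = insert w R" "w \<notin> R" "card R = n - 3"
    by (metis card_Suc_eq)
  have R: "finite R" "R \<subseteq> U" "w \<in> U"
    using R0 w(1) by auto
  have \<psi>c: "continuous_on U \<psi>" "inj_on \<psi> U"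
    using U_sub by (auto intro: continuous_on_subset[OF \<psi>(1)] inj_on_subset[OF inj_\<psi>])
  have sub: "\<psi> ` U \<subseteq> ball 0 1"
    using \<psi>(2) U_sub by blast
  have "open (\<psi> ` U)"
    using invariance_of_domain[OF \<psi>c(1) U(1) \<psi>c(2)] .
  then have "open (\<psi> ` U - \<psi> ` R)"
    using R(1) by (intro open_Diff finite_imp_closed) auto
  moreover have "\<psi> w \<in> \<psi> ` U - \<psi> ` R"
    using w(2) R(2,3) inj_on_image_mem_iff[OF \<psi>c(2) R(3,2)] by simp
  ultimately obtain \<epsilon> where \<epsilon>: "0 < \<epsilon>" "cball (\<psi> w) \<epsilon> \<subseteq> \<psi> ` U - \<psi> ` R"
    using open_contains_cball by metis
  let ?P = "\<lambda>z. pair 1 (\<psi> w) (\<psi> ` R) z"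
  have eq: "e ` \<psi> ` X = q ` X" if "X \<subseteq> U" for X
    using q_eq_e U_sub that unfolding image_image by (intro image_cong) auto
  have ball_sub: "cball (\<psi> w) (exp (Re z)) \<subseteq> \<psi> ` U - \<psi> ` R" if "z \<in> log_disc \<epsilon>" for z
    using subset_cball[of "exp (Re z)" \<epsilon> "\<psi> w"] \<epsilon>(2) that unfolding log_disc_def by blast
  have "moving_set (top_of_set (\<psi> ` U)) (card (\<psi> ` R) + 2) (top_of_set (log_disc \<epsilon>)) ?P"
    by (rule moving_set_pair[OF moving_set_const]) (use R(1,2) ball_sub in auto)
  moreover have "card (\<psi> ` R) + 2 = n - 1"
    using card_image[OF inj_on_subset[OF \<psi>c(2) R(2)]] w(3) n by simp
  ultimately have P: "moving_set (top_of_set (\<psi> ` U)) (n - 1) (top_of_set (log_disc \<epsilon>)) ?P"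
    by simp
  have P_sub: "?P z \<subseteq> \<psi> ` U" if "z \<in> log_disc \<epsilon>" for z
    using moving_set_sub[OF P] that by simp
  have A: "moving_set S (n - 1) (top_of_set (log_disc \<epsilon>)) (\<lambda>z. e ` ?P z)"
  proof (rule moving_set_image[OF P])
    show "continuous_map (top_of_set (\<psi> ` U)) S e"
    proof (rule continuous_map_top_of_set_compose)
      show "continuous_map (top_of_set (ball 0 1)) S e"
        using e by (simp add: chart_def)
      show "x \<in> ball 0 1" if "x \<in> \<psi> ` U" for x
        using that sub by blast
    qed (rule continuous_on_id)
    have "inj_on e (\<psi> ` U)"
      using e by (intro inj_on_subset[OF _ sub]) (simp add: chart_def)
    then show "inj_on e (topspace (top_of_set (\<psi> ` U)))"
      by simp
  qed
  have A_sub: "e ` ?P z \<subseteq> q ` U" if "z \<in> log_disc \<epsilon>" for z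
    using image_mono[OF P_sub[OF that], of e] eq[of U] by simp
  let ?l = "of_real (ln \<epsilon>) :: complex"
  have l: "?l \<in> log_disc \<epsilon>" "?l + of_real pi * \<i> \<in> log_disc \<epsilon>"
    using \<epsilon>(1) by (auto simp: log_disc_def)
  obtain Q where Q: "Q \<subseteq> U" "inj_on \<psi> Q" "?P ?l = \<psi> ` Q"
    using P_sub[OF l(1)] by (auto simp: subset_image_inj)
  have spec: "spectators U Q"
  proof -
    have "finite (?P ?l)" "card (?P ?l) = n - 1"
      using moving_set_card[OF P] l(1) by auto
    then have "finite (\<psi> ` Q)" "card (\<psi> ` Q) = n - 1"
      unfolding Q(3) by auto
    then show ?thesis
      using Q by (simp add: spectators_def card_image finite_image_iff)
  qed
  have AQ: "e ` ?P ?l = q ` Q" "e ` ?P (?l + of_real pi * \<i>) = q ` Q"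
    using eq[OF Q(1)] Q(3) by (simp_all add: pair_half_turn)
  have end_degree: "degree (\<lambda>z. insert (\<gamma> \<tau>) (e ` ?P z)) ?l (?l + of_real pi * \<i>) = 1" if \<tau>: "\<tau> \<in> {0, 1}" for \<tau>
  proof -
    have "\<gamma> \<tau> \<in> q ` D" "\<gamma> \<tau> \<notin> q ` U"
      using \<gamma> \<tau> unfolding gate_def by auto
    then obtain z0 where z0: "\<gamma> \<tau> = q z0" "z0 \<in> D" "z0 \<notin> U"
      by blast
    have z0': "\<psi> z0 \<in> ball 0 1" "\<psi> z0 \<notin> \<psi> ` U"
      using z0(2,3) \<psi>(2) inj_on_image_mem_iff[OF inj_\<psi> z0(2) U_sub] by blast+
    have iso: "isolated (ball 0 1) n (insert (\<psi> z0) (\<psi> ` R)) (\<psi> w) \<epsilon>"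
      unfolding isolated_def
    proof (intro conjI)
      have "\<psi> z0 \<notin> \<psi> ` R"
        using z0'(2) R(2) by blast
      then show "card (insert (\<psi> z0) (\<psi> ` R)) + 2 = n"
        using card_image[OF inj_on_subset[OF \<psi>c(2) R(2)]] w(3) n R(1) by simp
      show "insert (\<psi> z0) (\<psi> ` R) \<subseteq> ball 0 1" "cball (\<psi> w) \<epsilon> \<subseteq> ball 0 1"
        using z0'(1) R(2) sub \<epsilon>(2) by blast+
      show "cball (\<psi> w) \<epsilon> \<inter> insert (\<psi> z0) (\<psi> ` R) = {}"
        using z0'(2) \<epsilon>(2) by blast
    qed (use R(1) \<epsilon>(1) in auto)
    have "insert (\<gamma> \<tau>) (e ` ?P z) = e ` pair 1 (\<psi> w) (insert (\<psi> z0) (\<psi> ` R)) z" for z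
      using q_eq_e[OF z0(2)] z0(1) by (auto simp: pair_def)
    then have "degree (\<lambda>z. insert (\<gamma> \<tau>) (e ` ?P z)) ?l (?l + of_real pi * \<i>)
        = exchange e (insert (\<psi> z0) (\<psi> ` R)) (\<psi> w) \<epsilon>"
      by (simp add: orbit_degree_def)
    also have "\<dots> = 1"
      using e_exchange exchange_const[OF e iso] by metis
    finally show ?thesis .
  qed
  have "crossing \<gamma> Q \<otimes> j 1 = j 1 \<otimes> crossing \<gamma> Q" "crossing \<gamma> Q \<in> carrier F"
    using crossing_square[OF \<gamma> A A_sub convex_log_disc[OF \<epsilon>(1)] l AQ] end_degree[of 0] end_degree[of 1] by auto
  then have "commutes (crossing \<gamma> Q)"
    by (intro commutesI) auto
  then show thesis
    using that spec by blast
qed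

lemma commutesD: "commutes c \<Longrightarrow> j m \<otimes> c = c \<otimes> j m" "commutes c \<Longrightarrow> c \<in> carrier F"
  by (auto simp: commutes_def)

lemma commutes_j [simp]: "commutes (j m)"
  by (simp add: commutes_def add.commute flip: j_add)

lemma commutes_mult: "commutes c \<Longrightarrow> commutes d \<Longrightarrow> commutes (c \<otimes> d)"
  unfolding commutes_def by (metis m_assoc m_closed j_closed)

lemma commutes_inv: "commutes c \<Longrightarrow> commutes (inv c)"
  unfolding commutes_def by (metis inv_closed inv_solve_left inv_solve_right m_assoc j_closed m_closed)

lemma crossing_closed: "gate U \<gamma> \<Longrightarrow> spectators U Q \<Longrightarrow> crossing \<gamma> Q \<in> carrier F"
  using crossing_transport(2) by blast

lemma crossing_commutes:
  assumes \<gamma>: "gate U \<gamma>" and Q: "spectators U Q"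
  shows "commutes (crossing \<gamma> Q)"
proof -
  obtain Q' where Q': "spectators U Q'" "commutes (crossing \<gamma> Q')"
    using spectators_with_central_crossing[OF \<gamma>] by blast
  obtain a b where "crossing \<gamma> Q \<otimes> j a = j b \<otimes> crossing \<gamma> Q'"
    using crossing_transport(1)[OF \<gamma> Q Q'(1)] by blast
  moreover have "crossing \<gamma> Q \<otimes> j a \<otimes> inv (j a) = crossing \<gamma> Q"
    using crossing_closed[OF \<gamma> Q] by (simp add: m_assoc)
  ultimately have "crossing \<gamma> Q = j b \<otimes> crossing \<gamma> Q' \<otimes> inv (j a)"
    by simp
  then show ?thesis
    using Q'(2) by (auto intro!: commutes_mult commutes_inv)
qed

text \<open>As the crossing commutes with the integers, the two factors of
  \<open>crossing_transport\<close> can be collected on one side.\<close>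

lemma crossing_shift:
  assumes \<gamma>: "gate U \<gamma>" and Q: "spectators U Q" "spectators U Q'"
  shows "\<exists>m. crossing \<gamma> Q = crossing \<gamma> Q' \<otimes> j m"
proof -
  obtain a b where ab: "crossing \<gamma> Q \<otimes> j a = j b \<otimes> crossing \<gamma> Q'"
    using crossing_transport(1)[OF \<gamma> Q] by blast
  have c: "crossing \<gamma> Q \<in> carrier F" "crossing \<gamma> Q' \<in> carrier F"
    using crossing_closed[OF \<gamma>] Q by auto
  have "crossing \<gamma> Q = (crossing \<gamma> Q \<otimes> j a) \<otimes> j (- a)"
    using c by (simp add: m_assoc flip: j_add) (simp add: j_0)
  also have "\<dots> = crossing \<gamma> Q' \<otimes> j (b - a)"
    unfolding ab commutesD(1)[OF crossing_commutes[OF \<gamma> Q(2)]]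
    using c by (simp add: m_assoc flip: j_add)
  finally show ?thesis
    by blast
qed

end

section \<open>Two points moving along crossing chords\<close>

text \<open>A real linear map of the plane is split into its complex linear and its antilinear part.
  Its determinant is \<open>(cmod \<alpha>)\<^sup>2 - (cmod \<beta>)\<^sup>2\<close>, so it reverses
  the orientation exactly if the antilinear part dominates.\<close>

lemma real_decomposition:
  fixes A B w :: complex
  defines "\<alpha> \<equiv> (- A - \<i> * B) / 2" and "\<beta> \<equiv> (- A + \<i> * B) / 2"
  shows "of_real (Im w) * B - of_real (Re w) * A = \<alpha> * w + \<beta> * cnj w"
    "(cmod \<beta>)\<^sup>2 - (cmod \<alpha>)\<^sup>2 = - Im (A * cnj B)"
proof -
  show "of_real (Im w) * B - of_real (Re w) * A = \<alpha> * w + \<beta> * cnj w"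
    unfolding \<alpha>_def \<beta>_def by (auto simp: complex_eq_iff field_simps)
  show "(cmod \<beta>)\<^sup>2 - (cmod \<alpha>)\<^sup>2 = - Im (A * cnj B)"
    unfolding \<alpha>_def \<beta>_def norm_divide power_divide cmod_power2
    by (simp add: power2_eq_square field_simps)
qed

context conf_rep
begin

lemma degree_two_movers:
  assumes D: "chart D f" "convex D" and R: "finite R" "card R + 2 = n" "R \<subseteq> D"
    and K: "convex K" and x: "continuous_on K x1" "continuous_on K x2"
    and xK: "\<And>u. u \<in> K \<Longrightarrow> x1 u \<in> D - R \<and> x2 u \<in> D - R \<and> x1 u \<noteq> x2 u"
  shows "local_on K (\<lambda>u. f ` insert (x1 u) (insert (x2 u) R))"
proof (rule chart_local_on[OF D(1)])
  have "moving_set (top_of_set D) (Suc (Suc (card R))) (top_of_set K) (\<lambda>u. insert (x1 u) (insert (x2 u) R))"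
  proof (intro moving_set_insert moving_set_const)
    show "continuous_map (top_of_set K) (top_of_set D) x1" "continuous_map (top_of_set K) (top_of_set D) x2"
      using x xK by (auto simp: continuous_map_in_subtopology)
  qed (use R xK in auto)
  then show "moving_set (top_of_set D) n (top_of_set K) (\<lambda>u. insert (x1 u) (insert (x2 u) R))"
    using R(2) by simp
qed

text \<open>The relative position of the two points is an orientation reversing linear function of the
  parameter \<open>w\<close>. Its complex linear part is contracted to zero, and so is the motion of the first point.\<close>

lemma small_crossing:
  fixes A B :: complex
  assumes D: "chart D f" "convex D" and iso: "isolated D n R \<kappa> \<delta>"
    and AB: "Im (A * cnj B) < 0"
  obtains r where "0 < r" "\<And>u. u \<in> log_disc r \<Longrightarrow>
    degree (\<lambda>z. f ` insert (\<kappa> + of_real (Re (exp z)) * A) (insert (\<kappa> + of_real (Im (exp z)) * B) R))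
      u (u + 2 * of_real pi * \<i>) = - circling f R \<kappa> \<delta>"
proof -
  define \<alpha> \<beta> where "\<alpha> = (- A - \<i> * B) / 2" and "\<beta> = (- A + \<i> * B) / 2"
  have dec: "of_real (Im w) * B - of_real (Re w) * A = \<alpha> * w + \<beta> * cnj w" for w
    unfolding \<alpha>_def \<beta>_def by (rule real_decomposition)
  have "(cmod \<alpha>)\<^sup>2 < (cmod \<beta>)\<^sup>2"
    using real_decomposition(2)[of A B] AB unfolding \<alpha>_def \<beta>_def by linarith
  then have \<alpha>\<beta>: "cmod \<alpha> < cmod \<beta>"
    by (rule power2_less_imp_less) simp
  have \<beta>: "\<beta> \<noteq> 0"
    using \<alpha>\<beta> by auto
  have \<delta>: "0 < \<delta>" "finite R" "card R + 2 = n" "R \<subseteq> D"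
    using iso by (auto simp: isolated_def)
  \<comment> \<open>\<open>M\<close> bounds the displacement of both points per unit of
    \<open>cmod (exp z)\<close>; hence for \<open>cmod (exp z) \<le> \<delta> / M\<close> neither
    leaves the disc of radius \<open>\<delta>\<close>.\<close>
  define M where "M = cmod A + cmod \<alpha> + cmod \<beta>"
  have M: "0 < M"
    unfolding M_def using \<alpha>\<beta> norm_ge_zero[of A] norm_ge_zero[of \<alpha>] by linarith
  define r where "r = \<delta> / M"
  have r: "0 < r"
    using \<delta>(1) M by (simp add: r_def)
  let ?K = "{0..1::real} \<times> log_disc r"
  \<comment> \<open>The factor \<open>fst u\<close> leads from 1, the given motion, to 0. It scales
    the motion of the first point and the complex linear part of the difference \<open>?d\<close>.
    The antilinear part is kept, and as it dominates, the two points never collide.\<close>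
  let ?x = "\<lambda>u::real \<times> complex. \<kappa> + of_real (fst u * Re (exp (snd u))) * A"
  let ?d = "\<lambda>u::real \<times> complex. of_real (fst u) * \<alpha> * exp (snd u) + \<beta> * cnj (exp (snd u))"
  let ?G = "\<lambda>u. f ` insert (?x u) (insert (?x u + ?d u) R)"
  have near: "?x u \<in> cball \<kappa> \<delta>" "?x u + ?d u \<in> cball \<kappa> \<delta>" "?d u \<noteq> 0" if "u \<in> ?K" for u
  proof -
    obtain \<mu> z where u: "u = (\<mu>, z)" "0 \<le> \<mu>" "\<mu> \<le> 1" "exp (Re z) \<le> r"
      using \<open>u \<in> ?K\<close> by (auto simp: log_disc_def)
    let ?w = "exp z"
    have w: "cmod ?w \<le> r"
      using u(4) by simp
    have "\<bar>\<mu> * Re ?w\<bar> \<le> 1 * cmod ?w"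
      unfolding abs_mult using u(2,3) abs_Re_le_cmod[of ?w] by (intro mult_mono) auto
    then have "norm (of_real (\<mu> * Re ?w) * A) \<le> cmod ?w * cmod A"
      unfolding norm_mult norm_of_real by (intro mult_right_mono) auto
    also have "\<dots> \<le> r * cmod A"
      using w by (intro mult_right_mono) auto
    finally have 1: "norm (of_real (\<mu> * Re ?w) * A) \<le> r * cmod A" .
    have "\<mu> * (cmod \<alpha> * cmod ?w) \<le> 1 * (cmod \<alpha> * r)"
      using u(2,3) w by (intro mult_mono) auto
    then have 2: "norm (of_real \<mu> * \<alpha> * ?w) \<le> r * cmod \<alpha>"
      using u(2) by (simp add: norm_mult mult_ac)
    have "cmod \<beta> * cmod ?w \<le> cmod \<beta> * r"
      using w by (intro mult_left_mono) auto
    then have 3: "norm (\<beta> * cnj ?w) \<le> r * cmod \<beta>"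
      by (simp add: norm_mult mult_ac)
    have rM: "r * cmod A + r * cmod \<alpha> + r * cmod \<beta> = \<delta>"
    proof -
      have "r * M = \<delta>"
        using M by (simp add: r_def)
      then show ?thesis
        unfolding M_def by (simp add: distrib_left)
    qed
    have pos: "0 \<le> r * cmod \<alpha>" "0 \<le> r * cmod \<beta>"
      using r by auto
    have "norm (of_real (\<mu> * Re ?w) * A) \<le> \<delta>"
      using 1 rM pos by linarith
    then show "?x u \<in> cball \<kappa> \<delta>"
      by (simp add: u(1) dist_norm norm_mult)
    have "norm (of_real (\<mu> * Re ?w) * A + (of_real \<mu> * \<alpha> * ?w + \<beta> * cnj ?w)) \<le> \<delta>"
      using 1 2 3 rM norm_triangle_ineq[of "of_real (\<mu> * Re ?w) * A" "of_real \<mu> * \<alpha> * ?w + \<beta> * cnj ?w"]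
        norm_triangle_ineq[of "of_real \<mu> * \<alpha> * ?w" "\<beta> * cnj ?w"] by linarith
    moreover have "dist \<kappa> (?x u + ?d u) = norm (of_real (\<mu> * Re ?w) * A + (of_real \<mu> * \<alpha> * ?w + \<beta> * cnj ?w))"
    proof -
      have "?x u + ?d u - \<kappa> = of_real (\<mu> * Re ?w) * A + (of_real \<mu> * \<alpha> * ?w + \<beta> * cnj ?w)"
        by (simp add: u(1))
      then show ?thesis
        by (metis dist_commute dist_norm)
    qed
    ultimately show "?x u + ?d u \<in> cball \<kappa> \<delta>"
      unfolding mem_cball by linarith
    show "?d u \<noteq> 0"
    proof
      assume "?d u = 0"
      then have "\<beta> * cnj ?w = - (of_real \<mu> * \<alpha> * ?w)"
        by (simp add: u(1) add_eq_0_iff)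
      then have "cmod \<beta> * cmod ?w = \<mu> * cmod \<alpha> * cmod ?w"
        using u(2) by (metis norm_mult norm_minus_cancel complex_mod_cnj norm_of_real abs_of_nonneg)
      then have "cmod \<beta> = \<mu> * cmod \<alpha>"
        by simp
      also have "\<dots> \<le> 1 * cmod \<alpha>"
        using u(3) by (intro mult_right_mono) auto
      finally show False
        using \<alpha>\<beta> by simp
    qed
  qed
  have loc: "local_on ?K ?G"
  proof (rule degree_two_movers[OF D \<delta>(2-4)])
    show "convex ?K"
      by (intro convex_Times convex_real_interval convex_log_disc r)
    show "?x u \<in> D - R \<and> ?x u + ?d u \<in> D - R \<and> ?x u \<noteq> ?x u + ?d u" if "u \<in> ?K" for u
      using near[OF that] isolated_cball[OF iso order_refl] by (auto simp del: mem_cball)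
  qed (intro continuous_intros)+
  have K: "convex ?K"
    by (intro convex_Times convex_real_interval convex_log_disc r)
  let ?\<tau> = "2 * of_real pi * \<i>"
  show thesis
  proof (rule that[OF r])
    fix u assume u: "u \<in> log_disc r"
    have u': "u + ?\<tau> \<in> log_disc r"
      using u by (simp add: log_disc_def)
    have slice: "degree (\<lambda>z. ?G (\<mu>, z)) u (u + ?\<tau>) = degree ?G (\<mu>, u) ((\<mu>, u) + (0, ?\<tau>))"
      if "\<mu> \<in> {0..1}" for \<mu>
    proof -
      have "continuous_on (log_disc r) (Pair \<mu>)" "Pair \<mu> ` log_disc r \<subseteq> ?K"
        using that by (auto intro!: continuous_intros)
      from degree_compose[OF K loc convex_log_disc[OF r] this u u'] show ?thesis
        by simp
    qed
    have "(\<lambda>z. f ` insert (\<kappa> + of_real (Re (exp z)) * A) (insert (\<kappa> + of_real (Im (exp z)) * B) R))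
        = (\<lambda>z. ?G (1, z))"
    proof
      fix z
      have "\<kappa> + of_real (Re (exp z)) * A = ?x (1, z)" "\<kappa> + of_real (Im (exp z)) * B = ?x (1, z) + ?d (1, z)"
        using dec[of "exp z"] by (simp_all add: algebra_simps)
      then show "f ` insert (\<kappa> + of_real (Re (exp z)) * A) (insert (\<kappa> + of_real (Im (exp z)) * B) R) = ?G (1, z)"
        by (simp only:)
    qed
    then have "degree (\<lambda>z. f ` insert (\<kappa> + of_real (Re (exp z)) * A) (insert (\<kappa> + of_real (Im (exp z)) * B) R))
        u (u + ?\<tau>) = degree (\<lambda>z. ?G (1, z)) u (u + ?\<tau>)"
      by (simp only:)
    also have "\<dots> = degree ?G (1, u) ((1, u) + (0, ?\<tau>))"
      by (rule slice) simp
    also have "\<dots> = degree ?G (0, u) ((0, u) + (0, ?\<tau>))"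
      using u u' by (intro degree_period[OF K loc]) (auto simp: exp_add)
    also have "\<dots> = degree (\<lambda>z. ?G (0, z)) u (u + ?\<tau>)"
      by (rule slice[symmetric]) simp
    \<comment> \<open>Now the first point rests at \<open>\<kappa>\<close> and the second is at
      \<open>\<kappa> + \<beta> * cnj (exp z)\<close>. The logarithm of the difference,
      \<open>Ln \<beta> + cnj z\<close>, runs backwards over one period; this is the origin of the
      minus sign.\<close>
    also have "\<dots> = degree (\<lambda>z. f ` pair 0 \<kappa> R z) (Ln \<beta> + cnj u) (Ln \<beta> + cnj u - ?\<tau>)"
    proof -
      have "(\<lambda>z. ?G (0, z)) = (\<lambda>z. f ` pair 0 \<kappa> R (Ln \<beta> + cnj z))"
        using \<beta> by (simp add: pair_0 exp_add exp_cnj)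
      moreover have "(\<lambda>z. Ln \<beta> + cnj z) ` log_disc r \<subseteq> log_disc \<delta>"
      proof
        fix y assume "y \<in> (\<lambda>z. Ln \<beta> + cnj z) ` log_disc r"
        then obtain z where z: "y = Ln \<beta> + cnj z" "exp (Re z) \<le> r"
          by (auto simp: log_disc_def)
        have "exp (Re y) = cmod \<beta> * exp (Re z)"
          using \<beta> z(1) by (simp add: exp_add)
        also have "\<dots> \<le> M * r"
          using z(2) M by (intro mult_mono) (auto simp: M_def)
        finally show "y \<in> log_disc \<delta>"
          using M by (simp add: log_disc_def r_def)
      qed
      moreover have "continuous_on (log_disc r) (\<lambda>z. Ln \<beta> + cnj z)"
        by (intro continuous_intros)
      moreover have "local_on (log_disc \<delta>) (\<lambda>z. f ` pair 0 \<kappa> R z)"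
        by (rule pair_local_on[OF D(1) iso]) simp
      ultimately have "degree (\<lambda>z. ?G (0, z)) u (u + ?\<tau>)
          = degree (\<lambda>z. f ` pair 0 \<kappa> R z) (Ln \<beta> + cnj u) (Ln \<beta> + cnj (u + ?\<tau>))"
        using degree_compose[where g = "\<lambda>z. Ln \<beta> + cnj z" and A = "\<lambda>z. f ` pair 0 \<kappa> R z",
            OF convex_log_disc[OF \<delta>(1)] _ convex_log_disc[OF r] _ _ u u'] by (simp only:)
      also have "Ln \<beta> + cnj (u + ?\<tau>) = Ln \<beta> + cnj u - ?\<tau>"
        by simp
      finally show ?thesis .
    qed
    also have "\<dots> = - circling f R \<kappa> \<delta>"
    proof -
      let ?v = "Ln \<beta> + cnj u - ?\<tau>"
      have "exp (Re ?v) = cmod \<beta> * exp (Re u)"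
        using \<beta> by (simp add: exp_add)
      also have "\<dots> \<le> M * r"
        using u M by (intro mult_mono) (auto simp: M_def log_disc_def)
      finally have v: "?v \<in> log_disc \<delta>"
        using M by (simp add: log_disc_def r_def)
      then have v': "?v + ?\<tau> \<in> log_disc \<delta>"
        by (simp add: log_disc_def)
      have "degree (\<lambda>z. f ` pair 0 \<kappa> R z) ?v (?v + ?\<tau>) = circling f R \<kappa> \<delta>"
        by (rule orbit_degree_radius[OF D(1) iso]) (use v in \<open>simp_all add: pair_full_turn\<close>)
      moreover have "degree (\<lambda>z. f ` pair 0 \<kappa> R z) (?v + ?\<tau>) ?v = - degree (\<lambda>z. f ` pair 0 \<kappa> R z) ?v (?v + ?\<tau>)"
        by (rule degree_swap[OF convex_log_disc[OF \<delta>(1)] pair_local_on[OF D(1) iso]]) (use v v' in auto)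
      ultimately show ?thesis
        by simp
    qed
    finally show "degree (\<lambda>z. f ` insert (\<kappa> + of_real (Re (exp z)) * A) (insert (\<kappa> + of_real (Im (exp z)) * B) R))
        u (u + ?\<tau>) = - circling f R \<kappa> \<delta>" .
  qed
qed

end

section \<open>Rectangles in the parameter plane and crossing chords\<close>

context conf_rep
begin

lemma \<Phi>_joinpaths:
  assumes "pathin (unordered_conf n S) (\<lambda>t. conf_of n (G (p t)))"
    "pathin (unordered_conf n S) (\<lambda>t. conf_of n (G (p' t)))" "p 1 = p' 0"
  shows "\<Phi> (\<lambda>t. conf_of n (G ((p +++ p') t))) = \<Phi> (\<lambda>t. conf_of n (G (p t))) \<otimes> \<Phi> (\<lambda>t. conf_of n (G (p' t)))"
    "pathin (unordered_conf n S) (\<lambda>t. conf_of n (G ((p +++ p') t)))"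
proof -
  have *: "(\<lambda>t. conf_of n (G ((p +++ p') t))) = loop_join (\<lambda>t. conf_of n (G (p t))) (\<lambda>t. conf_of n (G (p' t)))"
    by (rule ext) (simp add: loop_join_def joinpaths_def)
  show "\<Phi> (\<lambda>t. conf_of n (G ((p +++ p') t))) = \<Phi> (\<lambda>t. conf_of n (G (p t))) \<otimes> \<Phi> (\<lambda>t. conf_of n (G (p' t)))"
    unfolding * by (rule \<Phi>_join) (use assms in auto)
  show "pathin (unordered_conf n S) (\<lambda>t. conf_of n (G ((p +++ p') t)))"
    unfolding * by (rule pathin_loop_join) (use assms in auto)
qed

lemma \<Phi>_linepath:
  assumes loc: "local_on {x0..x1} A" and uv: "u \<in> {x0..x1}" "v \<in> {x0..x1}"
    and G: "\<And>t. G (p t) = A ((1 - t) * u + t * v)"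
  shows "\<Phi> (\<lambda>t. conf_of n (G (p t))) = j (degree A u v)"
    "pathin (unordered_conf n S) (\<lambda>t. conf_of n (G (p t)))"
proof -
  have cv: "convex {x0..x1}"
    by (rule convex_real_interval)
  show "\<Phi> (\<lambda>t. conf_of n (G (p t))) = j (degree A u v)"
    unfolding j_degree[OF cv loc uv] G by (simp add: motion_def seg_def)
  show "pathin (unordered_conf n S) (\<lambda>t. conf_of n (G (p t)))"
    unfolding G using pathin_seg[OF cv moving_continuous[OF local_moving[OF cv loc]] uv] by simp
qed

text \<open>Locality is asked of the four edges only: the interior of the rectangle may contain a
  collision, and the sum over the edges then measures it. The top and the left edge are run
  backwards, hence their signs.\<close>

lemma \<Phi>_rectpath:
  assumes "x0 \<le> x1" "y0 \<le> y1"
    and hor: "\<And>y. y \<in> {y0, y1} \<Longrightarrow> local_on {x0..x1} (\<lambda>x. G (Complex x y))"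
    and ver: "\<And>x. x \<in> {x0, x1} \<Longrightarrow> local_on {y0..y1} (\<lambda>y. G (Complex x y))"
  shows "\<Phi> (\<lambda>t. conf_of n (G (rectpath (Complex x0 y0) (Complex x1 y1) t))) =
    j (degree (\<lambda>x. G (Complex x y0)) x0 x1 + degree (\<lambda>y. G (Complex x1 y)) y0 y1
       - degree (\<lambda>x. G (Complex x y1)) x0 x1 - degree (\<lambda>y. G (Complex x0 y)) y0 y1)"
proof -
  let ?h = "\<lambda>p t. conf_of n (G (p t))"
  have ends: "x0 \<in> {x0..x1}" "x1 \<in> {x0..x1}" "y0 \<in> {y0..y1}" "y1 \<in> {y0..y1}"
    using assms(1,2) by auto
  have line: "linepath (Complex a b) (Complex c d) t = Complex ((1 - t) * a + t * c) ((1 - t) * b + t * d)" for a b c d t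
    by (simp add: linepath_def complex_eq_iff)
  have const: "(1 - t) * a + t * a = a" for a t :: real
    by (simp add: algebra_simps)
  have l1: "\<Phi> (?h (linepath (Complex x0 y0) (Complex x1 y0))) = j (degree (\<lambda>x. G (Complex x y0)) x0 x1)"
      "pathin (unordered_conf n S) (?h (linepath (Complex x0 y0) (Complex x1 y0)))"
    by (rule \<Phi>_linepath[OF hor[of y0] ends(1,2)], simp, simp only: line const)+
  have l2: "\<Phi> (?h (linepath (Complex x1 y0) (Complex x1 y1))) = j (degree (\<lambda>y. G (Complex x1 y)) y0 y1)"
      "pathin (unordered_conf n S) (?h (linepath (Complex x1 y0) (Complex x1 y1)))"
    by (rule \<Phi>_linepath[OF ver[of x1] ends(3,4)], simp, simp only: line const)+
  have l3: "\<Phi> (?h (linepath (Complex x1 y1) (Complex x0 y1))) = j (degree (\<lambda>x. G (Complex x y1)) x1 x0)"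
      "pathin (unordered_conf n S) (?h (linepath (Complex x1 y1) (Complex x0 y1)))"
    by (rule \<Phi>_linepath[OF hor[of y1] ends(2,1)], simp, simp only: line const)+
  have l4: "\<Phi> (?h (linepath (Complex x0 y1) (Complex x0 y0))) = j (degree (\<lambda>y. G (Complex x0 y)) y1 y0)"
      "pathin (unordered_conf n S) (?h (linepath (Complex x0 y1) (Complex x0 y0)))"
    by (rule \<Phi>_linepath[OF ver[of x0] ends(4,3)], simp, simp only: line const)+
  have rev_top: "degree (\<lambda>x. G (Complex x y1)) x1 x0 = - degree (\<lambda>x. G (Complex x y1)) x0 x1"
    using degree_swap[OF convex_real_interval(5) hor[of y1] ends(1,2)] by simp
  have rev_left: "degree (\<lambda>y. G (Complex x0 y)) y1 y0 = - degree (\<lambda>y. G (Complex x0 y)) y0 y1"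
    using degree_swap[OF convex_real_interval(5) ver[of x0] ends(3,4)] by simp
  have j34: "pathin (unordered_conf n S) (?h (linepath (Complex x1 y1) (Complex x0 y1) +++ linepath (Complex x0 y1) (Complex x0 y0)))"
    "\<Phi> (?h (linepath (Complex x1 y1) (Complex x0 y1) +++ linepath (Complex x0 y1) (Complex x0 y0)))
      = j (degree (\<lambda>x. G (Complex x y1)) x1 x0) \<otimes> j (degree (\<lambda>y. G (Complex x0 y)) y1 y0)"
    using \<Phi>_joinpaths[OF l3(2) l4(2)] l3(1) l4(1) by (simp_all add: linepath_def)
  have j234: "pathin (unordered_conf n S) (?h (linepath (Complex x1 y0) (Complex x1 y1) +++ linepath (Complex x1 y1) (Complex x0 y1) +++ linepath (Complex x0 y1) (Complex x0 y0)))"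
    "\<Phi> (?h (linepath (Complex x1 y0) (Complex x1 y1) +++ linepath (Complex x1 y1) (Complex x0 y1) +++ linepath (Complex x0 y1) (Complex x0 y0)))
      = j (degree (\<lambda>y. G (Complex x1 y)) y0 y1) \<otimes> (j (degree (\<lambda>x. G (Complex x y1)) x1 x0) \<otimes> j (degree (\<lambda>y. G (Complex x0 y)) y1 y0))"
    using \<Phi>_joinpaths[OF l2(2) j34(1)] l2(1) j34(2) by (simp_all add: linepath_def joinpaths_def)
  have "\<Phi> (?h (rectpath (Complex x0 y0) (Complex x1 y1)))
      = j (degree (\<lambda>x. G (Complex x y0)) x0 x1) \<otimes> (j (degree (\<lambda>y. G (Complex x1 y)) y0 y1) \<otimes>
        (j (degree (\<lambda>x. G (Complex x y1)) x1 x0) \<otimes> j (degree (\<lambda>y. G (Complex x0 y)) y1 y0)))"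
  proof -
    have rect: "rectpath (Complex x0 y0) (Complex x1 y1) = linepath (Complex x0 y0) (Complex x1 y0) +++
        linepath (Complex x1 y0) (Complex x1 y1) +++ linepath (Complex x1 y1) (Complex x0 y1) +++
        linepath (Complex x0 y1) (Complex x0 y0)"
      by (simp add: rectpath_def Let_def)
    have join: "linepath (Complex x0 y0) (Complex x1 y0) 1 = (linepath (Complex x1 y0) (Complex x1 y1) +++
        linepath (Complex x1 y1) (Complex x0 y1) +++ linepath (Complex x0 y1) (Complex x0 y0)) 0"
      by (simp add: linepath_def joinpaths_def)
    show ?thesis
      unfolding rect \<Phi>_joinpaths(1)[OF l1(2) j234(1) join] l1(1) j234(2) by (rule refl)
  qed
  then show ?thesis
    by (simp only: rev_top rev_left flip: j_add) (simp add: algebra_simps)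
qed

text \<open>The positions on the two chords form a parameter square in which the points collide at
  the single parameter \<open>c0\<close>. The boundary of the square winds once around
  \<open>c0\<close> and contracts radially to a small loop, to which \<open>small_crossing\<close>
  applies.\<close>

lemma chord_crossing:
  fixes a0 a1 b0 b1 :: complex and s0 t0 :: real
  defines "A \<equiv> a1 - a0" and "B \<equiv> b1 - b0"
  defines "a \<equiv> \<lambda>s::real. a0 + of_real s * A" and "b \<equiv> \<lambda>t::real. b0 + of_real t * B"
  assumes D: "chart D f" "convex D" and iso: "isolated D n R \<kappa> \<delta>"
    and ends: "a0 \<in> D" "a1 \<in> D" "b0 \<in> D" "b1 \<in> D"
    and st: "0 < s0" "s0 < 1" "0 < t0" "t0 < 1" and \<kappa>: "a s0 = \<kappa>" "b t0 = \<kappa>"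
    and AB: "Im (A * cnj B) < 0"
    and R: "\<And>s. s \<in> {0..1} \<Longrightarrow> a s \<notin> R" "\<And>t. t \<in> {0..1} \<Longrightarrow> b t \<notin> R"
  shows "degree (\<lambda>s. f ` insert (a s) (insert b0 R)) 0 1 + degree (\<lambda>t. f ` insert a1 (insert (b t) R)) 0 1
      - degree (\<lambda>s. f ` insert (a s) (insert b1 R)) 0 1 - degree (\<lambda>t. f ` insert a0 (insert (b t) R)) 0 1
      = - circling f R \<kappa> \<delta>"
proof -
  have \<delta>: "0 < \<delta>" "finite R" "card R + 2 = n" "R \<subseteq> D"
    using iso by (auto simp: isolated_def)
  have a_eq: "a s = \<kappa> + of_real (s - s0) * A" and b_eq: "b t = \<kappa> + of_real (t - t0) * B" for s t
    using \<kappa> by (auto simp: a_def b_def algebra_simps)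
  \<comment> \<open>\<open>A\<close> and \<open>B\<close> are linearly independent over the reals,
    because \<open>Im (A * cnj B)\<close> is not 0; so the chords meet only once.\<close>
  have uniq: "s = s0 \<and> t = t0" if "a s = b t" for s t
  proof -
    have "of_real (s - s0) * A = of_real (t - t0) * B"
      using that by (simp add: a_eq b_eq)
    then have "of_real (s - s0) * (A * cnj B) = of_real (t - t0) * (B * cnj B)"
      by (metis mult.assoc)
    then have "of_real (s - s0) * (A * cnj B) = of_real ((t - t0) * (cmod B)\<^sup>2)"
      by (simp only: of_real_mult complex_norm_square)
    moreover have "Im (of_real (s - s0) * (A * cnj B)) = (s - s0) * Im (A * cnj B)"
      by simp
    ultimately have "(s - s0) * Im (A * cnj B) = 0"
      by (simp only: Im_complex_of_real)
    then have "s = s0"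
      using AB by auto
    moreover have "B \<noteq> 0"
      using AB by auto
    ultimately show ?thesis
      using \<open>of_real (s - s0) * A = of_real (t - t0) * B\<close> by simp
  qed
  have aD: "a s \<in> D" and bD: "b s \<in> D" if "s \<in> {0..1}" for s
  proof -
    have "a s = (1 - s) *\<^sub>R a0 + s *\<^sub>R a1" "b s = (1 - s) *\<^sub>R b0 + s *\<^sub>R b1"
      by (simp_all add: a_def b_def A_def B_def scaleR_conv_of_real algebra_simps)
    then show "a s \<in> D" "b s \<in> D"
      using that ends convexD[OF D(2)] by simp_all
  qed
  let ?G = "\<lambda>c. f ` insert (a (Re c)) (insert (b (Im c)) R)"
  let ?S = "cbox 0 (Complex 1 1)"
  define c0 where "c0 = Complex s0 t0"
  have locG: "local_on K (\<lambda>u. ?G (g u))"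
    if "convex K" "continuous_on K g" "\<And>u. u \<in> K \<Longrightarrow> g u \<in> ?S \<and> g u \<noteq> c0" for K :: "'v::real_normed_vector set" and g
  proof (rule degree_two_movers[OF D \<delta>(2-4) that(1)])
    show "continuous_on K (\<lambda>u. a (Re (g u)))" "continuous_on K (\<lambda>u. b (Im (g u)))"
      unfolding a_def b_def by (intro continuous_intros that(2))+
    fix u assume "u \<in> K"
    then have "Re (g u) \<in> {0..1}" "Im (g u) \<in> {0..1}" "Re (g u) \<noteq> s0 \<or> Im (g u) \<noteq> t0"
      using that(3) by (auto simp: in_cbox_complex_iff c0_def complex_eq_iff)
    then show "a (Re (g u)) \<in> D - R \<and> b (Im (g u)) \<in> D - R \<and> a (Re (g u)) \<noteq> b (Im (g u))"
      using aD bD R uniq by blast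
  qed
  let ?p = "rectpath (Complex 0 0) (Complex 1 1)"
  have c0: "c0 \<in> box (Complex 0 0) (Complex 1 1)"
    using st by (simp add: in_box_complex_iff c0_def)
  have p_image: "path_image ?p = cbox (Complex 0 0) (Complex 1 1) - box (Complex 0 0) (Complex 1 1)"
    by (rule path_image_rectpath_cbox_minus_box) simp_all
  have 00: "Complex 0 0 = 0"
    by (simp add: complex_eq_iff)
  have p: "?p t \<in> ?S" "?p t \<noteq> c0" if "t \<in> {0..1}" for t
    using p_image c0 that unfolding path_image_def 00 by blast+
  have c0S: "c0 \<in> ?S"
    using st by (simp add: in_cbox_complex_iff c0_def)
  have pc: "continuous_on {0..1} ?p"
    using path_rectpath unfolding path_def .
  have p_bound: "cmod (?p t - c0) \<le> 2" if "t \<in> {0..1}" for t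
  proof -
    have "\<bar>Re (?p t - c0)\<bar> \<le> 1" "\<bar>Im (?p t - c0)\<bar> \<le> 1"
      using p(1)[OF that] st by (auto simp: in_cbox_complex_iff c0_def)
    then show ?thesis
      using cmod_le[of "?p t - c0"] by linarith
  qed
  have "\<Phi> (\<lambda>t. conf_of n (?G (?p t))) =
    j (degree (\<lambda>x. ?G (Complex x 0)) 0 1 + degree (\<lambda>y. ?G (Complex 1 y)) 0 1
       - degree (\<lambda>x. ?G (Complex x 1)) 0 1 - degree (\<lambda>y. ?G (Complex 0 y)) 0 1)"
  proof (rule \<Phi>_rectpath)
    show "local_on {0..1} (\<lambda>x. ?G (Complex x y))" if "y \<in> {0, 1}" for y
      using that st by (intro locG) (auto simp: in_cbox_complex_iff c0_def complex_eq_iff intro!: continuous_intros)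
    show "local_on {0..1} (\<lambda>y. ?G (Complex x y))" if "x \<in> {0, 1}" for x
      using that st by (intro locG) (auto simp: in_cbox_complex_iff c0_def complex_eq_iff intro!: continuous_intros)
  qed simp_all
  moreover have "a 0 = a0" "a 1 = a1" "b 0 = b0" "b 1 = b1"
    by (auto simp: a_def b_def A_def B_def)
  ultimately have edges: "\<Phi> (\<lambda>t. conf_of n (?G (?p t))) =
    j (degree (\<lambda>s. f ` insert (a s) (insert b0 R)) 0 1 + degree (\<lambda>t. f ` insert a1 (insert (b t) R)) 0 1
      - degree (\<lambda>s. f ` insert (a s) (insert b1 R)) 0 1 - degree (\<lambda>t. f ` insert a0 (insert (b t) R)) 0 1)"
    by simp
  obtain r where r: "0 < r" "\<And>u. u \<in> log_disc r \<Longrightarrow>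
    degree (\<lambda>z. f ` insert (\<kappa> + of_real (Re (exp z)) * A) (insert (\<kappa> + of_real (Im (exp z)) * B) R))
      u (u + 2 * of_real pi * \<i>) = - circling f R \<kappa> \<delta>"
    using small_crossing[OF D iso AB] by blast
  obtain \<rho> where \<rho>: "0 < \<rho>" "cball c0 \<rho> \<subseteq> box (Complex 0 0) (Complex 1 1)"
    using c0 open_contains_cball[of "box (Complex 0 0) (Complex 1 1)"] by (meson open_box)
  define r' where "r' = min r \<rho>"
  have r': "0 < r'" "r' \<le> r" "r' \<le> \<rho>"
    using r(1) \<rho>(1) by (auto simp: r'_def)
  \<comment> \<open>The boundary of the square lies within distance 2 of \<open>c0\<close>, so the
    factor \<open>\<epsilon>\<close> brings it within distance \<open>r'\<close>.\<close>
  define \<epsilon> where "\<epsilon> = min 1 (r' / 2)"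
  have \<epsilon>: "0 < \<epsilon>" "\<epsilon> \<le> 1" "\<epsilon> * 2 \<le> r'"
    using r'(1) by (auto simp: \<epsilon>_def)
  let ?K = "{\<epsilon>..1} \<times> {0..1::real}"
  let ?q = "\<lambda>x::real \<times> real. c0 + of_real (fst x) * (?p (snd x) - c0)"
  have loc: "local_on ?K (\<lambda>x. ?G (?q x))"
  proof (rule locG)
    show "convex ?K"
      by (intro convex_Times convex_real_interval)
    show "continuous_on ?K ?q"
      by (intro continuous_intros continuous_on_compose2[OF pc]) auto
    fix x assume x: "x \<in> ?K"
    have "?q x = (1 - fst x) *\<^sub>R c0 + fst x *\<^sub>R ?p (snd x)"
      by (simp add: scaleR_conv_of_real algebra_simps)
    also have "\<dots> \<in> ?S"
      using x \<epsilon> p(1)[of "snd x"] c0S by (intro convexD[OF convex_box(1)]) auto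
    finally show "?q x \<in> ?S \<and> ?q x \<noteq> c0"
      using x \<epsilon> p(2)[of "snd x"] by auto
  qed
  have K: "convex ?K"
    by (intro convex_Times convex_real_interval)
  have p01: "?p 1 = ?p 0"
    using pathfinish_rectpath pathstart_rectpath unfolding pathfinish_def pathstart_def by metis
  let ?d = "degree (\<lambda>x. ?G (?q x))"
  have "?d (1, 0) (1, 1) = ?d (\<epsilon>, 0) (\<epsilon>, 1)"
  proof -
    have "?d (1, 0) (\<epsilon>, 0) = ?d (1, 1) (\<epsilon>, 1)"
      using \<epsilon> p01 by (intro degree_cong[OF K loc]) auto
    moreover have "?d (1, 0) (1, 1) + ?d (1, 1) (\<epsilon>, 1) = ?d (1, 0) (\<epsilon>, 1)"
      "?d (1, 0) (\<epsilon>, 0) + ?d (\<epsilon>, 0) (\<epsilon>, 1) = ?d (1, 0) (\<epsilon>, 1)"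
      using \<epsilon> by (intro degree_add[OF K loc]; simp)+
    ultimately show ?thesis
      by linarith
  qed
  moreover have radial: "\<Phi> (\<lambda>t. conf_of n (?G (c0 + of_real \<mu> * (?p t - c0)))) = j (?d (\<mu>, 0) (\<mu>, 1))"
    "pathin (unordered_conf n S) (\<lambda>t. conf_of n (?G (c0 + of_real \<mu> * (?p t - c0))))"
    if "\<mu> \<in> {\<epsilon>..1}" for \<mu>
  proof -
    have cl: "continuous_on {0..1} (\<lambda>t. (\<mu>, t::real))" "(\<lambda>t. (\<mu>, t)) ` {0..1} \<subseteq> ?K"
      using that by (auto intro!: continuous_intros)
    from \<Phi>_degree[OF K loc this] show "\<Phi> (\<lambda>t. conf_of n (?G (c0 + of_real \<mu> * (?p t - c0)))) = j (?d (\<mu>, 0) (\<mu>, 1))"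
      by simp
    from pathin_comp[OF moving_continuous[OF local_moving[OF K loc]] cl]
    show "pathin (unordered_conf n S) (\<lambda>t. conf_of n (?G (c0 + of_real \<mu> * (?p t - c0))))"
      by (simp add: o_def)
  qed
  moreover have "j (?d (\<epsilon>, 0) (\<epsilon>, 1)) = j (- circling f R \<kappa> \<delta>)"
  proof -
    have "winding_number ?p c0 = 1"
      by (rule winding_number_rectpath[OF c0])
    moreover have "c0 \<notin> path_image ?p"
      using c0 p_image by blast
    ultimately obtain g where g: "path g" "pathfinish g - pathstart g = 2 * of_real pi * \<i>"
      "\<And>t. t \<in> {0..1} \<Longrightarrow> ?p t = c0 + exp (g t)"
      using winding_number_as_continuous_log[of ?p c0] by auto
    let ?u = "\<lambda>t. of_real (ln \<epsilon>) + g t"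
    have u: "c0 + of_real \<epsilon> * (?p t - c0) = c0 + exp (?u t)" if "t \<in> {0..1}" for t
      using g(3)[OF that] \<epsilon>(1) by (simp add: exp_add exp_of_real)
    have uK: "?u ` {0..1} \<subseteq> log_disc r'"
    proof
      fix z assume "z \<in> ?u ` {0..1}"
      then obtain t where t: "t \<in> {0..1}" "z = ?u t"
        by auto
      have "exp (Re z) = norm (exp z)"
        by simp
      also have "exp z = of_real \<epsilon> * (?p t - c0)"
        using u[OF t(1)] t(2) by (metis add_left_cancel)
      also have "norm \<dots> \<le> \<epsilon> * 2"
        using p_bound[OF t(1)] \<epsilon>(1) by (simp add: norm_mult)
      finally show "z \<in> log_disc r'"
        using \<epsilon>(3) by (simp add: log_disc_def)
    qed
    have cv: "convex (log_disc r')"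
      by (rule convex_log_disc[OF r'(1)])
    have locL: "local_on (log_disc r') (\<lambda>z. ?G (c0 + exp z))"
    proof (rule locG[OF cv])
      fix z assume z: "z \<in> log_disc r'"
      then have "c0 + exp z \<in> cball c0 \<rho>"
        using r'(3) by (simp add: log_disc_def dist_norm)
      then have "c0 + exp z \<in> box (Complex 0 0) (Complex 1 1)"
        using \<rho>(2) by blast
      then show "c0 + exp z \<in> ?S \<and> c0 + exp z \<noteq> c0"
        using box_subset_cbox unfolding 00 by auto
    qed (intro continuous_intros)
    have "j (?d (\<epsilon>, 0) (\<epsilon>, 1)) = \<Phi> (\<lambda>t. conf_of n (?G (c0 + of_real \<epsilon> * (?p t - c0))))"
      using radial(1)[of \<epsilon>] \<epsilon> by simp
    also have "\<dots> = \<Phi> (\<lambda>t. conf_of n (?G (c0 + exp (?u t))))"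
    proof (rule \<Phi>_cong)
      show "pathin (unordered_conf n S) (\<lambda>t. conf_of n (?G (c0 + of_real \<epsilon> * (?p t - c0))))"
        using radial(2)[of \<epsilon>] \<epsilon> by simp
      show "conf_of n (?G (c0 + of_real \<epsilon> * (?p t - c0))) = conf_of n (?G (c0 + exp (?u t)))" if "t \<in> {0..1}" for t
        unfolding u[OF that] by (rule refl)
    qed
    also have "\<dots> = j (degree (\<lambda>z. ?G (c0 + exp z)) (?u 0) (?u 1))"
    proof (rule \<Phi>_degree[OF cv locL _ uK])
      show "continuous_on {0..1} ?u"
        using g(1) unfolding path_def by (intro continuous_intros)
    qed
    also have "?u 1 = ?u 0 + 2 * of_real pi * \<i>"
      using g(2) by (simp add: pathfinish_def pathstart_def algebra_simps)
    also have "(\<lambda>z. ?G (c0 + exp z)) =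
        (\<lambda>z. f ` insert (\<kappa> + of_real (Re (exp z)) * A) (insert (\<kappa> + of_real (Im (exp z)) * B) R))"
      by (simp add: a_eq b_eq c0_def)
    also have "degree \<dots> (?u 0) (?u 0 + 2 * of_real pi * \<i>) = - circling f R \<kappa> \<delta>"
    proof (rule r(2))
      have "?u 0 \<in> log_disc r'"
        using uK by (rule subsetD) simp
      then show "?u 0 \<in> log_disc r"
        using r'(2) by (simp add: log_disc_def)
    qed
    finally show ?thesis .
  qed
  ultimately have "\<Phi> (\<lambda>t. conf_of n (?G (?p t))) = j (- circling f R \<kappa> \<delta>)"
    using radial(1)[of 1] \<epsilon> by simp
  then show ?thesis
    unfolding edges j_eq_iff .
qed

end

section \<open>One point circling around all the others\<close>

context polygon_rep
begin

lemma one_mover_local: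
  assumes Q: "finite Q" "Suc (card Q) = n" "Q \<subseteq> D" and x: "continuous_on K x"
    and xK: "\<And>u. u \<in> K \<Longrightarrow> x u \<in> D - Q"
  shows "local_on K (\<lambda>u. q ` insert (x u) Q)"
proof (rule chart_local_on[OF chart_q])
  have "moving_set (top_of_set D) (Suc (card Q)) (top_of_set K) (\<lambda>u. insert (x u) Q)"
  proof (intro moving_set_insert moving_set_const)
    show "continuous_map (top_of_set K) (top_of_set D) x"
      using x xK by (auto simp: continuous_map_in_subtopology)
  qed (use Q xK in auto)
  then show "moving_set (top_of_set D) n (top_of_set K) (\<lambda>u. insert (x u) Q)"
    using Q(2) by simp
qed

lemma rectangle_in_D:
  assumes "z \<in> cbox (Complex (-1/2) (-1/2)) (Complex (1/2) (1/2))"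
  shows "cmod z \<le> 4/5"
proof -
  have "\<bar>Re z\<bar> \<le> 1/2" "\<bar>Im z\<bar> \<le> 1/2"
    using assms by (auto simp: in_cbox_complex_iff)
  then have "(Re z)\<^sup>2 \<le> (1/2)\<^sup>2" "(Im z)\<^sup>2 \<le> (1/2)\<^sup>2"
    by (metis abs_ge_zero power2_abs power_mono)+
  then have "(cmod z)\<^sup>2 \<le> (4/5)\<^sup>2"
    unfolding cmod_power2 by (simp add: power2_eq_square)
  then show ?thesis
    by (rule power2_le_imp_le) simp
qed

text \<open>The boundary of the rectangle winds once around the only resting point inside, so
  \<open>\<Phi>_winding\<close> evaluates the sum over its edges.\<close>

lemma rectangle_degree:
  assumes Q: "finite Q" "Suc (card Q) = n" "Q \<subseteq> D" "w \<in> Q"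
    and rect: "-1/2 \<le> x0" "x0 < Re w" "Re w < x1" "x1 \<le> 1/2" "\<bar>Im w\<bar> < 1/2"
    and sep: "cbox (Complex x0 (-1/2)) (Complex x1 (1/2)) \<inter> Q = {w}"
  shows "degree (\<lambda>x. q ` insert (Complex x (-1/2)) Q) x0 x1 + degree (\<lambda>y. q ` insert (Complex x1 y) Q) (-1/2) (1/2)
      - degree (\<lambda>x. q ` insert (Complex x (1/2)) Q) x0 x1 - degree (\<lambda>y. q ` insert (Complex x0 y) Q) (-1/2) (1/2) = turn"
    (is "?N = _")
proof -
  let ?C = "cbox (Complex x0 (-1/2)) (Complex x1 (1/2))"
  let ?p = "rectpath (Complex x0 (-1/2)) (Complex x1 (1/2))"
  have CD: "?C \<subseteq> D"
  proof
    fix z assume "z \<in> ?C"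
    then have "z \<in> cbox (Complex (-1/2) (-1/2)) (Complex (1/2) (1/2))"
      using rect by (auto simp: in_cbox_complex_iff)
    from rectangle_in_D[OF this] show "z \<in> D"
      by simp
  qed
  have edge: "z \<in> D - Q" if "z \<in> ?C" "z \<noteq> w" for z
    using that CD sep by blast
  have "\<Phi> (\<lambda>t. conf_of n (q ` insert (?p t) Q)) = j ?N"
  proof (rule \<Phi>_rectpath)
    show "local_on {x0..x1} (\<lambda>x. q ` insert (Complex x y) Q)" if "y \<in> {-1/2, 1/2}" for y
    proof (rule one_mover_local[OF Q(1-3)])
      show "Complex x y \<in> D - Q" if "x \<in> {x0..x1}" for x
        using that \<open>y \<in> {-1/2, 1/2}\<close> rect by (intro edge) (auto simp: in_cbox_complex_iff)
    qed (auto intro!: continuous_intros)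
    show "local_on {-1/2..1/2} (\<lambda>y. q ` insert (Complex x y) Q)" if "x \<in> {x0, x1}" for x
    proof (rule one_mover_local[OF Q(1-3)])
      show "Complex x y \<in> D - Q" if "y \<in> {-1/2..1/2}" for y
        using that \<open>x \<in> {x0, x1}\<close> rect by (intro edge) (auto simp: in_cbox_complex_iff)
    qed (auto intro!: continuous_intros)
  qed (use rect in auto)
  moreover have "\<Phi> (\<lambda>t. conf_of n (q ` insert (?p t) Q)) = j (1 * turn)"
  proof -
    have w: "w \<in> box (Complex x0 (-1/2)) (Complex x1 (1/2))"
      using rect by (auto simp: in_box_complex_iff)
    have card: "card (Q - {w}) + 2 = n"
      using Q n by (simp add: card_Diff_singleton)
    have "Q - {w} \<subseteq> D" "w \<in> D" "w \<notin> Q - {w}" "finite (Q - {w})"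
      using Q by blast+
    then obtain \<delta> where iso: "isolated D n (Q - {w}) w \<delta>"
      using isolated_exists[OF open_ball _ card] by blast
    have "path_image ?p = ?C - box (Complex x0 (-1/2)) (Complex x1 (1/2))"
      by (rule path_image_rectpath_cbox_minus_box) (use rect in auto)
    then have "path_image ?p \<subseteq> ?C - {w}"
      using w by blast
    moreover have "winding_number ?p w = of_int 1"
      using winding_number_rectpath[OF w] by simp
    ultimately have "\<Phi> (\<lambda>t. conf_of n (q ` insert (?p t) Q)) = j (1 * circling q (Q - {w}) w \<delta>)"
      using \<Phi>_winding[OF chart_q convex_box(1) CD Q(1-3) sep iso path_rectpath] by simp
    then show ?thesis
      by (simp add: circling_turn[OF iso])
  qed
  ultimately show ?thesis
    by (simp add: j_eq_iff)
qed

text \<open>The resting points sit on a line, one in each of \<open>n - 1\<close> vertical strips of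
  a square. Going around a strip contributes \<open>turn\<close>, the common edges of neighbouring
  strips cancel, and the boundary of the square is deformed to the circle of radius 4/5 in an
  annulus around the cluster.\<close>

lemma cluster_degree:
  obtains Q where "finite Q" "card Q = n - 1" "Q \<subseteq> ball 0 (1/2)"
    "degree (\<lambda>z. q ` insert (exp z) Q) (of_real (ln (4/5))) (of_real (ln (4/5)) + 2 * of_real pi * \<i>)
      = int (n - 1) * turn"
proof -
  define m where "m = n - 1"
  have m: "m > 0" "Suc m = n"
    using n by (auto simp: m_def)
  \<comment> \<open>The cuts \<open>v i\<close> divide the interval from -1/2 to 1/2 into
    \<open>m\<close> equal parts, whose midpoints are the \<open>y i\<close>.\<close>
  define v where "v i = (2 * real i - real m) / (2 * real m)" for i
  define y where "y i = complex_of_real ((2 * real i + 1 - real m) / (2 * real m))" for i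
  define Q where "Q = y ` {..<m}"
  have v_mono: "v i \<le> v k" if "i \<le> k" for i k
    using that m by (auto simp: v_def divide_right_mono)
  have vy: "v i < Re (y i)" "Re (y i) < v (Suc i)" for i
    using m by (auto simp: v_def y_def divide_strict_right_mono)
  have v_ends: "v 0 = -1/2" "v m = 1/2"
    using m by (auto simp: v_def field_simps)
  have v_range: "v i \<in> {-1/2..1/2}" if "i \<le> m" for i
    using v_mono[of 0 i] v_mono[OF that] v_ends by auto
  have Im_y: "Im (y i) = 0" for i
    by (simp add: y_def)
  have inj_y: "inj_on y {..<m}"
    using m by (auto simp: inj_on_def y_def)
  have Q: "finite Q" "Suc (card Q) = n"
    using m by (simp_all add: Q_def card_image[OF inj_y])
  have Q_ball: "Q \<subseteq> ball 0 (1/2)"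
  proof
    fix z assume "z \<in> Q"
    then obtain i where i: "i < m" "z = y i"
      by (auto simp: Q_def)
    have "-1/2 < Re (y i)" "Re (y i) < 1/2"
      using vy[of i] v_range[of i] v_range[of "Suc i"] i by auto
    then have "\<bar>Re (y i)\<bar> < 1/2"
      by auto
    moreover have "cmod (y i) = \<bar>Re (y i)\<bar>"
      using Im_y[of i] by (simp add: cmod_def)
    ultimately show "z \<in> ball 0 (1/2)"
      by (simp add: i(2))
  qed
  then have QD: "Q \<subseteq> D"
    by force
  let ?hor = "\<lambda>\<eta> x. q ` insert (Complex x \<eta>) Q" and ?ver = "\<lambda>x y. q ` insert (Complex x y) Q"
  have outside: "z \<in> D - Q" if "z \<in> cbox (Complex (-1/2) (-1/2)) (Complex (1/2) (1/2))" "1/2 \<le> cmod z" for z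
    using rectangle_in_D[OF that(1)] that(2) Q_ball by auto
  have far: "1/2 \<le> cmod (Complex x \<eta>)" "1/2 \<le> cmod (Complex \<eta> x)" if "\<eta> \<in> {-1/2, 1/2}" for x \<eta>
    using that abs_Re_le_cmod[of "Complex \<eta> x"] abs_Im_le_cmod[of "Complex x \<eta>"] by auto
  have hor: "local_on {-1/2..1/2} (?hor \<eta>)" if "\<eta> \<in> {-1/2, 1/2}" for \<eta>
  proof (rule one_mover_local[OF Q QD])
    show "Complex x \<eta> \<in> D - Q" if "x \<in> {-1/2..1/2}" for x
      using that \<open>\<eta> \<in> {-1/2, 1/2}\<close> by (intro outside far) (auto simp: in_cbox_complex_iff)
  qed (auto intro!: continuous_intros)
  have ver: "local_on {-1/2..1/2} (?ver x)" if "x \<in> {-1/2, 1/2}" for x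
  proof (rule one_mover_local[OF Q QD])
    show "Complex x y \<in> D - Q" if "y \<in> {-1/2..1/2}" for y
      using that \<open>x \<in> {-1/2, 1/2}\<close> by (intro outside far) (auto simp: in_cbox_complex_iff)
  qed (auto intro!: continuous_intros)
  \<comment> \<open>Along the bottom to the cut \<open>v i\<close>, up the cut and back along the
    top. Successive values differ by the boundary of one strip, so the sum over the strips
    telescopes.\<close>
  define f where "f i = degree (?hor (-1/2)) (v 0) (v i) + degree (?ver (v i)) (-1/2) (1/2)
      - degree (?hor (1/2)) (v 0) (v i)" for i
  have step: "f (Suc i) - f i = turn" if i: "i < m" for i
  proof -
    have "degree (?hor (-1/2)) (v i) (v (Suc i)) + degree (?ver (v (Suc i))) (-1/2) (1/2)
        - degree (?hor (1/2)) (v i) (v (Suc i)) - degree (?ver (v i)) (-1/2) (1/2) = turn"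
    proof (rule rectangle_degree[OF Q QD, of "y i"])
      show "cbox (Complex (v i) (-1/2)) (Complex (v (Suc i)) (1/2)) \<inter> Q = {y i}"
      proof (intro equalityI subsetI)
        fix z assume z: "z \<in> cbox (Complex (v i) (-1/2)) (Complex (v (Suc i)) (1/2)) \<inter> Q"
        then obtain k where k: "k < m" "z = y k"
          by (auto simp: Q_def)
        have "v i \<le> Re (y k)" "Re (y k) \<le> v (Suc i)"
          using z k by (auto simp: in_cbox_complex_iff)
        then have "\<not> k < i" "\<not> i < k"
          using vy[of k] v_mono[of "Suc k" i] v_mono[of "Suc i" k] by (auto simp: Suc_le_eq)
        then show "z \<in> {y i}"
          using k by simp
      next
        fix z assume "z \<in> {y i}"
        then show "z \<in> cbox (Complex (v i) (-1/2)) (Complex (v (Suc i)) (1/2)) \<inter> Q"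
          using vy[of i] i by (auto simp: in_cbox_complex_iff Q_def Im_y)
      qed
    qed (use i vy[of i] v_range[of i] v_range[of "Suc i"] in \<open>auto simp: Q_def Im_y\<close>)
    moreover have "degree (?hor \<eta>) (v 0) (v i) + degree (?hor \<eta>) (v i) (v (Suc i)) = degree (?hor \<eta>) (v 0) (v (Suc i))"
      if "\<eta> \<in> {-1/2, 1/2}" for \<eta>
      by (rule degree_add[OF convex_real_interval(5) hor[OF that]]) (use i v_range in auto)
    from this[of "-1/2"] this[of "1/2"] calculation show ?thesis
      unfolding f_def by simp
  qed
  have f: "f i = f 0 + int i * turn" if "i \<le> m" for i
    using that
  proof (induction i)
    case (Suc i)
    then show ?case
      using step[of i] by (simp add: algebra_simps)
  qed simp
  let ?p = "rectpath (Complex (-1/2) (-1/2)) (Complex (1/2) (1/2))"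
  have "\<Phi> (\<lambda>t. conf_of n (q ` insert (?p t) Q)) =
      j (degree (?hor (-1/2)) (-1/2) (1/2) + degree (?ver (1/2)) (-1/2) (1/2)
       - degree (?hor (1/2)) (-1/2) (1/2) - degree (?ver (-1/2)) (-1/2) (1/2))"
    by (rule \<Phi>_rectpath) (use hor ver in auto)
  also have "degree (?hor (-1/2)) (-1/2) (1/2) + degree (?ver (1/2)) (-1/2) (1/2)
       - degree (?hor (1/2)) (-1/2) (1/2) - degree (?ver (-1/2)) (-1/2) (1/2) = f m - f 0"
    using degree_refl[OF convex_real_interval(5) hor] unfolding f_def v_ends by simp
  also have "f m - f 0 = int m * turn"
    using f[of m] by simp
  finally have rect: "\<Phi> (\<lambda>t. conf_of n (q ` insert (?p t) Q)) = j (int m * turn)" .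
  let ?B = "box (Complex (-1/2) (-1/2)) (Complex (1/2) (1/2))"
  have 0: "0 \<in> ?B"
    by (simp add: in_box_complex_iff)
  have p_image: "path_image ?p = cbox (Complex (-1/2) (-1/2)) (Complex (1/2) (1/2)) - ?B"
    by (rule path_image_rectpath_cbox_minus_box) simp_all
  then have "0 \<notin> path_image ?p"
    using 0 by blast
  then obtain h where h: "path h" "pathfinish h - pathstart h = 2 * of_real pi * \<i>"
      "\<And>t. t \<in> {0..1} \<Longrightarrow> ?p t = 0 + exp (h t)"
    using winding_number_as_continuous_log[of ?p 0] winding_number_rectpath[OF 0] by auto
  \<comment> \<open>Logarithms of the annulus between the radii 1/2 and 4/5, which avoids the
    cluster and contains the boundary of the square.\<close>
  let ?K = "{z. ln (1/2) \<le> Re z \<and> Re z \<le> ln (4/5)}"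
  have K: "convex ?K"
    unfolding Collect_conj_eq by (intro convex_Int convex_halfspace_Re_ge convex_halfspace_Re_le)
  have locK: "local_on ?K (\<lambda>z. q ` insert (exp z) Q)"
  proof (rule one_mover_local[OF Q QD])
    fix z assume "z \<in> ?K"
    then have "exp (ln (1/2)) \<le> exp (Re z)" "exp (Re z) \<le> exp (ln (4/5::real))"
      unfolding exp_le_cancel_iff by auto
    then have "1/2 \<le> cmod (exp z)" "cmod (exp z) \<le> 4/5"
      by simp_all
    then show "exp z \<in> D - Q"
      using Q_ball by auto
  qed (intro continuous_intros)
  have hK: "h ` {0..1} \<subseteq> ?K"
  proof
    fix z assume "z \<in> h ` {0..1}"
    then obtain t where t: "t \<in> {0..1}" "z = h t"
      by auto
    then have pt: "?p t = exp z" "?p t \<in> path_image ?p"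
      using h(3) by (auto simp: path_image_def)
    then have z: "exp z \<in> cbox (Complex (-1/2) (-1/2)) (Complex (1/2) (1/2))" "exp z \<notin> ?B"
      using p_image by auto
    have "\<not> (\<bar>Re (exp z)\<bar> < 1/2 \<and> \<bar>Im (exp z)\<bar> < 1/2)"
      using z(2) by (auto simp: in_box_complex_iff abs_less_iff)
    then have "1/2 \<le> cmod (exp z)"
      using abs_Re_le_cmod[of "exp z"] abs_Im_le_cmod[of "exp z"] by linarith
    then have "exp (ln (1/2)) \<le> exp (Re z)" "exp (Re z) \<le> exp (ln (4/5::real))"
      using rectangle_in_D[OF z(1)] by simp_all
    then show "z \<in> ?K"
      by (simp only: exp_le_cancel_iff mem_Collect_eq)
  qed
  have "h 1 = h 0 + 2 * of_real pi * \<i>"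
    using h(2) by (simp add: pathfinish_def pathstart_def algebra_simps)
  have "\<Phi> (\<lambda>t. conf_of n (q ` insert (?p t) Q)) = \<Phi> (\<lambda>t. conf_of n (q ` insert (exp (h t)) Q))"
  proof (rule \<Phi>_cong[symmetric])
    show "pathin (unordered_conf n S) (\<lambda>t. conf_of n (q ` insert (exp (h t)) Q))"
      using pathin_comp[OF moving_continuous[OF local_moving[OF K locK]] _ hK] h(1)
      by (simp add: path_def o_def)
    show "conf_of n (q ` insert (exp (h t)) Q) = conf_of n (q ` insert (?p t) Q)" if "t \<in> {0..1}" for t
      using h(3)[OF that] by simp
  qed
  also have "\<dots> = j (degree (\<lambda>z. q ` insert (exp z) Q) (h 0) (h 1))"
    using h(1) by (intro \<Phi>_degree[OF K locK _ hK]) (simp add: path_def)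
  finally have "int m * turn = degree (\<lambda>z. q ` insert (exp z) Q) (h 0) (h 0 + 2 * of_real pi * \<i>)"
    using rect \<open>h 1 = _\<close> by (simp add: j_eq_iff)
  also have "\<dots> = degree (\<lambda>z. q ` insert (exp z) Q) (of_real (ln (4/5))) (of_real (ln (4/5)) + 2 * of_real pi * \<i>)"
  proof (rule degree_period[OF K locK])
    show "h 0 \<in> ?K" "h 0 + 2 * of_real pi * \<i> \<in> ?K"
      using hK \<open>h 1 = _\<close> by (auto simp: image_subset_iff)
  qed (auto simp: exp_add)
  finally show thesis
    using that[of Q] Q Q_ball m by (simp add: m_def)
qed

end

section \<open>The commutator of the two crossings of a handle\<close>

lemma cmod_rim [simp]: "cmod (rim g u) = 1"
  by (simp add: rim_def)

text \<open>The ray outward from the circle of radius 4/5 in the direction \<open>P\<close>. A point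
  leaving the disc travels along it, so it is removed from the region left to the other
  points.\<close>

definition slit :: "complex \<Rightarrow> complex set" where
  "slit P = {z. 4/5 \<le> cmod z \<and> z = of_real (cmod z) * P}"

lemma closed_slit: "closed (slit P)"
  unfolding slit_def Collect_conj_eq
  by (intro closed_Int closed_Collect_le closed_Collect_eq continuous_intros)

text \<open>Slits point away from the centre; hence the region that remains is starlike about 0 and
  therefore connected.\<close>

lemma starlike_slit_complement:
  assumes "z \<notin> slit P" "0 \<le> t" "t \<le> 1"
  shows "t *\<^sub>R z \<notin> slit P"
proof
  assume t: "t *\<^sub>R z \<in> slit P"
  then have "4/5 \<le> t * cmod z" and eq: "of_real t * z = of_real (t * cmod z) * P"
    using assms(2) by (auto simp: slit_def scaleR_conv_of_real norm_mult)
  then have "t \<noteq> 0"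
    by auto
  moreover have "of_real t * z = of_real t * (of_real (cmod z) * P)"
    using eq by (simp add: mult.assoc)
  ultimately have "z = of_real (cmod z) * P"
    by simp
  moreover have "t * cmod z \<le> 1 * cmod z"
    using assms by (intro mult_right_mono) auto
  ultimately show False
    using assms(1) \<open>4/5 \<le> t * cmod z\<close> by (auto simp: slit_def)
qed

context polygon_rep
begin

lemma q_eq_imp: "z \<in> ball 0 1 \<Longrightarrow> w \<in> cball 0 1 \<Longrightarrow> q z = q w \<Longrightarrow> z = w"
  using q_sphere[of z w] inj_onD[OF q_inj, of z w] by (cases "cmod w = 1") auto

text \<open>Outward along one ray, through the side of the polygon, and inward along the ray at the
  identified boundary point. The halves fit together if \<open>rim g u\<close> and
  \<open>rim g v\<close> have the same image under \<open>q\<close>.\<close>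

definition side_gate :: "real \<Rightarrow> real \<Rightarrow> real \<Rightarrow> 'a" where
  "side_gate u v = loop_join (\<lambda>t. q (of_real (4/5 + t/5) * rim g u)) (\<lambda>t. q (of_real (1 - t/5) * rim g v))"

definition gate_region :: "real \<Rightarrow> real \<Rightarrow> complex set" where
  "gate_region u v = D - slit (rim g u) - slit (rim g v)"

lemma side_gate_value:
  assumes "t \<in> {0..1}"
  obtains r w where "r \<in> {4/5..1}" "w \<in> {u, v}" "side_gate u v t = q (of_real r * rim g w)"
proof (cases "t \<le> 1/2")
  case True
  then show ?thesis
    using assms that[of "4/5 + 2 * t/5" u] by (simp add: side_gate_def loop_join_def)
next
  case False
  then show ?thesis
    using assms that[of "1 - (2 * t - 1)/5" v] by (simp add: side_gate_def loop_join_def)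
qed

lemma side_gate_ends:
  "side_gate u v 0 = q (of_real (4/5) * rim g u)" "side_gate u v 1 = q (of_real (4/5) * rim g v)"
  by (simp_all add: side_gate_def)

lemma pathin_radial: "r \<in> {0..1} \<Longrightarrow> r' \<in> {0..1} \<Longrightarrow> pathin S (\<lambda>t. q (of_real (r + t * (r' - r)) * rim g u))"
  unfolding pathin_def
proof (rule continuous_map_top_of_set_compose[OF q_cont])
  fix t :: real
  assume r: "r \<in> {0..1}" "r' \<in> {0..1}" and t: "t \<in> {0..1}"
  have "r + t * (r' - r) = (1 - t) * r + t * r'"
    by (simp add: algebra_simps)
  then have "r + t * (r' - r) \<in> {0..1}"
    using convexD[OF convex_real_interval(5) r, of "1 - t" t] t by simp
  then show "of_real (r + t * (r' - r)) * rim g u \<in> cball 0 1"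
    by (simp add: norm_mult del: of_real_add of_real_mult)
qed (intro continuous_intros)

lemma pathin_side_gate:
  assumes "q (rim g u) = q (rim g v)"
  shows "pathin S (side_gate u v)"
  unfolding side_gate_def
proof (rule pathin_loop_join)
  show "pathin S (\<lambda>t. q (of_real (4/5 + t/5) * rim g u))"
    using pathin_radial[of "4/5" 1 u] by simp
  show "pathin S (\<lambda>t. q (of_real (1 - t/5) * rim g v))"
  proof -
    have "1 + t * (4/5 - 1) = 1 - t/5" for t :: real
      by simp
    from pathin_radial[of 1 "4/5" v, unfolded this] show ?thesis
      by simp
  qed
qed (use assms in simp)

lemma gate_side_gate:
  assumes "q (rim g u) = q (rim g v)"
  shows "gate (gate_region u v) (side_gate u v)"
  unfolding gate_def
proof (intro conjI ballI)
  show "open (gate_region u v)"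
    unfolding gate_region_def by (intro open_Diff open_ball closed_slit)
  have 0: "0 \<in> gate_region u v"
    by (simp add: gate_region_def slit_def)
  have "starlike (gate_region u v)"
    unfolding starlike_def
  proof (intro bexI ballI subsetI)
    fix z x assume z: "z \<in> gate_region u v" and "x \<in> closed_segment 0 z"
    then obtain t where t: "0 \<le> t" "t \<le> 1" "x = t *\<^sub>R z"
      by (auto simp: in_segment)
    have "x \<in> D"
      using z t convexD[OF convex_ball, of 0 0 "9/10" z "1 - t" t] by (simp add: gate_region_def)
    then show "x \<in> gate_region u v"
      using z t starlike_slit_complement by (simp add: gate_region_def)
  qed (rule 0)
  then show "connected (gate_region u v)"
    by (rule starlike_imp_connected)
  show "gate_region u v \<noteq> {}"
    using 0 by blast
  show "gate_region u v \<subseteq> D"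
    by (auto simp: gate_region_def)
  show "pathin S (side_gate u v)"
    by (rule pathin_side_gate[OF assms])
  show "side_gate u v 0 \<in> q ` D" "side_gate u v 1 \<in> q ` D"
    unfolding side_gate_ends by (rule imageI; simp add: norm_mult)+
  fix t :: real assume "t \<in> {0..1}"
  then obtain r w where r: "r \<in> {4/5..1}" "w \<in> {u, v}" "side_gate u v t = q (of_real r * rim g w)"
    by (rule side_gate_value)
  show "side_gate u v t \<notin> q ` gate_region u v"
  proof
    assume "side_gate u v t \<in> q ` gate_region u v"
    then obtain z where z: "z \<in> gate_region u v" "q z = q (of_real r * rim g w)"
      using r(3) by auto
    then have "z = of_real r * rim g w"
      using r(1) by (intro q_eq_imp) (auto simp: gate_region_def norm_mult)
    then have "z \<in> slit (rim g w)"
      using r(1) by (simp add: slit_def norm_mult)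
    then show False
      using z(1) r(2) by (auto simp: gate_region_def)
  qed
qed

text \<open>Equal values would give two boundary points with the same image or, since points of the
  open polygon are not identified with others, the same direction; both contradict
  \<open>q (rim g u) \<noteq> q (rim g u')\<close>. Hence two points can pass the two gates at the
  same time.\<close>

lemma side_gates_disjoint:
  assumes uv: "q (rim g u) = q (rim g v)" "q (rim g u') = q (rim g v')" "q (rim g u) \<noteq> q (rim g u')"
    and t: "t \<in> {0..1}" "t' \<in> {0..1}"
  shows "side_gate u v t \<noteq> side_gate u' v' t'"
proof
  assume eq: "side_gate u v t = side_gate u' v' t'"
  obtain r w where r: "r \<in> {4/5..1}" "w \<in> {u, v}" "side_gate u v t = q (of_real r * rim g w)"
    using t(1) by (rule side_gate_value)
  obtain r' w' where r': "r' \<in> {4/5..1}" "w' \<in> {u', v'}" "side_gate u' v' t' = q (of_real r' * rim g w')"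
    using t(2) by (rule side_gate_value)
  have ne: "q (rim g w) \<noteq> q (rim g w')"
    using uv r(2) r'(2) by auto
  have qq: "q (of_real r * rim g w) = q (of_real r' * rim g w')"
    using eq r(3) r'(3) by simp
  have "of_real r * rim g w = of_real r' * rim g w'"
  proof (cases "r = 1 \<and> r' = 1")
    case True
    then show ?thesis
      using qq ne by simp
  next
    case False
    then consider "r < 1" | "r' < 1"
      using r(1) r'(1) by fastforce
    then show ?thesis
    proof cases
      case 1
      then show ?thesis
        using r(1) r'(1) by (intro q_eq_imp[OF _ _ qq]) (simp_all add: norm_mult)
    next
      case 2
      then show ?thesis
        using r(1) r'(1) by (intro q_eq_imp[OF _ _ qq[symmetric], symmetric]) (simp_all add: norm_mult)
    qed
  qed
  moreover from arg_cong[OF this, of cmod] have "r = r'"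
    using r(1) r'(1) by (simp add: norm_mult)
  ultimately have "rim g w = rim g w'"
    using r(1) by simp
  then show False
    using ne by simp
qed

text \<open>Two points pass disjoint gates independently, which gives a family over the unit square;
  the two orders of passing are its two boundary paths. Opposite edges differ in the place of the
  partner, which rests before or after its own passage.\<close>

lemma gate_gate_square:
  assumes \<gamma>: "gate U \<gamma>" "gate U' \<gamma>'" and disj: "\<And>t t'. t \<in> {0..1} \<Longrightarrow> t' \<in> {0..1} \<Longrightarrow> \<gamma> t \<noteq> \<gamma>' t'"
    and R: "finite R" "card R + 2 = n" "R \<subseteq> U" "R \<subseteq> U'"
    and ends: "\<gamma> 0 = q a1" "\<gamma> 1 = q a0" "\<gamma>' 0 = q b1" "\<gamma>' 1 = q b0"
  shows "crossing \<gamma> (insert b1 R) \<otimes> crossing \<gamma>' (insert a0 R)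
    = crossing \<gamma>' (insert a1 R) \<otimes> crossing \<gamma> (insert b0 R)"
proof -
  let ?K = "{0..1::real} \<times> {0..1::real}"
  let ?A = "\<lambda>x. insert (\<gamma> (fst x)) (insert (\<gamma>' (snd x)) (q ` R))"
  have RD: "R \<subseteq> D"
    using R(3) \<gamma>(1) by (auto simp: gate_def)
  have inj: "inj_on q R"
    using chart_q inj_on_subset[of q D R, OF _ RD] by (simp add: chart_def)
  have RS: "q ` R \<subseteq> topspace S"
    using chart_q RD by (auto simp: chart_def continuous_map_def)
  have avoid: "\<gamma> t \<notin> q ` R" "\<gamma>' t \<notin> q ` R" if "t \<in> {0..1}" for t
    using \<gamma> R(3,4) that unfolding gate_def by blast+
  have c: "continuous_map (top_of_set ?K) S (\<lambda>x. \<gamma> (fst x))" "continuous_map (top_of_set ?K) S (\<lambda>x. \<gamma>' (snd x))"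
    by (rule continuous_map_top_of_set_compose[where K = "{0..1}"];
        use \<gamma> in \<open>auto simp: gate_def pathin_def intro!: continuous_intros\<close>)+
  have "moving_set S (Suc (Suc (card (q ` R)))) (top_of_set ?K) ?A"
  proof (intro moving_set_insert moving_set_const c)
    show "finite (q ` R)" "card (q ` R) = card (q ` R)" "q ` R \<subseteq> topspace S"
      using R(1) RS by auto
    fix x assume x: "x \<in> topspace (top_of_set ?K)"
    then have "fst x \<in> {0..1}" "snd x \<in> {0..1}"
      by auto
    then show "\<gamma>' (snd x) \<notin> q ` R" "\<gamma> (fst x) \<notin> insert (\<gamma>' (snd x)) (q ` R)"
      using avoid disj by blast+
  qed
  then have mov: "moving ?K ?A"
    using R(2) by (simp add: card_image[OF inj])
  have K: "convex ?K"
    by (intro convex_Times convex_real_interval)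
  have edge: "crossing \<gamma> (insert b R) = motion ?A (0, t) (1, t)"
    if "t \<in> {0..1}" "\<gamma>' t = q b" for t b
  proof -
    have "continuous_on {0..1} (\<lambda>s::real. (s, t))" "(\<lambda>s. (s, t)) ` {0..1} \<subseteq> ?K"
      using that(1) by (auto intro!: continuous_intros)
    from \<Phi>_motion[OF K mov this] show ?thesis
      using that(2) by (simp add: crossing_def)
  qed
  have edge': "crossing \<gamma>' (insert a R) = motion ?A (t, 0) (t, 1)"
    if "t \<in> {0..1}" "\<gamma> t = q a" for t a
  proof -
    have "continuous_on {0..1} (\<lambda>s::real. (t, s))" "(\<lambda>s. (t, s)) ` {0..1} \<subseteq> ?K"
      using that(1) by (auto intro!: continuous_intros)
    from \<Phi>_motion[OF K mov this] show ?thesis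
      using that(2) by (simp add: crossing_def insert_commute)
  qed
  have "motion ?A (0, 0) (1, 0) \<otimes> motion ?A (1, 0) (1, 1) = motion ?A (0, 0) (1, 1)"
    "motion ?A (0, 0) (0, 1) \<otimes> motion ?A (0, 1) (1, 1) = motion ?A (0, 0) (1, 1)"
    by (intro motion_mult[OF K mov]; simp)+
  then show ?thesis
    using edge[of 0 b1] edge[of 1 b0] edge'[of 1 a0] edge'[of 0 a1] ends by simp
qed

text \<open>While one point passes the gate, a partner moves along \<open>x\<close> in
  \<open>U\<close>; the integers are the degrees of this motion with the first point resting at the
  entrance or at the exit of the gate.\<close>

lemma chord_gate_square:
  fixes x :: "real \<Rightarrow> complex"
  assumes \<gamma>: "gate U \<gamma>" and R: "finite R" "card R + 2 = n" "R \<subseteq> U"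
    and x: "continuous_on {0..1} x" "\<And>s. s \<in> {0..1} \<Longrightarrow> x s \<in> U - R"
    and ends: "\<gamma> 0 = q b1" "\<gamma> 1 = q b0"
  shows "crossing \<gamma> (insert (x 0) R) \<otimes> j (degree (\<lambda>s. q ` insert b0 (insert (x s) R)) 0 1)
    = j (degree (\<lambda>s. q ` insert b1 (insert (x s) R)) 0 1) \<otimes> crossing \<gamma> (insert (x 1) R)"
    "spectators U (insert (x 0) R)"
proof -
  have U: "U \<subseteq> D"
    using \<gamma> by (simp add: gate_def)
  have "moving_set (top_of_set U) (Suc (card R)) (top_of_set {0..1}) (\<lambda>s. insert (x s) R)"
  proof (intro moving_set_insert moving_set_const)
    show "continuous_map (top_of_set {0..1}) (top_of_set U) x"
      using x by (auto simp: continuous_map_in_subtopology)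
  qed (use R x in auto)
  then have mov: "moving_set (top_of_set U) (n - 1) (top_of_set {0..1}) (\<lambda>s. insert (x s) R)"
    by (simp add: R(2)[symmetric])
  have sub: "q ` insert (x s) R \<subseteq> q ` U" if "s \<in> {0..1}" for s
    using x(2)[OF that] R(3) by (intro image_mono) auto
  have "crossing \<gamma> (insert (x 0) R) \<otimes> j (degree (\<lambda>s. insert (\<gamma> 1) (q ` insert (x s) R)) 0 1)
    = j (degree (\<lambda>s. insert (\<gamma> 0) (q ` insert (x s) R)) 0 1) \<otimes> crossing \<gamma> (insert (x 1) R)"
  proof (rule crossing_square(1)[OF \<gamma> moving_set_q[OF mov U]])
    show "q ` insert (x s) R \<subseteq> q ` U" if "s \<in> {0..1}" for s
      by (rule sub[OF that])
  qed (simp_all add: convex_real_interval)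
  then show "crossing \<gamma> (insert (x 0) R) \<otimes> j (degree (\<lambda>s. q ` insert b0 (insert (x s) R)) 0 1)
    = j (degree (\<lambda>s. q ` insert b1 (insert (x s) R)) 0 1) \<otimes> crossing \<gamma> (insert (x 1) R)"
    unfolding ends image_insert .
  show "spectators U (insert (x 0) R)"
    using moving_set_card[OF mov, of 0] x(2)[of 0] R(3) by (auto simp: spectators_def)
qed

end

context polygon_rep
begin

lemma commutes_shift:
  assumes c: "commutes c" and d: "d \<in> carrier F" and eq: "c \<otimes> j a = j b \<otimes> d"
  shows "d = c \<otimes> j (a - b)"
proof -
  have "d = j (- b) \<otimes> (j b \<otimes> d)"
    using d by (simp add: j_0 flip: m_assoc j_add)
  also have "\<dots> = c \<otimes> j (- b) \<otimes> j a"
    using commutesD[OF c] by (simp add: eq[symmetric] m_assoc flip: commutesD(1)[OF c])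
  also have "\<dots> = c \<otimes> j (a - b)"
    using commutesD(2)[OF c] by (simp add: m_assoc flip: j_add)
  finally show ?thesis .
qed

lemma mult_shifted:
  assumes c: "commutes c" and d: "commutes d"
  shows "(c \<otimes> j a) \<otimes> (d \<otimes> j b) = c \<otimes> d \<otimes> j (a + b)"
proof -
  have cl: "c \<in> carrier F" "d \<in> carrier F"
    using c d by (auto simp: commutes_def)
  have "(c \<otimes> j a) \<otimes> (d \<otimes> j b) = c \<otimes> (j a \<otimes> d) \<otimes> j b"
    using cl by (simp add: m_assoc)
  also have "\<dots> = c \<otimes> (d \<otimes> j a) \<otimes> j b"
    by (simp only: commutesD(1)[OF d])
  also have "\<dots> = c \<otimes> d \<otimes> j (a + b)"
    using cl by (simp add: m_assoc j_add)
  finally show ?thesis .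
qed

text \<open>The two gates of a handle are closed up by two chords of the disc that cross once.
  Passing both gates at once gives commutativity with partners in different places,
  \<open>X1 \<otimes> Y0 = Y1 \<otimes> X0\<close>. Moving the partners along their chords expresses
  \<open>X1\<close> and \<open>Y1\<close> by \<open>X0\<close> and \<open>Y0\<close> at the cost of
  integers, and these add up to the contribution of the crossing of the chords.\<close>

lemma handle_commutator:
  assumes k: "k < g"
  defines "ua \<equiv> 4 * real k + 1/2" and "ub \<equiv> 4 * real k + 3/2"
    and "va \<equiv> 4 * real k + 5/2" and "vb \<equiv> 4 * real k + 7/2"
  assumes Qa: "spectators (gate_region ua va) Qa" and Qb: "spectators (gate_region ub vb) Qb"
  shows "crossing (side_gate ua va) Qa \<otimes> crossing (side_gate ub vb) Qb
    = crossing (side_gate ub vb) Qb \<otimes> crossing (side_gate ua va) Qa \<otimes> j (- turn)"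
proof -
  have glue: "q (rim g ua) = q (rim g va)" "q (rim g ub) = q (rim g vb)" "q (rim g ua) \<noteq> q (rim g ub)"
  proof -
    have e: "4 * real k + 3 - 1/2 = va" "4 * real k + 1 + 1/2 = ub" "4 * real k + 4 - 1/2 = vb"
      by (simp_all add: ub_def va_def vb_def)
    show "q (rim g ua) = q (rim g va)" "q (rim g ub) = q (rim g vb)" "q (rim g ua) \<noteq> q (rim g ub)"
      using side_a[OF k, of "1/2", unfolded e] side_b[OF k, of "1/2", unfolded e] sides_differ[OF k]
      by (simp_all add: ua_def ub_def)
  qed
  note ga = gate_side_gate[OF glue(1)] and gb = gate_side_gate[OF glue(2)]
  \<comment> \<open>Half the angle of a side. Relative to the direction \<open>c\<close> of the
    corner at parameter \<open>4 k + 2\<close>, the midpoints of the four sides of the handle have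
    the angles \<open>- 3 \<phi>\<close>, \<open>- \<phi>\<close>, \<open>\<phi>\<close> and
    \<open>3 \<phi>\<close>; since \<open>g \<ge> 1\<close>, these stay below \<open>pi\<close> in
    modulus.\<close>
  define \<phi> where "\<phi> = pi / (4 * real g)"
  have "1 \<le> real g"
    using g by simp
  then have \<phi>: "0 < \<phi>" "\<phi> \<le> pi / 4"
    by (auto simp: \<phi>_def field_simps)
  define c where "c = cis (2 * \<phi> * (4 * real k + 2))"
  define C1 S1 C3 S3 where "C1 = cos \<phi>" and "S1 = sin \<phi>" and "C3 = cos (3 * \<phi>)" and "S3 = sin (3 * \<phi>)"
  have S: "0 < S1" "0 < S3"
    unfolding S1_def S3_def using \<phi> pi_gt_zero by (auto intro!: sin_gt_zero)
  have C: "C3 < C1" "0 < C1" "C1 < 1"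
    unfolding C1_def C3_def using \<phi> pi_gt_zero cos_monotone_0_pi[of 0 \<phi>]
    by (auto intro!: cos_monotone_0_pi cos_gt_zero)
  have circle: "C1\<^sup>2 + S1\<^sup>2 = 1" "C3\<^sup>2 + S3\<^sup>2 = 1"
    by (simp_all add: C1_def S1_def C3_def S3_def)
  have c0: "c \<noteq> 0" "cmod c = 1"
    by (simp_all add: c_def)
  \<comment> \<open>Coordinates in which the axis of symmetry of the handle is horizontal and the
    circle of radius 4/5 becomes the unit circle.\<close>
  define pt where "pt x y = of_real (4/5) * (c * Complex x y)" for x y
  have pt_eq: "pt x y = pt x' y' \<longleftrightarrow> x = x' \<and> y = y'" for x y x' y'
    using c0 by (simp add: pt_def)
  have pt_diff: "pt x y - pt x' y' = pt (x - x') (y - y')" for x y x' y'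
  proof -
    have "Complex x y - Complex x' y' = Complex (x - x') (y - y')"
      by (simp add: complex_eq_iff)
    then show ?thesis
      by (simp only: pt_def flip: right_diff_distrib)
  qed
  have pt_cmod: "cmod (pt x y) = 4/5 * sqrt (x\<^sup>2 + y\<^sup>2)" for x y
    using c0(2) by (simp add: pt_def norm_mult complex_norm)
  have rims: "of_real (4/5) * rim g ua = pt C3 (- S3)" "of_real (4/5) * rim g ub = pt C1 (- S1)"
    "of_real (4/5) * rim g va = pt C1 S1" "of_real (4/5) * rim g vb = pt C3 S3"
  proof -
    have rim: "rim g u = c * cis \<alpha>" if "2 * u * \<phi> = 2 * \<phi> * (4 * real k + 2) + \<alpha>" for u \<alpha>
    proof -
      have "2 * pi * u / (4 * real g) = 2 * \<phi> * (4 * real k + 2) + \<alpha>"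
        using that by (simp add: \<phi>_def field_simps)
      then show ?thesis
        by (simp add: rim_def c_def cis_mult)
    qed
    have "rim g ua = c * cis (- (3 * \<phi>))" "rim g ub = c * cis (- \<phi>)" "rim g va = c * cis \<phi>" "rim g vb = c * cis (3 * \<phi>)"
      by (rule rim; simp add: ua_def ub_def va_def vb_def field_simps)+
    then show "of_real (4/5) * rim g ua = pt C3 (- S3)" "of_real (4/5) * rim g ub = pt C1 (- S1)"
      "of_real (4/5) * rim g va = pt C1 S1" "of_real (4/5) * rim g vb = pt C3 S3"
      by (simp_all add: pt_def cis.code C1_def S1_def C3_def S3_def)
  qed
  define p h where "p = C1 - C3" and "h = S1 + S3"
  have ph: "0 < p" "0 < h"
    using C S by (auto simp: p_def h_def)
  \<comment> \<open>The gates lead from \<open>a1\<close> to \<open>a0\<close> and from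
    \<open>b1\<close> to \<open>b0\<close>, and the chords lead back. As segments the chords are
    mirror images of each other in the axis.\<close>
  define a0 a1 b0 b1 where "a0 = pt C1 S1" and "a1 = pt C3 (- S3)" and "b0 = pt C3 S3" and "b1 = pt C1 (- S1)"
  define a where "a = (\<lambda>s::real. a0 + of_real s * (a1 - a0))"
  define b where "b = (\<lambda>t::real. b0 + of_real t * (b1 - b0))"
  have pt_line: "pt x y + of_real s * pt x' y' = pt (x + s * x') (y + s * y')" for x y x' y' s
  proof -
    have sum: "Complex x y + of_real s * Complex x' y' = Complex (x + s * x') (y + s * y')"
      by (simp add: complex_eq_iff)
    show ?thesis
      unfolding pt_def by (simp only: sum[symmetric]) (simp add: algebra_simps)
  qed
  have a_pt: "a s = pt (C1 - s * p) (S1 - s * h)" and b_pt: "b t = pt (C3 + t * p) (S3 - t * h)" for s t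
    unfolding a_def b_def a0_def a1_def b0_def b1_def pt_diff pt_line pt_eq p_def h_def
    by (simp_all add: algebra_simps)
  have a_ends: "a 0 = a0" "a 1 = a1" and b_ends: "b 0 = b0" "b 1 = b1"
    by (simp_all add: a_def b_def)
  have cb: "a0 \<in> cball 0 (4/5)" "a1 \<in> cball 0 (4/5)" "b0 \<in> cball 0 (4/5)" "b1 \<in> cball 0 (4/5)"
    by (simp_all add: a0_def a1_def b0_def b1_def pt_cmod circle)
  have a_cball: "a s \<in> cball 0 (4/5)" and b_cball: "b s \<in> cball 0 (4/5)" if s: "s \<in> {0..1}" for s
  proof -
    have "a s = (1 - s) *\<^sub>R a0 + s *\<^sub>R a1" "b s = (1 - s) *\<^sub>R b0 + s *\<^sub>R b1"
      by (simp_all add: a_def b_def scaleR_conv_of_real algebra_simps)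
    moreover have "(1 - s) *\<^sub>R a0 + s *\<^sub>R a1 \<in> cball 0 (4/5)" "(1 - s) *\<^sub>R b0 + s *\<^sub>R b1 \<in> cball 0 (4/5)"
      using cb s by (intro convexD[OF convex_cball]; simp)+
    ultimately show "a s \<in> cball 0 (4/5)" "b s \<in> cball 0 (4/5)"
      by (simp_all only:)
  qed
  have cball_D: "z \<in> D" if "z \<in> cball 0 (4/5)" for z
    using that by simp
  have slit_cball: "z = of_real (4/5) * P" if "z \<in> cball 0 (4/5)" "z \<in> slit P" for z P
  proof -
    have "cmod z = 4/5"
      using that by (auto simp: slit_def)
    then show ?thesis
      using that(2) unfolding slit_def by (metis (mono_tags, lifting) mem_Collect_eq)
  qed
  have one: "s = 1" if "s * p = p" for s
    using that ph by simp
  have a_region: "a s \<in> gate_region ub vb" if s: "s \<in> {0..1}" for s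
  proof -
    have "s = 1" if "C1 - s * p = C3"
      by (rule one) (use that p_def in linarith)
    then have "a s \<noteq> pt C1 (- S1)" "a s \<noteq> pt C3 S3"
      using ph S by (auto simp: a_pt pt_eq h_def)
    then have "a s \<notin> slit (rim g ub)" "a s \<notin> slit (rim g vb)"
      using slit_cball[OF a_cball[OF s]] rims by metis+
    then show ?thesis
      using cball_D[OF a_cball[OF s]] unfolding gate_region_def by blast
  qed
  have b_region: "b t \<in> gate_region ua va" if t: "t \<in> {0..1}" for t
  proof -
    have "t = 1" if "C3 + t * p = C1"
      by (rule one) (use that p_def in linarith)
    then have "b t \<noteq> pt C1 S1" "b t \<noteq> pt C3 (- S3)"
      using ph S by (auto simp: b_pt pt_eq h_def)
    then have "b t \<notin> slit (rim g ua)" "b t \<notin> slit (rim g va)"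
      using slit_cball[OF b_cball[OF t]] rims by metis+
    then show ?thesis
      using cball_D[OF b_cball[OF t]] unfolding gate_region_def by blast
  qed
  \<comment> \<open>The resting points are placed on the axis beyond \<open>C1\<close>, where the
    first coordinates of the chords do not reach.\<close>
  have "infinite {C1<..<1}"
    using C(3) by (rule infinite_Ioo)
  then obtain X where X: "X \<subseteq> {C1<..<1}" "finite X" "card X = n - 2"
    using infinite_arbitrarily_large by blast
  define R where "R = (\<lambda>\<rho>. pt \<rho> 0) ` X"
  have "inj_on (\<lambda>\<rho>. pt \<rho> 0) X"
    by (auto simp: inj_on_def pt_eq)
  then have R: "finite R" "card R + 2 = n"
    using X n by (simp_all add: R_def card_image)
  have R_cmod: "cmod z < 4/5" if "z \<in> R" for z
    using that X C by (auto simp: R_def pt_cmod)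
  have R_region: "R \<subseteq> gate_region u v" for u v
    using R_cmod by (force simp: gate_region_def slit_def)
  have RD: "R \<subseteq> D"
    using R_cmod by force
  have aR: "a s \<notin> R" if "s \<in> {0..1}" for s
  proof
    assume "a s \<in> R"
    then obtain \<rho> where "C1 < \<rho>" "C1 - s * p = \<rho>"
      using X by (auto simp: R_def a_pt pt_eq)
    moreover have "0 \<le> s * p"
      using that ph by simp
    ultimately show False
      by linarith
  qed
  have bR: "b t \<notin> R" if "t \<in> {0..1}" for t
  proof
    assume "b t \<in> R"
    then obtain \<rho> where "C1 < \<rho>" "C3 + t * p = \<rho>"
      using X by (auto simp: R_def b_pt pt_eq)
    moreover have "t * p \<le> 1 * p"
      using that ph by (intro mult_right_mono) auto
    ultimately show False
      by (simp add: p_def)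
  qed
  \<comment> \<open>By symmetry the chords meet on the axis; these parameters make the second
    coordinates vanish.\<close>
  define s0 t0 where "s0 = S1 / h" and "t0 = S3 / h"
  have s0h: "s0 * h = S1" "t0 * h = S3"
    using ph by (simp_all add: s0_def t0_def)
  have pos: "0 < s0" "0 < t0"
    unfolding s0_def t0_def using S ph by simp_all
  have "(s0 + t0) * h = 1 * h"
    unfolding distrib_right s0h by (simp add: h_def)
  then have "s0 + t0 = 1"
    using ph(2) mult_right_cancel[of h "s0 + t0" 1] by linarith
  then have st: "0 < s0" "s0 < 1" "0 < t0" "t0 < 1" "s0 + t0 = 1" "s0 * h = S1" "t0 * h = S3"
    using pos s0h by linarith+
  have "(s0 + t0) * p = p"
    unfolding st(5) by simp
  then have "C3 + t0 * p = C1 - s0 * p"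
    using p_def unfolding distrib_right by linarith
  then have ab: "b t0 = a s0"
    using st(6,7) by (simp add: a_pt b_pt)
  have s0: "s0 \<in> {0..1}"
    using st by simp
  obtain \<delta> where iso: "isolated D n R (a s0) \<delta>"
    using isolated_exists[OF open_ball R RD cball_D[OF a_cball[OF s0]] aR[OF s0]] by blast
  \<comment> \<open>In the rotated coordinates the chords have the directions
    \<open>(- p, - h)\<close> and \<open>(p, - h)\<close>. Here the sign of the commutator is
    decided.\<close>
  have AB: "Im ((a1 - a0) * cnj (b1 - b0)) < 0"
  proof -
    have "a1 - a0 = pt (- p) (- h)" "b1 - b0 = pt p (- h)"
      by (simp_all add: a0_def a1_def b0_def b1_def pt_diff pt_eq p_def h_def)
    moreover have "pt x y * cnj (pt x' y') = of_real (16/25) * (Complex x y * cnj (Complex x' y'))" for x y x' y'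
    proof -
      have "c * cnj c = 1"
        by (simp add: c_def cis_cnj cis_mult)
      moreover have "pt x y * cnj (pt x' y') = (c * cnj c) * (of_real (16/25) * (Complex x y * cnj (Complex x' y')))"
        unfolding pt_def by (simp add: field_simps del: complex_cnj)
      ultimately show ?thesis
        by simp
    qed
    ultimately have "(a1 - a0) * cnj (b1 - b0) = of_real (16/25) * (Complex (- p) (- h) * cnj (Complex p (- h)))"
      by (simp only:)
    also have "Im \<dots> = 16/25 * Im (Complex (- p) (- h) * cnj (Complex p (- h)))"
      by (simp only: Im_complex_of_real Re_complex_of_real times_complex.sel mult_zero_left add_0_right)
    also have "\<dots> = - (32/25 * (p * h))"
      by simp
    finally show ?thesis
      using ph by simp
  qed
  have "degree (\<lambda>s. q ` insert (a s) (insert b0 R)) 0 1 + degree (\<lambda>t. q ` insert a1 (insert (b t) R)) 0 1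
      - degree (\<lambda>s. q ` insert (a s) (insert b1 R)) 0 1 - degree (\<lambda>t. q ` insert a0 (insert (b t) R)) 0 1
      = - circling q R (a s0) \<delta>"
    unfolding a_def b_def
  proof (rule chord_crossing[OF chart_q convex_ball iso[unfolded a_def] _ _ _ _ st(1-4) _ _ AB])
    show "a0 + of_real s * (a1 - a0) \<notin> R" if "s \<in> {0..1}" for s
      using aR[OF that] unfolding a_def .
    show "b0 + of_real t * (b1 - b0) \<notin> R" if "t \<in> {0..1}" for t
      using bR[OF that] unfolding b_def .
  qed (use cb cball_D ab in \<open>simp_all add: a_def b_def\<close>)
  moreover define u u' v v' where "u = degree (\<lambda>s. q ` insert (a s) (insert b0 R)) 0 1"
    and "u' = degree (\<lambda>s. q ` insert (a s) (insert b1 R)) 0 1"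
    and "v = degree (\<lambda>t. q ` insert a0 (insert (b t) R)) 0 1"
    and "v' = degree (\<lambda>t. q ` insert a1 (insert (b t) R)) 0 1"
  ultimately have uv: "u + v' - u' - v = - turn"
    by (simp add: circling_turn[OF iso])
  let ?\<gamma>a = "side_gate ua va" and ?\<gamma>b = "side_gate ub vb"
  have gate_ends: "?\<gamma>a 0 = q a1" "?\<gamma>a 1 = q a0" "?\<gamma>b 0 = q b1" "?\<gamma>b 1 = q b0"
    by (simp_all only: side_gate_ends rims a0_def a1_def b0_def b1_def)
  have ac: "continuous_on {0..1} a" and bc: "continuous_on {0..1} b"
    unfolding a_def b_def by (intro continuous_intros)+
  have aU: "a s \<in> gate_region ub vb - R" if "s \<in> {0..1}" for s
    using a_region aR that by blast
  have bU: "b t \<in> gate_region ua va - R" if "t \<in> {0..1}" for t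
    using b_region bR that by blast
  note sqb = chord_gate_square[OF gb R R_region ac aU gate_ends(3,4), unfolded a_ends]
  note sqa = chord_gate_square[OF ga R R_region bc bU gate_ends(1,2), unfolded b_ends]
  define X0 X1 Y0 Y1 where "X0 = crossing ?\<gamma>a (insert b0 R)" and "X1 = crossing ?\<gamma>a (insert b1 R)"
    and "Y0 = crossing ?\<gamma>b (insert a0 R)" and "Y1 = crossing ?\<gamma>b (insert a1 R)"
  have sq: "Y0 \<otimes> j u = j u' \<otimes> Y1" "X0 \<otimes> j v = j v' \<otimes> X1"
    using sqa(1) sqb(1) unfolding X0_def X1_def Y0_def Y1_def u_def u'_def v_def v'_def
    by (simp_all only: insert_commute)
  have specs: "spectators (gate_region ub vb) (insert a0 R)" "spectators (gate_region ua va) (insert b0 R)"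
    using sqa(2) sqb(2) by simp_all
  have "spectators (gate_region ub vb) (insert a1 R)" "spectators (gate_region ua va) (insert b1 R)"
    using specs a_region[of 1] b_region[of 1] R R_region aR[of 1] bR[of 1] n
    unfolding spectators_def a_ends b_ends by auto
  then have cl1: "X1 \<in> carrier F" "Y1 \<in> carrier F"
    unfolding X1_def Y1_def using crossing_closed ga gb by auto
  have com: "commutes X0" "commutes Y0"
    unfolding X0_def Y0_def using crossing_commutes ga gb specs by auto
  then have cl0: "X0 \<in> carrier F" "Y0 \<in> carrier F"
    by (auto dest: commutesD(2))
  have shift: "Y1 = Y0 \<otimes> j (u - u')" "X1 = X0 \<otimes> j (v - v')"
    using commutes_shift com cl1 sq by auto
  have "X1 \<otimes> Y0 = Y1 \<otimes> X0"
    unfolding X0_def X1_def Y0_def Y1_def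
    by (rule gate_gate_square[OF ga gb side_gates_disjoint[OF glue] R R_region R_region gate_ends])
  then have "(X0 \<otimes> j (v - v')) \<otimes> (Y0 \<otimes> j 0) = (Y0 \<otimes> j (u - u')) \<otimes> (X0 \<otimes> j 0)"
    using cl0 by (simp add: shift j_0)
  then have eq: "X0 \<otimes> Y0 \<otimes> j (v - v') = Y0 \<otimes> X0 \<otimes> j (u - u')"
    using com by (simp add: mult_shifted)
  \<comment> \<open>Other resting points multiply the two crossings by integers, which commute with
    both crossings and enter the two sides of the relation equally.\<close>
  obtain m m' where m: "crossing ?\<gamma>a Qa = X0 \<otimes> j m" "crossing ?\<gamma>b Qb = Y0 \<otimes> j m'"
    using crossing_shift[OF ga Qa specs(2)] crossing_shift[OF gb Qb specs(1)] unfolding X0_def Y0_def by blast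
  have "crossing ?\<gamma>a Qa \<otimes> crossing ?\<gamma>b Qb = X0 \<otimes> Y0 \<otimes> j (v - v') \<otimes> j (m + m' - (v - v'))"
    unfolding m mult_shifted[OF com] using cl0 by (simp add: m_assoc flip: j_add)
  also have "\<dots> = Y0 \<otimes> X0 \<otimes> j (u - u' + (m + m' - (v - v')))"
    unfolding eq using cl0 by (simp add: m_assoc j_add)
  also have "u - u' + (m + m' - (v - v')) = (m' + m) + - turn"
    using uv by linarith
  also have "Y0 \<otimes> X0 \<otimes> j \<dots> = crossing ?\<gamma>b Qb \<otimes> crossing ?\<gamma>a Qa \<otimes> j (- turn)"
    unfolding m mult_shifted[OF com(2,1)] using cl0 by (simp add: m_assoc flip: j_add)
  finally show ?thesis .
qed

end

section \<open>The relation given by the polygon\<close>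

context polygon_rep
begin

definition angle :: "real \<Rightarrow> complex" where
  "angle u = of_real (2 * pi * u / (4 * real g)) * \<i>"

lemma exp_angle: "exp (of_real a + angle u) = of_real (exp a) * rim g u"
  by (simp add: angle_def rim_def exp_add exp_of_real cis_conv_exp mult_ac)

lemma exp_angle': "exp (angle u) = rim g u"
  using exp_angle[of 0 u] by simp

lemma angle_line: "(1 - t) *\<^sub>R angle u + t *\<^sub>R angle v = angle ((1 - t) * u + t * v)"
  by (simp add: angle_def scaleR_conv_of_real ring_distribs add_divide_distrib diff_divide_distrib mult_ac)

lemma Re_angle [simp]: "Re (angle u) = 0"
  by (simp add: angle_def)

lemma angle_0 [simp]: "angle 0 = 0"
  by (simp add: angle_def)

lemma angle_turn: "angle (4 * real g) = 2 * of_real pi * \<i>"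
  using g by (simp add: angle_def)

text \<open>One point moves in the annulus between the circle of radius \<open>4/5\<close> and the boundary of the
  polygon, parametrised by the logarithm; the other points form the cluster \<open>Q\<close>.\<close>

theorem no_extension: False
proof -
  obtain Q where Q: "finite Q" "card Q = n - 1" "Q \<subseteq> ball 0 (1/2)"
    and cluster: "degree (\<lambda>z. q ` insert (exp z) Q) (of_real (ln (4/5))) (of_real (ln (4/5)) + 2 * of_real pi * \<i>)
      = int (n - 1) * turn"
    by (rule cluster_degree)
  define A where "A = (\<lambda>z. q ` insert (exp z) Q)"
  define L :: complex where "L = of_real (ln (4/5))"
  \<comment> \<open>Motions over the strip \<open>?K\<close> have values in \<open>F\<close> only;
    over the line \<open>?I\<close>, which is the circle of radius 4/5, they are local and have
    degrees.\<close>
  let ?K = "{z. ln (4/5) \<le> Re z \<and> Re z \<le> 0}" and ?I = "{z. Re z = ln (4/5)}"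
  have ln45: "ln (4/5) \<le> (0::real)"
    by simp
  have QD: "Q \<subseteq> D"
    using Q(3) by force
  have K: "convex ?K"
    unfolding Collect_conj_eq by (intro convex_Int convex_halfspace_Re_ge convex_halfspace_Re_le)
  have I: "convex ?I"
    by (rule convexI) (simp flip: distrib_right)
  have exp_K: "4/5 \<le> cmod (exp z)" "cmod (exp z) \<le> 1" if "z \<in> ?K" for z
  proof -
    have "exp (ln (4/5)) \<le> exp (Re z)" "exp (Re z) \<le> exp (0::real)"
      unfolding exp_le_cancel_iff using that by auto
    then show "4/5 \<le> cmod (exp z)" "cmod (exp z) \<le> 1"
      by simp_all
  qed
  have exp_Q: "q (exp z) \<notin> q ` Q" if "z \<in> ?K" for z
  proof
    assume "q (exp z) \<in> q ` Q"
    then obtain y where y: "y \<in> Q" "q y = q (exp z)"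
      by auto
    then have "cmod y < 1/2"
      using Q(3) by auto
    moreover have "y = exp z"
      using y(2) \<open>cmod y < 1/2\<close> exp_K[OF that] by (intro q_eq_imp) auto
    ultimately show False
      using exp_K(1)[OF that] by simp
  qed
  have inj: "inj_on q Q"
    using chart_q inj_on_subset[of q D Q, OF _ QD] by (simp add: chart_def)
  have mov: "moving ?K A"
  proof -
    have "moving_set S (Suc (card (q ` Q))) (top_of_set ?K) (\<lambda>z. insert (q (exp z)) (q ` Q))"
    proof (intro moving_set_insert moving_set_const)
      show "continuous_map (top_of_set ?K) S (\<lambda>z. q (exp z))"
        by (rule continuous_map_top_of_set_compose[OF q_cont])
          (use exp_K in \<open>auto intro!: continuous_intros simp del: norm_exp_eq_Re\<close>)
      show "q ` Q \<subseteq> topspace S"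
        using chart_q QD by (auto simp: chart_def continuous_map_def)
    qed (use Q(1) exp_Q in auto)
    then show ?thesis
      using Q(2) n by (simp add: A_def card_image[OF inj])
  qed
  have locI: "local_on ?I A"
    unfolding A_def
  proof (rule one_mover_local[OF Q(1) _ QD])
    fix z assume "z \<in> ?I"
    then have "exp (Re z) = 4/5"
      by simp
    then have "cmod (exp z) = 4/5"
      by simp
    then show "exp z \<in> D - Q"
      using Q(3) by (auto simp del: norm_exp_eq_Re)
  qed (use Q(2) n in \<open>auto intro!: continuous_intros\<close>)
  have mem: "L + angle u \<in> ?K" "angle u \<in> ?K" "L + angle u \<in> ?I" for u
    using ln45 by (simp_all add: L_def)
  have LK: "L \<in> ?K" "L \<in> ?I" "0 \<in> ?K"
    using ln45 by (simp_all add: L_def)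
  note closed = motion_closed[OF K mov] and mult = motion_mult[OF K mov]
  have inner: "motion A L (L + angle u) = j (degree A L (L + angle u))" for u
    using j_degree[OF I locI LK(2) mem(3)] by simp
  have spec: "spectators (gate_region u v) Q" for u v
    using Q by (force simp: spectators_def gate_region_def slit_def)
  \<comment> \<open>The value of going from the base point on the inner circle to the boundary point
    with parameter \<open>u\<close>. In the logarithm the parameters \<open>0\<close> and
    \<open>4 g\<close> differ although they give the same boundary point; the proof compares the two
    values in two ways.\<close>
  define \<theta> where "\<theta> u = motion A L (angle u)" for u
  have \<theta>_closed [simp]: "\<theta> u \<in> carrier F" for u
    unfolding \<theta>_def by (intro closed LK mem)
  \<comment> \<open>The gate goes out at \<open>u\<close> and comes in at \<open>v\<close>; going
    out again at \<open>v\<close> undoes its second half.\<close>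
  have crossing_motion: "crossing (side_gate u v) Q \<otimes> motion A (L + angle v) (angle v) = motion A (L + angle u) (angle u)"
    if glue: "q (rim g u) = q (rim g v)" for u v
  proof -
    let ?h = "\<lambda>r t. ln r + t * 0 :: real"
    have radial: "A (of_real (ln r) + angle w) = insert (q (of_real r * rim g w)) (q ` Q)" if "0 < r" for r w
      using that by (simp add: A_def exp_angle)
    have out: "\<Phi> (\<lambda>t. conf_of n (insert (q (of_real (4/5 + t/5) * rim g u)) (q ` Q))) = motion A (L + angle u) (angle u)"
      "pathin (unordered_conf n S) (\<lambda>t. conf_of n (insert (q (of_real (4/5 + t/5) * rim g u)) (q ` Q)))"
    proof -
      let ?u = "\<lambda>t::real. of_real (ln (4/5 + t/5)) + angle u"
      have c: "continuous_on {0..1} ?u"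
        by (auto intro!: continuous_intros)
      have s: "?u ` {0..1} \<subseteq> ?K"
        by auto
      have eq: "A (?u t) = insert (q (of_real (4/5 + t/5) * rim g u)) (q ` Q)" if "t \<in> {0..1}" for t
        using that by (intro radial) auto
      have p: "pathin (unordered_conf n S) (\<lambda>t. conf_of n (A (?u t)))"
        using pathin_comp[OF moving_continuous[OF mov] c s] by (simp add: o_def)
      have "path_homotopic (unordered_conf n S) (\<lambda>t. conf_of n (A (?u t)))
          (\<lambda>t. conf_of n (insert (q (of_real (4/5 + t/5) * rim g u)) (q ` Q)))"
        by (rule path_homotopic_eq[OF p]) (simp only: eq)
      from \<Phi>_homotopic[OF this] path_homotopic_pathin(2)[OF this] \<Phi>_motion[OF K mov c s]
      show "\<Phi> (\<lambda>t. conf_of n (insert (q (of_real (4/5 + t/5) * rim g u)) (q ` Q))) = motion A (L + angle u) (angle u)"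
        "pathin (unordered_conf n S) (\<lambda>t. conf_of n (insert (q (of_real (4/5 + t/5) * rim g u)) (q ` Q)))"
        by (simp_all add: L_def)
    qed
    have into: "\<Phi> (\<lambda>t. conf_of n (insert (q (of_real (1 - t/5) * rim g v)) (q ` Q))) = motion A (angle v) (L + angle v)"
      "pathin (unordered_conf n S) (\<lambda>t. conf_of n (insert (q (of_real (1 - t/5) * rim g v)) (q ` Q)))"
    proof -
      let ?u = "\<lambda>t::real. of_real (ln (1 - t/5)) + angle v"
      have c: "continuous_on {0..1} ?u"
        by (auto intro!: continuous_intros)
      have s: "?u ` {0..1} \<subseteq> ?K"
        by auto
      have eq: "A (?u t) = insert (q (of_real (1 - t/5) * rim g v)) (q ` Q)" if "t \<in> {0..1}" for t
        using that by (intro radial) auto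
      have p: "pathin (unordered_conf n S) (\<lambda>t. conf_of n (A (?u t)))"
        using pathin_comp[OF moving_continuous[OF mov] c s] by (simp add: o_def)
      have "path_homotopic (unordered_conf n S) (\<lambda>t. conf_of n (A (?u t)))
          (\<lambda>t. conf_of n (insert (q (of_real (1 - t/5) * rim g v)) (q ` Q)))"
        by (rule path_homotopic_eq[OF p]) (simp only: eq)
      from \<Phi>_homotopic[OF this] path_homotopic_pathin(2)[OF this] \<Phi>_motion[OF K mov c s]
      show "\<Phi> (\<lambda>t. conf_of n (insert (q (of_real (1 - t/5) * rim g v)) (q ` Q))) = motion A (angle v) (L + angle v)"
        "pathin (unordered_conf n S) (\<lambda>t. conf_of n (insert (q (of_real (1 - t/5) * rim g v)) (q ` Q)))"
        by (simp_all add: L_def)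
    qed
    have "crossing (side_gate u v) Q = \<Phi> (loop_join (\<lambda>t. conf_of n (insert (q (of_real (4/5 + t/5) * rim g u)) (q ` Q)))
        (\<lambda>t. conf_of n (insert (q (of_real (1 - t/5) * rim g v)) (q ` Q))))"
      unfolding crossing_def side_gate_def loop_join_def by (intro arg_cong[where f = \<Phi>] ext) (simp only: if_distrib[of "\<lambda>x. conf_of n (insert x (q ` Q))"])
    also have "\<dots> = motion A (L + angle u) (angle u) \<otimes> motion A (angle v) (L + angle v)"
      unfolding out(1)[symmetric] into(1)[symmetric] by (rule \<Phi>_join[OF out(2) into(2)]) (use glue in simp)
    finally have "crossing (side_gate u v) Q \<otimes> motion A (L + angle v) (angle v)
        = motion A (L + angle u) (angle u) \<otimes> (motion A (angle v) (L + angle v) \<otimes> motion A (L + angle v) (angle v))"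
      using closed mem by (simp add: m_assoc)
    also have "motion A (angle v) (L + angle v) \<otimes> motion A (L + angle v) (angle v) = \<one>"
      using mult[of "angle v" "L + angle v" "angle v"] motion_refl[OF K mov, of "angle v"] mem by simp
    finally show ?thesis
      using closed mem by simp
  qed
  \<comment> \<open>Running along one side from its midpoint \<open>u\<close>, and along the partner
    side backwards from its midpoint \<open>v\<close>, is the same motion on the surface. Hence one
    integer \<open>m\<close> serves for both corners of the side, and the same factor occurs twice
    in the word of the handle.\<close>
  have glued: "\<exists>m. \<forall>d\<in>{-1/2, 1/2}. \<theta> (u + d) = crossing (side_gate u v) Q \<otimes> j m \<otimes> \<theta> (v - d)"
    if glue: "\<And>s. s \<in> {-1/2..1/2} \<Longrightarrow> q (rim g (u + s)) = q (rim g (v - s))" for u v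
  proof -
    have uv: "q (rim g u) = q (rim g v)"
      using glue[of 0] by simp
    define X where "X = crossing (side_gate u v) Q"
    have X: "commutes X" "X \<in> carrier F"
      using crossing_commutes[OF gate_side_gate[OF uv] spec] commutesD(2) by (auto simp: X_def)
    define b b' where "b = degree A L (L + angle u)" and "b' = degree A L (L + angle v)"
    have \<theta>_split: "\<theta> w = j (degree A L (L + angle w)) \<otimes> motion A (L + angle w) (angle w)" for w
      unfolding \<theta>_def inner[symmetric] using mem LK by (intro mult[symmetric])
    have Mc: "motion A (L + angle w) (angle w) \<in> carrier F" for w
      by (intro closed mem)
    have "X \<otimes> j (b - b') \<otimes> \<theta> v = X \<otimes> (j (b - b') \<otimes> j b') \<otimes> motion A (L + angle v) (angle v)"
      unfolding \<theta>_split[of v] b'_def[symmetric] using X Mc by (simp add: m_assoc)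
    also have "\<dots> = X \<otimes> j b \<otimes> motion A (L + angle v) (angle v)"
      by (simp flip: j_add)
    also have "\<dots> = j b \<otimes> (X \<otimes> motion A (L + angle v) (angle v))"
      using X Mc commutesD(1)[OF X(1), of b] by (simp flip: m_assoc)
    also have "\<dots> = \<theta> u"
      unfolding X_def crossing_motion[OF uv] \<theta>_split[of u] b_def ..
    finally have base: "\<theta> u = X \<otimes> j (b - b') \<otimes> \<theta> v" ..
    have "\<theta> (u + d) = X \<otimes> j (b - b') \<otimes> \<theta> (v - d)" if d: "d \<in> {-1/2, 1/2}" for d
    proof -
      have side: "motion A (angle u) (angle (u + d)) = motion A (angle v) (angle (v - d))"
      proof (rule motion_cong[OF K mov mem(2) mem(2)])
        fix t :: real assume t: "t \<in> {0..1}"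
        have "t * d \<in> {-1/2..1/2}"
        proof -
          have "d = - (1/2) \<or> d = 1/2"
            using d by simp
          then have "t * d = t * - (1/2) \<or> t * d = t * (1/2)"
            by metis
          moreover have "0 \<le> t" "t \<le> 1"
            using t by auto
          ultimately show ?thesis
            unfolding atLeastAtMost_iff by linarith
        qed
        moreover have "(1 - t) * u + t * (u + d) = u + t * d" "(1 - t) * v + t * (v - d) = v - t * d"
          by (simp_all add: algebra_simps)
        ultimately show "A ((1 - t) *\<^sub>R angle u + t *\<^sub>R angle (u + d)) = A ((1 - t) *\<^sub>R angle v + t *\<^sub>R angle (v - d))"
          using glue[of "t * d"] unfolding angle_line by (simp add: A_def exp_angle')
      qed
      have "\<theta> (u + d) = \<theta> u \<otimes> motion A (angle u) (angle (u + d))"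
        unfolding \<theta>_def using mem LK by (intro mult[symmetric])
      also have "\<dots> = X \<otimes> j (b - b') \<otimes> (\<theta> v \<otimes> motion A (angle v) (angle (v - d)))"
        unfolding base side using X closed[OF mem(2) mem(2)] by (simp add: m_assoc)
      also have "\<theta> v \<otimes> motion A (angle v) (angle (v - d)) = \<theta> (v - d)"
        unfolding \<theta>_def using mem LK by (intro mult)
      finally show ?thesis .
    qed
    then show ?thesis
      unfolding X_def by blast
  qed
  \<comment> \<open>The four gluing relations between the corners \<open>4 k\<close> to
    \<open>4 k + 4\<close> combine to a commutator of \<open>x\<close> and \<open>y\<close>, which
    are the two crossings up to integers.\<close>
  have handle: "\<theta> (4 * real k + 4) = j (- turn) \<otimes> \<theta> (4 * real k)" if k: "k < g" for k
  proof -
    let ?ua = "4 * real k + 1/2" and ?va = "4 * real k + 5/2" and ?ub = "4 * real k + 3/2" and ?vb = "4 * real k + 7/2"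
    let ?X = "crossing (side_gate ?ua ?va) Q" and ?Y = "crossing (side_gate ?ub ?vb) Q"
    have ga: "q (rim g (?ua + s)) = q (rim g (?va - s))" and gb: "q (rim g (?ub + s)) = q (rim g (?vb - s))"
      if "s \<in> {-1/2..1/2}" for s
    proof -
      have e: "4 * real k + (1/2 + s) = ?ua + s" "4 * real k + 3 - (1/2 + s) = ?va - s"
        "4 * real k + 1 + (1/2 + s) = ?ub + s" "4 * real k + 4 - (1/2 + s) = ?vb - s"
        by simp_all
      show "q (rim g (?ua + s)) = q (rim g (?va - s))" "q (rim g (?ub + s)) = q (rim g (?vb - s))"
        using side_a[OF k, of "1/2 + s"] side_b[OF k, of "1/2 + s"] that unfolding e by simp_all
    qed
    obtain m where m: "\<forall>d\<in>{-1/2, 1/2}. \<theta> (?ua + d) = ?X \<otimes> j m \<otimes> \<theta> (?va - d)"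
      using glued[of ?ua ?va] ga by blast
    obtain m' where m': "\<forall>d\<in>{-1/2, 1/2}. \<theta> (?ub + d) = ?Y \<otimes> j m' \<otimes> \<theta> (?vb - d)"
      using glued[of ?ub ?vb] gb by blast
    have com: "commutes ?X" "commutes ?Y"
      using crossing_commutes[OF gate_side_gate spec] ga[of 0] gb[of 0] by simp_all
    note cl = commutesD(2)[OF com(1)] commutesD(2)[OF com(2)]
    define x y where "x = ?X \<otimes> j m" and "y = ?Y \<otimes> j m'"
    have xy_cl: "x \<in> carrier F" "y \<in> carrier F" and xy_com: "commutes x" "commutes y"
      using cl com by (auto simp: x_def y_def intro: commutes_mult)
    have e: "?ua + -1/2 = 4 * real k" "?ua + 1/2 = 4 * real k + 1" "?va - -1/2 = 4 * real k + 3" "?va - 1/2 = 4 * real k + 2"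
      "?ub + -1/2 = 4 * real k + 1" "?ub + 1/2 = 4 * real k + 2" "?vb - -1/2 = 4 * real k + 4" "?vb - 1/2 = 4 * real k + 3"
      by simp_all
    have \<theta>s: "\<theta> (4 * real k) = x \<otimes> \<theta> (4 * real k + 3)" "\<theta> (4 * real k + 1) = x \<otimes> \<theta> (4 * real k + 2)"
      "\<theta> (4 * real k + 1) = y \<otimes> \<theta> (4 * real k + 4)" "\<theta> (4 * real k + 2) = y \<otimes> \<theta> (4 * real k + 3)"
      using m[THEN bspec, of "-1/2", unfolded e] m[THEN bspec, of "1/2", unfolded e]
        m'[THEN bspec, of "-1/2", unfolded e] m'[THEN bspec, of "1/2", unfolded e]
      unfolding x_def y_def by simp_all
    have "x \<otimes> y = ?X \<otimes> ?Y \<otimes> j (m + m')"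
      unfolding x_def y_def by (rule mult_shifted[OF com])
    also have "\<dots> = ?Y \<otimes> ?X \<otimes> j (m' + m) \<otimes> j (- turn)"
      unfolding handle_commutator[OF k spec spec] using cl by (simp add: m_assoc flip: j_add)
        (simp add: algebra_simps)
    also have "?Y \<otimes> ?X \<otimes> j (m' + m) = y \<otimes> x"
      unfolding x_def y_def by (rule mult_shifted[OF com(2,1), symmetric])
    finally have xy: "x \<otimes> y = y \<otimes> x \<otimes> j (- turn)" .
    have "y \<otimes> \<theta> (4 * real k + 4) = x \<otimes> y \<otimes> \<theta> (4 * real k + 3)"
      using xy_cl by (simp add: m_assoc flip: \<theta>s(2-4))
    also have "\<dots> = y \<otimes> (x \<otimes> j (- turn) \<otimes> \<theta> (4 * real k + 3))"
      unfolding xy using xy_cl by (simp add: m_assoc)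
    also have "x \<otimes> j (- turn) \<otimes> \<theta> (4 * real k + 3) = j (- turn) \<otimes> \<theta> (4 * real k)"
      unfolding \<theta>s(1) commutesD(1)[OF xy_com(1), symmetric] using xy_cl by (simp add: m_assoc)
    finally show ?thesis
      using xy_cl by simp
  qed
  have "\<theta> (4 * real k) = j (- int k * turn) \<otimes> \<theta> 0" if "k \<le> g" for k
    using that
  proof (induction k)
    case 0
    then show ?case
      by (simp add: j_0)
  next
    case (Suc k)
    have "\<theta> (4 * real (Suc k)) = j (- turn) \<otimes> \<theta> (4 * real k)"
      using handle[of k] Suc.prems by (simp add: algebra_simps)
    also have "\<dots> = j (- turn + - int k * turn) \<otimes> \<theta> 0"
      unfolding Suc.IH[OF Suc_leD[OF Suc.prems]] by (simp only: j_add m_assoc j_closed \<theta>_closed)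
    also have "- turn + - int k * turn = - int (Suc k) * turn"
      by (simp add: algebra_simps)
    finally show ?case .
  qed
  from this[of g] have "\<theta> (4 * real g) = j (- int g * turn) \<otimes> \<theta> 0"
    by simp
  \<comment> \<open>The other way to the same boundary point: once around the inner circle, which
    encloses the cluster, and then radially outward.\<close>
  moreover have "\<theta> (4 * real g) = j (int (n - 1) * turn) \<otimes> \<theta> 0"
  proof -
    have "motion A (L + angle (4 * real g)) (angle (4 * real g)) = motion A L 0"
    proof (rule motion_cong[OF K mov mem(1) mem(2)])
      fix t :: real
      have "(1 - t) *\<^sub>R (L + angle (4 * real g)) + t *\<^sub>R angle (4 * real g) = (1 - t) *\<^sub>R L + t *\<^sub>R 0 + 2 * of_real pi * \<i>"
        unfolding angle_turn by (simp add: algebra_simps scaleR_conv_of_real)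
      then show "A ((1 - t) *\<^sub>R (L + angle (4 * real g)) + t *\<^sub>R angle (4 * real g)) = A ((1 - t) *\<^sub>R L + t *\<^sub>R 0)"
        by (simp only: A_def exp_add exp_two_pi_i' exp_two_pi_i mult_1_right)
    qed
    moreover have "\<theta> (4 * real g) = motion A L (L + angle (4 * real g)) \<otimes> motion A (L + angle (4 * real g)) (angle (4 * real g))"
      unfolding \<theta>_def using mem LK by (intro mult[symmetric])
    moreover have "degree A L (L + angle (4 * real g)) = int (n - 1) * turn"
      unfolding angle_turn L_def A_def by (rule cluster)
    ultimately show ?thesis
      using inner[of "4 * real g"] by (simp add: \<theta>_def)
  qed
  ultimately have "j (- int g * turn) = j (int (n - 1) * turn)"
    using right_cancel[of "\<theta> 0"] by simp
  then have "(int (n - 1) + int g) * turn = 0"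
    unfolding j_eq_iff by (simp add: algebra_simps)
  then show False
    using turn_nonzero g by simp
qed

end

section \<open>The functor defined by an extension of the length function\<close>

lemma conf_map_image_conf_of:
  assumes e: "inj_on e B"
  shows "conf_map n e ` conf_of n B = conf_of n (e ` B)"
proof (intro equalityI subsetI)
  fix y assume "y \<in> conf_map n e ` conf_of n B"
  then obtain x where x: "bij_betw x {1..n} B" "y = (\<lambda>k\<in>{1..n}. e (x k))"
    by (auto simp: conf_of_def conf_map_def)
  have "bij_betw (e \<circ> x) {1..n} (e ` B)"
    by (rule bij_betw_trans[OF x(1) inj_on_imp_bij_betw[OF e]])
  then have "bij_betw y {1..n} (e ` B)"
    by (rule bij_betw_cong[THEN iffD1, rotated]) (simp add: x(2))
  then show "y \<in> conf_of n (e ` B)"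
    by (simp add: conf_of_def x(2))
next
  fix y assume "y \<in> conf_of n (e ` B)"
  then have y: "bij_betw y {1..n} (e ` B)" "y \<in> extensional {1..n}"
    by (auto simp: conf_of_def)
  define x where "x = (\<lambda>k\<in>{1..n}. inv_into B e (y k))"
  have "bij_betw (inv_into B e \<circ> y) {1..n} B"
    by (rule bij_betw_trans[OF y(1) bij_betw_inv_into[OF inj_on_imp_bij_betw[OF e]]])
  then have "bij_betw x {1..n} B"
    by (rule bij_betw_cong[THEN iffD1, rotated]) (simp add: x_def)
  then have "x \<in> conf_of n B"
    by (simp add: conf_of_def x_def)
  moreover have "conf_map n e x = y"
  proof
    fix k
    show "conf_map n e x k = y k"
    proof (cases "k \<in> {1..n}")
      case True
      then have "y k \<in> e ` B"
        using bij_betwE[OF y(1)] by blast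
      then show ?thesis
        using True f_inv_into_f[of "y k" e B] by (simp add: conf_map_def x_def)
    next
      case False
      then show ?thesis
        unfolding extensional_arb[OF y(2) False] conf_map_def by (rule restrict_apply[THEN trans, OF if_not_P])
    qed
  qed
  ultimately show "y \<in> conf_map n e ` conf_of n B"
    by blast
qed

lemma continuous_map_conf_map:
  assumes e: "continuous_map X Y e" "inj_on e (topspace X)"
  shows "continuous_map (unordered_conf n X) (unordered_conf n Y) (\<lambda>Q. conf_map n e ` Q)"
proof -
  have top: "x \<in> topspace (ordered_conf n X) \<longleftrightarrow> x \<in> extensional {1..n} \<and> x ` {1..n} \<subseteq> topspace X \<and> inj_on x {1..n}" for x
    by (auto simp: ordered_conf_def PiE_def Pi_def)
  have "continuous_map (ordered_conf n X) (unordered_conf n Y) (\<lambda>x. conf_of n ((\<lambda>i. e (x i)) ` {1..n}))"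
  proof (rule continuous_map_conf_of)
    show "continuous_map (ordered_conf n X) Y (\<lambda>x. e (x i))" if "i \<in> {1..n}" for i
    proof -
      have "continuous_map (ordered_conf n X) X (\<lambda>x. x i)"
        unfolding ordered_conf_def
        by (rule continuous_map_from_subtopology) (rule continuous_map_product_projection[OF that])
      from continuous_map_compose[OF this e(1)] show ?thesis
        by (simp add: o_def)
    qed
    show "inj_on (\<lambda>i. e (x i)) {1..n}" if "x \<in> topspace (ordered_conf n X)" for x
      using comp_inj_on[of x "{1..n}" e] inj_on_subset[OF e(2)] that unfolding top by (simp add: o_def)
  qed auto
  moreover have "conf_of n ((\<lambda>i. e (x i)) ` {1..n}) = ((\<lambda>Q. conf_map n e ` Q) \<circ> sym_orbit n) x"
    if "x \<in> topspace (ordered_conf n X)" for x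
  proof -
    have x: "x \<in> extensional {1..n}" "x ` {1..n} \<subseteq> topspace X" "inj_on x {1..n}"
      using that unfolding top by auto
    have "conf_map n e ` conf_of n (x ` {1..n}) = conf_of n (e ` x ` {1..n})"
      by (rule conf_map_image_conf_of[OF inj_on_subset[OF e(2) x(2)]])
    then show ?thesis
      by (simp only: o_apply sym_orbit_eq_conf_of[OF x(1,3)] image_image)
  qed
  ultimately have "continuous_map (ordered_conf n X) (unordered_conf n Y) ((\<lambda>Q. conf_map n e ` Q) \<circ> sym_orbit n)"
    by (rule continuous_map_eq)
  then show ?thesis
    unfolding unordered_conf_def[of n X]
    by (rule continuous_compose_quotient_map[OF quotient_map_quotient_topology])
qed

text \<open>Base paths to configurations in the embedded disc are chosen inside it, so that loops formed
  from local motions come from the Artin braid group.\<close>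

lemma length_extension_functor:
  fixes F :: "'f monoid" and S :: "'a topology" and e :: "complex \<Rightarrow> 'a"
  assumes n: "n \<ge> 1" and F: "group F" and j: "j \<in> mon integer_group F"
    and l\<Sigma>: "l\<Sigma> \<in> hom (braid_group n S (conf_map n e (disc_base n))) F"
    and comm: "\<And>\<beta>. \<beta> \<in> carrier (artin_braid_group n) \<Longrightarrow> l\<Sigma> (braid_map n S e (disc_base n) \<beta>) = j (len \<beta>)"
    and e: "embedding_map disc S e"
    and base: "inj_on (disc_base n) {1..n}" "disc_base n ` {1..n} \<subseteq> ball 0 1"
  obtains \<Phi> where "conf_rep F n S \<Phi> (e ` ball 0 1) j"
    "\<And>B. moving_set (top_of_set (ball 0 1)) n (top_of_set {0..1}) B \<Longrightarrow>
       B 0 = disc_base n ` {1..n} \<Longrightarrow> B 1 = disc_base n ` {1..n} \<Longrightarrow>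
       \<Phi> (\<lambda>t. conf_of n (e ` B t)) =
       j (len (loop_class (unordered_conf n disc) (sym_orbit n (disc_base n)) (\<lambda>t. conf_of n (B t))))"
proof -
  let ?U = "ball (0::complex) 1" and ?B0 = "disc_base n ` {1..n}"
  let ?X = "unordered_conf n disc" and ?Y = "unordered_conf n S"
  let ?E = "\<lambda>Q. conf_map n e ` Q"
  have e_cont: "continuous_map disc S e" and e_inj: "inj_on e (cball 0 1)"
    using e by (auto simp: embedding_map_def homeomorphic_eq_everything_map continuous_map_in_subtopology)
  have U: "?U \<subseteq> cball 0 1"
    by auto
  have E_cont: "continuous_map ?X ?Y ?E"
    by (rule continuous_map_conf_map) (use e_cont e_inj in auto)
  have E_conf: "?E (conf_of n B) = conf_of n (e ` B)" if "B \<subseteq> ?U" for B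
    by (rule conf_map_image_conf_of[OF inj_on_subset[OF e_inj]]) (use that in auto)
  have base_ext: "disc_base n \<in> extensional {1..n}"
    by (simp add: disc_base_def)
  define x where "x = sym_orbit n (disc_base n)"
  have x: "x = conf_of n ?B0"
    unfolding x_def by (rule sym_orbit_eq_conf_of[OF base_ext base(1)])
  define y where "y = sym_orbit n (conf_map n e (disc_base n))"
  have inj_e: "inj_on e ?U"
    by (rule inj_on_subset[OF e_inj U])
  have y: "y = ?E x"
  proof -
    have "inj_on (e \<circ> disc_base n) {1..n}"
      by (rule comp_inj_on[OF base(1) inj_on_subset[OF inj_e base(2)]])
    then have "inj_on (conf_map n e (disc_base n)) {1..n}"
      by (rule inj_on_cong[THEN iffD1, rotated]) (simp add: conf_map_def)
    then have "y = conf_of n (conf_map n e (disc_base n) ` {1..n})"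
      unfolding y_def by (intro sym_orbit_eq_conf_of) (simp_all add: conf_map_def)
    also have "conf_map n e (disc_base n) ` {1..n} = e ` ?B0"
      by (simp add: conf_map_def image_image)
    finally show ?thesis
      unfolding x E_conf[OF base(2)] .
  qed
  define good where "good A Y \<longleftrightarrow> moving_set (top_of_set ?U) n (top_of_set {0..1}) Y \<and> Y 0 = ?B0 \<and> Y 1 = A"
    for A and Y :: "real \<Rightarrow> complex set"
  have card_B0: "card ?B0 = n" "finite ?B0"
    using card_image[OF base(1)] by simp_all
  have good_B0: "good ?B0 (\<lambda>_. ?B0)"
    unfolding good_def using base(2) card_B0 by (auto intro!: moving_set_const)
  have good_ex: "\<exists>Y. good A Y" if A: "finite A" "card A = n" "A \<subseteq> ?U" for A
  proof -
    obtain a where a: "bij_betw a {1..n} A"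
      using ex_bij_betw_nat_finite_1[OF A(1)] A(2) by auto
    have aA: "a ` {1..n} \<subseteq> ?U"
      unfolding bij_betw_imp_surj_on[OF a] by (rule A(3))
    obtain Y where Y: "motion_between ?U {1..n} (disc_base n) a Y"
      using motion_between_exists[OF open_ball connected_ball _ base bij_betw_imp_inj_on[OF a] aA] by blast
    have "moving_set (top_of_set ?U) n (top_of_set {0..1}) (\<lambda>t. Y t ` {1..n})"
      by (rule moving_setI[of "{1..n}" _ _ _ Y])
        (use Y in \<open>auto simp: motion_between_def continuous_map_in_subtopology image_subset_iff\<close>)
    moreover have "Y 0 ` {1..n} = ?B0" "Y 1 ` {1..n} = a ` {1..n}"
      using Y by (auto simp: motion_between_def intro!: image_cong)
    ultimately have "good A (\<lambda>t. Y t ` {1..n})"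
      unfolding good_def bij_betw_imp_surj_on[OF a] by blast
    then show ?thesis
      by blast
  qed
  \<comment> \<open>For the base configuration itself the constant motion is prescribed, so that
    loops based there are not conjugated and their values can be read off from
    \<open>len\<close>.\<close>
  define path where "path A = (if A = ?B0 then (\<lambda>_. ?B0) else (SOME Y. good A Y))" for A
  have good_path: "good A (path A)" if "finite A" "card A = n" "A \<subseteq> ?U" for A
    using good_B0 someI_ex[OF good_ex[OF that]] by (auto simp: path_def)
  define R where "R = {A. finite A \<and> card A = n \<and> A \<subseteq> ?U}"
  define bp where "bp A = (\<lambda>t. conf_of n (path A t))" for A
  have moving_path: "pathin ?X (\<lambda>t. conf_of n (B t))" if "moving_set (top_of_set ?U) n (top_of_set {0..1}) B" for B
  proof -
    have "moving_set disc n (top_of_set {0..1}) (\<lambda>t. (\<lambda>z. z) ` B t)"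
      by (rule moving_set_image[OF that]) auto
    then show ?thesis
      unfolding pathin_def by (intro continuous_map_moving_set) simp
  qed
  have bp: "pathin ?X (bp A)" "bp A 0 = x" "bp A 1 = conf_of n A" "\<And>t. t \<in> {0..1} \<Longrightarrow> path A t \<subseteq> ?U" if "A \<in> R" for A
  proof -
    have g: "good A (path A)"
      using that by (intro good_path) (auto simp: R_def)
    then show "pathin ?X (bp A)" "bp A 0 = x" "bp A 1 = conf_of n A"
      using moving_path by (auto simp: good_def bp_def x)
    show "path A t \<subseteq> ?U" if "t \<in> {0..1}" for t
      using g moving_set_sub[of "top_of_set ?U" n "top_of_set {0..1}" "path A" t] that by (simp add: good_def)
  qed
  \<comment> \<open>A configuration in the embedded disc determines the set it comes from, so base
    paths can be indexed by configurations of the surface.\<close>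
  have conf_inj: "A = B" if "A \<in> R" "B \<in> R" "conf_of n (e ` A) = conf_of n (e ` B)" for A B
  proof -
    have "card (e ` A) = n" "finite (e ` A)"
      using that(1) card_image[OF inj_on_subset[OF inj_e, of A]] by (auto simp: R_def)
    then obtain h where h: "bij_betw h {1..n} (e ` A)"
      using ex_bij_betw_nat_finite_1[of "e ` A"] by auto
    have "bij_betw (restrict h {1..n}) {1..n} (e ` A)"
      using h by (simp add: bij_betw_restrict_eq)
    then have "restrict h {1..n} \<in> conf_of n (e ` A)"
      by (simp add: conf_of_def)
    then have "bij_betw (restrict h {1..n}) {1..n} (e ` B)"
      unfolding that(3) by (simp add: conf_of_def)
    then have "e ` A = e ` B"
      using \<open>bij_betw (restrict h {1..n}) {1..n} (e ` A)\<close> by (metis bij_betw_imp_surj_on)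
    then show ?thesis
      using inj_on_image_eq_iff[OF inj_e] that(1,2) by (auto simp: R_def)
  qed
  define pre where "pre c = (SOME A. A \<in> R \<and> conf_of n (e ` A) = c)" for c
  have pre: "pre (conf_of n (e ` A)) = A" if "A \<in> R" for A
    unfolding pre_def using that conf_inj by (intro some_equality) blast+
  let ?R = "(\<lambda>A. conf_of n (e ` A)) ` R"
  let ?\<gamma> = "\<lambda>c. ?E \<circ> bp (pre c)"
  have E_path: "pathin ?Y (?E \<circ> p)" if "pathin ?X p" for p
    using continuous_map_compose[OF _ E_cont] that by (auto simp: pathin_def)
  have l\<Sigma>': "l\<Sigma> \<in> hom (fundamental_group ?Y y) F"
    using l\<Sigma> by (simp add: braid_group_def y_def)
  have \<gamma>: "pathin ?Y (?\<gamma> c) \<and> ?\<gamma> c 0 = y \<and> ?\<gamma> c 1 = c" if c: "c \<in> ?R" for c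
  proof -
    obtain A where A: "A \<in> R" "c = conf_of n (e ` A)"
      using c by blast
    have "?E (conf_of n A) = c"
      using A by (subst E_conf) (auto simp: R_def)
    then show ?thesis
      using bp[OF A(1)] E_path[OF bp(1)[OF A(1)]] pre[OF A(1)] A(2) y by simp
  qed
  obtain \<Phi> where \<Phi>: "\<And>p. pathin ?Y p \<Longrightarrow> \<Phi> p \<in> carrier F"
    "\<And>p q. pathin ?Y p \<Longrightarrow> pathin ?Y q \<Longrightarrow> p 1 = q 0 \<Longrightarrow> \<Phi> (loop_join p q) = \<Phi> p \<otimes>\<^bsub>F\<^esub> \<Phi> q"
    "\<And>p q. path_homotopic ?Y p q \<Longrightarrow> \<Phi> p = \<Phi> q"
    "\<And>p. pathin ?Y p \<Longrightarrow> p 0 \<in> ?R \<Longrightarrow> p 1 \<in> ?R \<Longrightarrow>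
       \<Phi> p = l\<Sigma> (loop_class ?Y y (loop_join (?\<gamma> (p 0)) (loop_join p (path_rev (?\<gamma> (p 1))))))"
    using pi1_hom_extends_to_paths[OF F l\<Sigma>' \<gamma>] by blast
  \<comment> \<open>A motion in the disc, closed up by base paths in the disc, is the image of an
    element of the Artin braid group, on which the extension agrees with \<open>len\<close>.\<close>
  have local: "\<Phi> (\<lambda>t. conf_of n (e ` B t)) =
      j (len (loop_class ?X x (loop_join (bp (B 0)) (loop_join (\<lambda>t. conf_of n (B t)) (path_rev (bp (B 1)))))))"
    if B: "moving_set (top_of_set ?U) n (top_of_set {0..1}) B" for B
  proof -
    let ?p = "\<lambda>t. conf_of n (B t)"
    have BU: "B t \<subseteq> ?U" if "t \<in> {0..1}" for t
      using moving_set_sub[OF B, of t] that by simp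
    have BR: "B t \<in> R" if t: "t \<in> {0..1}" for t
    proof -
      obtain I :: "nat set" and z where "finite I" "card I = n" "inj_on (z t) I" "B t = z t ` I"
        using B t unfolding moving_set_def by fastforce
      then show ?thesis
        using BU[OF t] by (simp add: R_def card_image)
    qed
    have p: "pathin ?X ?p"
      by (rule moving_path[OF B])
    have B01: "B 0 \<in> R" "B 1 \<in> R"
      by (rule BR; simp)+
    let ?l = "loop_join (bp (B 0)) (loop_join ?p (path_rev (bp (B 1))))"
    have l: "?l \<in> loops_at ?X x"
      unfolding loops_at_def using bp[OF B01(1)] bp[OF B01(2)] p
      by (simp add: pathin_loop_join pathin_path_rev)
    have Ep: "path_homotopic ?Y (?E \<circ> ?p) (\<lambda>t. conf_of n (e ` B t))"
      by (rule path_homotopic_eq[OF E_path[OF p]]) (simp only: o_apply E_conf[OF BU])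
    have "\<Phi> (\<lambda>t. conf_of n (e ` B t)) = \<Phi> (?E \<circ> ?p)"
      by (rule \<Phi>(3)[OF Ep, symmetric])
    also have "\<dots> = l\<Sigma> (loop_class ?Y y (loop_join (?E \<circ> bp (B 0)) (loop_join (?E \<circ> ?p) (path_rev (?E \<circ> bp (B 1))))))"
    proof -
      have E01: "(?E \<circ> ?p) 0 = conf_of n (e ` B 0)" "(?E \<circ> ?p) 1 = conf_of n (e ` B 1)"
        unfolding o_apply by (rule E_conf[OF BU]; simp)+
      have r: "(?E \<circ> ?p) 0 \<in> ?R" "(?E \<circ> ?p) 1 \<in> ?R"
        unfolding E01 using B01 by blast+
      have g: "pre ((?E \<circ> ?p) 0) = B 0" "pre ((?E \<circ> ?p) 1) = B 1"
        unfolding E01 by (rule pre[OF B01(1)]) (rule pre[OF B01(2)])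
      show ?thesis
        using \<Phi>(4)[OF E_path[OF p] r] unfolding g .
    qed
    also have "loop_join (?E \<circ> bp (B 0)) (loop_join (?E \<circ> ?p) (path_rev (?E \<circ> bp (B 1)))) = ?E \<circ> ?l"
      unfolding comp_loop_join comp_path_rev by (rule refl)
    also have "loop_class ?Y y (?E \<circ> ?l) = pi1_map ?Y ?E x (loop_class ?X x ?l)"
      unfolding y by (rule pi1_map_loop_class[OF l E_cont, symmetric])
    also have "\<dots> = braid_map n S e (disc_base n) (loop_class ?X x ?l)"
      by (simp add: braid_map_def x_def)
    also have "l\<Sigma> \<dots> = j (len (loop_class ?X x ?l))"
      using l by (intro comm) (auto simp: braid_group_def fundamental_group_def x_def)
    finally show ?thesis .
  qed
  show thesis
  proof (rule that)
    obtain e' where "homeomorphic_maps disc (subtopology S (e ` cball 0 1)) e e'"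
      using e unfolding embedding_map_def homeomorphic_map_maps topspace_euclidean_subtopology by blast
    then have e_inv: "continuous_map (subtopology S (e ` cball 0 1)) disc e'"
      and e'e: "\<And>z. z \<in> cball 0 1 \<Longrightarrow> e' (e z) = z"
      unfolding homeomorphic_maps_def topspace_euclidean_subtopology by blast+
    \<comment> \<open>\<open>e\<close> is a homeomorphism onto its image, so a motion in the image
      of the open disc is pulled back label by label with \<open>e'\<close>.\<close>
    have loc: "\<Phi> (\<lambda>t. conf_of n (A t)) \<in> range j"
      if A: "moving_set S n (top_of_set {0..1}) A" and AW: "\<And>t. t \<in> {0..1} \<Longrightarrow> A t \<subseteq> e ` ?U" for A
    proof -
      let ?i = e'
      obtain I :: "nat set" and z where z: "finite I" "card I = n"
        "\<And>i. i \<in> I \<Longrightarrow> continuous_map (top_of_set {0..1}) S (\<lambda>t. z t i)"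
        "\<And>t. t \<in> topspace (top_of_set {0..1}) \<Longrightarrow> inj_on (z t) I"
        "\<And>t. t \<in> topspace (top_of_set {0..1}) \<Longrightarrow> A t = z t ` I"
        using A by (rule moving_setE) blast
      have zU: "z t i \<in> e ` ?U" if "t \<in> {0..1}" "i \<in> I" for t i
        using AW[OF that(1)] z(5)[of t] that by auto
      have ei: "e (?i c) = c" "?i c \<in> ?U" if c: "c \<in> e ` ?U" for c
      proof -
        obtain w where "w \<in> ?U" "c = e w"
          using c by blast
        then show "e (?i c) = c" "?i c \<in> ?U"
          using e'e[of w] by auto
      qed
      have "moving_set (top_of_set ?U) n (top_of_set {0..1}) (\<lambda>t. ?i ` A t)"
      proof (rule moving_setI[of I _ _ _ "\<lambda>t k. ?i (z t k)"])
        fix k assume k: "k \<in> I"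
        have "continuous_map (top_of_set {0..1}) (subtopology S (e ` cball 0 1)) (\<lambda>t. z t k)"
          using z(3)[OF k] zU k by (auto simp: continuous_map_in_subtopology) (use U in blast)
        from continuous_map_compose[OF this e_inv] have "continuous_map (top_of_set {0..1}) disc (\<lambda>t. ?i (z t k))"
          by (simp add: o_def)
        then show "continuous_map (top_of_set {0..1}) (top_of_set ?U) (\<lambda>t. ?i (z t k))"
          using ei(2)[OF zU[OF _ k]] by (simp add: continuous_map_in_subtopology Pi_iff)
      next
        fix t :: real assume t: "t \<in> topspace (top_of_set {0..1})"
        show "inj_on (\<lambda>k. ?i (z t k)) I"
          using z(4)[OF t] ei(1)[OF zU] t by (simp add: inj_on_def) metis
        show "?i ` A t = (\<lambda>k. ?i (z t k)) ` I"
          using z(5)[OF t] by (simp add: image_image)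
      qed (use z in auto)
      from local[OF this] have "\<Phi> (\<lambda>t. conf_of n (e ` ?i ` A t)) \<in> range j"
        by simp
      moreover have "path_homotopic ?Y (\<lambda>t. conf_of n (A t)) (\<lambda>t. conf_of n (e ` ?i ` A t))"
      proof (rule path_homotopic_eq)
        show "pathin ?Y (\<lambda>t. conf_of n (A t))"
          unfolding pathin_def by (rule continuous_map_moving_set[OF A])
        show "conf_of n (A t) = conf_of n (e ` ?i ` A t)" if "t \<in> {0..1}" for t
        proof -
          have "e ` ?i ` A t = (\<lambda>c. c) ` A t"
            unfolding image_image using AW[OF that] ei(1) by (intro image_cong) auto
          then show ?thesis
            by simp
        qed
      qed
      ultimately show ?thesis
        using \<Phi>(3) by metis
    qed
    show "conf_rep F n S \<Phi> (e ` ball 0 1) j"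
      by (intro conf_rep.intro path_rep.intro path_rep_axioms.intro conf_rep_axioms.intro F j \<Phi>(1-3) loc)
        (assumption | blast)+
  next
    fix B :: "real \<Rightarrow> complex set"
    assume B: "moving_set (top_of_set ?U) n (top_of_set {0..1}) B" "B 0 = ?B0" "B 1 = ?B0"
    let ?p = "\<lambda>t. conf_of n (B t)"
    have p: "pathin ?X ?p" "?p 0 = x" "?p 1 = x"
      using moving_path[OF B(1)] B(2,3) x by simp_all
    have bp0: "bp ?B0 = (\<lambda>_. x)"
      by (simp add: bp_def path_def x)
    have xX: "pathin ?X (\<lambda>_. x)"
      using moving_path[of "\<lambda>_. ?B0"] good_B0 by (simp add: good_def x)
    have h1: "path_homotopic ?X (loop_join ?p (\<lambda>_. x)) ?p"
      by (rule path_homotopic_const_right) (use p in auto)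
    have "path_homotopic ?X (loop_join (\<lambda>_. x) (loop_join ?p (\<lambda>_. x))) (loop_join (\<lambda>_. x) ?p)"
      by (rule path_homotopic_join[OF path_homotopic_refl[OF xX] h1]) (use p in simp)
    moreover have "path_homotopic ?X (loop_join (\<lambda>_. x) ?p) ?p"
      by (rule path_homotopic_const_left) (use p in auto)
    ultimately have "path_homotopic ?X (loop_join (\<lambda>_. x) (loop_join ?p (\<lambda>_. x))) ?p"
      by (rule path_homotopic_trans)
    moreover have "loop_join (\<lambda>_. x) (loop_join ?p (\<lambda>_. x)) \<in> loops_at ?X x"
      using xX p by (simp add: loops_at_def pathin_loop_join)
    ultimately have "loop_class ?X x (loop_join (\<lambda>_. x) (loop_join ?p (\<lambda>_. x))) = loop_class ?X x ?p"
      by (intro loop_class_eqI)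
    then show "\<Phi> (\<lambda>t. conf_of n (e ` B t)) = j (len (loop_class ?X (sym_orbit n (disc_base n)) ?p))"
      using local[OF B(1)] unfolding B(2,3) bp0 x_def path_rev_def by simp
  qed
qed

section \<open>The half twist in the disc\<close>

lemma disc_base_apply: "k \<in> {1..n} \<Longrightarrow> disc_base n k = of_real ((2 * real k - real n - 1) / (real n + 1))"
  by (simp add: disc_base_def)

lemma disc_base_inj: "inj_on (disc_base n) {1..n}"
proof (rule inj_onI)
  fix k l assume "k \<in> {1..n}" "l \<in> {1..n}" "disc_base n k = disc_base n l"
  then have "(2 * real k - real n - 1) / (real n + 1) = (2 * real l - real n - 1) / (real n + 1)"
    using of_real_eq_iff[where 'a = complex] by (simp only: disc_base_apply)
  moreover have "real n + 1 \<noteq> 0"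
    by linarith
  ultimately show "k = l"
    by simp
qed

lemma disc_base_ball: "disc_base n ` {1..n} \<subseteq> ball 0 1"
proof
  fix z assume "z \<in> disc_base n ` {1..n}"
  then obtain k where k: "k \<in> {1..n}" "z = disc_base n k"
    by blast
  have "\<bar>2 * real k - real n - 1\<bar> < real n + 1"
    using k(1) by auto
  then have "\<bar>(2 * real k - real n - 1) / (real n + 1)\<bar> < 1"
    by (simp add: abs_divide)
  then show "z \<in> ball 0 1"
    unfolding k(2) disc_base_apply[OF k(1)] by (simp only: mem_ball dist_0_norm norm_of_real)
qed

text \<open>The midpoint of the base points \<open>n - 1\<close> and \<open>n\<close>. The last pair
  is taken so that the resting points are those with labels in \<open>{1..n-2}\<close>.\<close>

definition twist_centre :: "nat \<Rightarrow> complex" where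
  "twist_centre n = of_real ((real n - 2) / (real n + 1))"

definition twist_radius :: "nat \<Rightarrow> real" where
  "twist_radius n = 1 / (real n + 1)"

text \<open>Identifies the last standard generator with the half turn of a \<open>pair\<close> in
  logarithmic form: a vertical segment of length \<open>pi\<close> that starts at the logarithm of
  the radius.\<close>

lemma half_twist_apply:
  assumes n: "n \<ge> 2"
  shows "half_twist n (n - 1) t ` {1..n} =
    pair 1 (twist_centre n) (disc_base n ` {1..n-2}) (of_real (ln (twist_radius n)) + of_real t * (of_real pi * \<i>))"
proof -
  let ?m = "(disc_base n (n - 1) + disc_base n (Suc (n - 1))) / 2"
  let ?r = "(disc_base n (Suc (n - 1)) - disc_base n (n - 1)) / 2"
  have Suc: "Suc (n - 1) = n"
    using n by simp
  have n1: "real (n - 1) = real n - 1"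
    using n by simp
  have pos: "real n + 1 \<noteq> 0" "complex_of_real (real n + 1) \<noteq> 0"
    unfolding of_real_eq_0_iff by linarith+
  have b: "disc_base n n = of_real ((real n - 1) / (real n + 1))" "disc_base n (n - 1) = of_real ((real n - 3) / (real n + 1))"
    using n by (subst disc_base_apply; simp add: n1)+
  have ar: "((real n - 3) / (real n + 1) + (real n - 1) / (real n + 1)) / 2 = (real n - 2) / (real n + 1)"
    "((real n - 1) / (real n + 1) - (real n - 3) / (real n + 1)) / 2 = 1 / (real n + 1)"
  proof -
    have h: "(a / d + b / d) / 2 = c / d" if "a + b = 2 * c" for a b c d :: real
      using that by (simp flip: add_divide_distrib)
    show "((real n - 3) / (real n + 1) + (real n - 1) / (real n + 1)) / 2 = (real n - 2) / (real n + 1)"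
      by (rule h) simp
    have h': "(a / d - b / d) / 2 = c / d" if "a - b = 2 * c" for a b c d :: real
      using that by (simp flip: diff_divide_distrib)
    show "((real n - 1) / (real n + 1) - (real n - 3) / (real n + 1)) / 2 = 1 / (real n + 1)"
      by (rule h') simp
  qed
  have "?m = of_real (((real n - 3) / (real n + 1) + (real n - 1) / (real n + 1)) / 2)"
    unfolding Suc b by simp
  then have m: "?m = twist_centre n"
    unfolding ar(1) twist_centre_def .
  have "?r = of_real (((real n - 1) / (real n + 1) - (real n - 3) / (real n + 1)) / 2)"
    unfolding Suc b by simp
  then have r: "?r = of_real (twist_radius n)"
    unfolding ar(2) twist_radius_def .
  have "0 < twist_radius n"
    by (simp add: twist_radius_def)
  then have ex: "exp (of_real (ln (twist_radius n)) + of_real t * (of_real pi * \<i>)) = of_real (twist_radius n) * cis (pi * t)"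
    by (simp add: exp_add exp_of_real cis_conv_exp mult_ac)
  have split: "{1..n} = insert (n - 1) (insert n {1..n-2})"
    using n by auto
  have "half_twist n (n - 1) t (n - 1) = twist_centre n - of_real (twist_radius n) * cis (pi * t)"
    "half_twist n (n - 1) t n = twist_centre n + of_real (twist_radius n) * cis (pi * t)"
    unfolding m[symmetric] r[symmetric] half_twist_def Let_def using n by (auto simp: Suc)
  moreover have "half_twist n (n - 1) t ` {1..n-2} = disc_base n ` {1..n-2}"
    by (rule image_cong) (auto simp: half_twist_def Let_def)
  ultimately show ?thesis
    unfolding pair_def ex by (subst split) simp
qed

lemma half_twist_orbit:
  assumes n: "n \<ge> 2"
    and inj: "card (half_twist n (n - 1) t ` {1..n}) = n"
  shows "sym_orbit n (half_twist n (n - 1) t) = conf_of n (half_twist n (n - 1) t ` {1..n})"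
proof (rule sym_orbit_eq_conf_of)
  show "half_twist n (n - 1) t \<in> extensional {1..n}"
    by (simp add: half_twist_def Let_def)
  show "inj_on (half_twist n (n - 1) t) {1..n}"
    by (rule eq_card_imp_inj_on) (use inj in auto)
qed

text \<open>The other base points are at distance at least \<open>3 / (n + 1)\<close> from the
  centre, three times the radius, and the disc reaches only to modulus
  \<open>(n - 1) / (n + 1)\<close>.\<close>

lemma twist_isolated:
  assumes n: "n \<ge> 2"
  shows "isolated (ball 0 1) n (disc_base n ` {1..n-2}) (twist_centre n) (twist_radius n)"
  unfolding isolated_def
proof (intro conjI)
  have sub: "{1..n-2} \<subseteq> {1..n}"
    by auto
  have pos: "0 < real n + 1"
    by simp
  show "card (disc_base n ` {1..n-2}) + 2 = n"
    using card_image[OF inj_on_subset[OF disc_base_inj sub]] n by simp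
  show "disc_base n ` {1..n-2} \<subseteq> ball 0 1"
    using disc_base_ball image_mono[OF sub, of "disc_base n"] by blast
  show "0 < twist_radius n"
    by (simp add: twist_radius_def)
  have c: "cmod (twist_centre n) + twist_radius n < 1"
  proof -
    have "0 \<le> (real n - 2) / (real n + 1)"
      using n by simp
    then have "cmod (twist_centre n) = (real n - 2) / (real n + 1)"
      unfolding twist_centre_def norm_of_real by (rule abs_of_nonneg)
    then have "cmod (twist_centre n) + twist_radius n = (real n - 1) / (real n + 1)"
      by (simp add: twist_radius_def flip: add_divide_distrib)
    then show ?thesis
      by simp
  qed
  show "cball (twist_centre n) (twist_radius n) \<subseteq> ball 0 1"
  proof
    fix z assume "z \<in> cball (twist_centre n) (twist_radius n)"
    then have "cmod (z - twist_centre n) \<le> twist_radius n"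
      by (simp add: dist_norm norm_minus_commute)
    then show "z \<in> ball 0 1"
      using c norm_triangle_ineq[of "z - twist_centre n" "twist_centre n"] by simp
  qed
  have "dist (twist_centre n) (disc_base n k) > twist_radius n" if k: "k \<in> {1..n-2}" for k
  proof -
    have "disc_base n k = of_real ((2 * real k - real n - 1) / (real n + 1))"
      using k by (intro disc_base_apply) auto
    then have "twist_centre n - disc_base n k = of_real ((real n - 2) / (real n + 1) - (2 * real k - real n - 1) / (real n + 1))"
      by (simp only: twist_centre_def of_real_diff)
    also have "(real n - 2) / (real n + 1) - (2 * real k - real n - 1) / (real n + 1) = (2 * real n - 1 - 2 * real k) / (real n + 1)"
      by (simp flip: diff_divide_distrib)
    finally have "dist (twist_centre n) (disc_base n k) = \<bar>(2 * real n - 1 - 2 * real k) / (real n + 1)\<bar>"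
      by (simp only: dist_norm norm_of_real)
    also have "\<dots> \<ge> 3 / (real n + 1)"
    proof -
      have "real k + 2 \<le> real n"
        using k by auto
      then have "3 / (real n + 1) \<le> (2 * real n - 1 - 2 * real k) / (real n + 1)"
        by (intro divide_right_mono) auto
      then show ?thesis
        by linarith
    qed
    moreover have "twist_radius n < 3 / (real n + 1)"
      unfolding twist_radius_def by (intro divide_strict_right_mono) auto
    ultimately show ?thesis
      by linarith
  qed
  then show "cball (twist_centre n) (twist_radius n) \<inter> disc_base n ` {1..n-2} = {}"
    by force
qed simp

section \<open>The polygon model in general position to the embedded disc\<close>

text \<open>Invariance of domain, applied in a planar chart of the surface around each image
  point.\<close>

lemma openin_embedded_ball:
  fixes e :: "complex \<Rightarrow> 'a"
  assumes S: "surface_without_boundary S" and e: "continuous_map disc S e" "inj_on e (cball 0 1)"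
  shows "openin S (e ` ball 0 1)"
proof (subst openin_subopen, intro ballI)
  fix x assume "x \<in> e ` ball 0 1"
  then obtain z where z: "z \<in> ball 0 1" "x = e z"
    by blast
  have "x \<in> topspace S"
    using z e(1) by (auto simp: continuous_map_def)
  then obtain U where U: "openin S U" "x \<in> U" "subtopology S U homeomorphic_space (euclidean :: complex topology)"
    using S unfolding surface_without_boundary_def by blast
  then obtain f f' where f: "homeomorphic_maps (subtopology S U) (euclidean :: complex topology) f f'"
    unfolding homeomorphic_space_def by blast
  have US: "topspace (subtopology S U) = U"
    using openin_subset[OF U(1)] by auto
  have ff': "f' (f y) = y" if "y \<in> U" for y
    using f that US unfolding homeomorphic_maps_def by blast
  have fc: "continuous_map (subtopology S U) euclidean f"
    using f unfolding homeomorphic_maps_def by blast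
  have eb: "continuous_map (top_of_set (ball 0 1)) S e"
    using e(1) by (rule continuous_map_top_of_set_compose[where u = "\<lambda>x. x"]) auto
  define V where "V = {v \<in> ball 0 1. e v \<in> U}"
  have "openin (top_of_set (ball 0 1)) V"
    using openin_continuous_map_preimage[OF eb U(1)] by (simp add: V_def)
  then have V: "open V"
    by (simp add: openin_open_eq)
  have "continuous_map (top_of_set V) (subtopology S U) e"
    using continuous_map_top_of_set_compose[OF e(1), of V "\<lambda>x. x"] by (auto simp: V_def continuous_map_in_subtopology)
  from continuous_map_compose[OF this fc] have "continuous_on V (f \<circ> e)"
    by simp
  moreover have "inj_on (f \<circ> e) V"
  proof (rule inj_onI)
    fix v w assume vw: "v \<in> V" "w \<in> V" "(f \<circ> e) v = (f \<circ> e) w"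
    then have "e v = e w"
      using ff' unfolding V_def o_apply by (metis (mono_tags, lifting) mem_Collect_eq)
    then show "v = w"
      using inj_onD[OF e(2)] vw by (auto simp: V_def)
  qed
  ultimately have "open ((f \<circ> e) ` V)"
    using V by (intro invariance_of_domain)
  then have "openin (subtopology S U) {y \<in> topspace (subtopology S U). f y \<in> (f \<circ> e) ` V}"
    by (intro openin_continuous_map_preimage[OF fc]) simp
  then have op: "openin S {y \<in> U. f y \<in> (f \<circ> e) ` V}"
    unfolding US by (simp add: openin_open_subtopology[OF U(1)])
  have "{y \<in> U. f y \<in> (f \<circ> e) ` V} \<subseteq> e ` ball 0 1"
  proof
    fix y assume "y \<in> {y \<in> U. f y \<in> (f \<circ> e) ` V}"
    then obtain v where v: "y \<in> U" "v \<in> V" "f y = f (e v)"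
      by auto
    have "e v \<in> U"
      using v(2) by (simp add: V_def)
    from ff'[OF this] ff'[OF v(1)] v(3) have "y = e v"
      by metis
    then show "y \<in> e ` ball 0 1"
      using v(2) by (auto simp: V_def)
  qed
  moreover have "x \<in> {y \<in> U. f y \<in> (f \<circ> e) ` V}"
    using U(2) z by (auto simp: V_def)
  ultimately show "\<exists>T. openin S T \<and> x \<in> T \<and> T \<subseteq> e ` ball 0 1"
    using op by blast
qed

text \<open>This self-map of the disc fixes the boundary and maps the circle of radius \<open>r\<close> to the circle of radius
  \<open>r ^ N\<close> around \<open>(1 - r ^ N) w\<close>; these circles are nested.\<close>

definition shrink :: "nat \<Rightarrow> complex \<Rightarrow> complex \<Rightarrow> complex" where
  "shrink N w z = of_real (cmod z ^ (N - 1)) * z + of_real (1 - cmod z ^ N) * w"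

lemma shrink_sphere: "cmod z = 1 \<Longrightarrow> shrink N w z = z"
  by (simp add: shrink_def)

text \<open>The value is a vector \<open>?y z\<close> of modulus \<open>cmod z ^ N\<close> plus
  \<open>1 - cmod z ^ N\<close> times \<open>w\<close>. If two values agree, the vectors differ by
  the difference of their moduli times \<open>cmod w\<close>, but at least by that difference; as
  \<open>cmod w < 1\<close>, the moduli agree and then the vectors do.\<close>

lemma shrink_inj:
  assumes N: "N > 0" and w: "cmod w < 1" and eq: "shrink N w z = shrink N w z'"
  shows "z = z'"
proof -
  let ?y = "\<lambda>z. of_real (cmod z ^ (N - 1)) * z"
  have cm: "cmod (?y z) = cmod z ^ N" for z
    using N by (cases N) (simp_all add: norm_mult norm_power mult.commute)
  have "?y z - ?y z' = of_real (cmod z ^ N - cmod z' ^ N) * w"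
    using eq by (simp add: shrink_def algebra_simps)
  then have "cmod (?y z - ?y z') = \<bar>cmod z ^ N - cmod z' ^ N\<bar> * cmod w"
    by (simp only: norm_mult norm_of_real)
  moreover have "\<bar>cmod z ^ N - cmod z' ^ N\<bar> \<le> cmod (?y z - ?y z')"
    using norm_triangle_ineq3[of "?y z" "?y z'"] unfolding cm .
  ultimately have "\<bar>cmod z ^ N - cmod z' ^ N\<bar> * (1 - cmod w) \<le> 0"
    by (simp add: algebra_simps)
  then have pow: "cmod z ^ N = cmod z' ^ N"
    using w by (simp add: mult_le_0_iff)
  then have "cmod z = cmod z'"
    using N by (simp add: power_eq_iff_eq_base)
  moreover have "?y z = ?y z'"
    using \<open>?y z - ?y z' = _\<close> pow by simp
  ultimately show ?thesis
    by (cases "z' = 0") auto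
qed

text \<open>The second bound is what the exponent is for: a large \<open>N\<close> squeezes the disc
  of radius 9/10 into a small disc around \<open>w\<close>.\<close>

lemma shrink_cmod:
  assumes N: "N > 0" and w: "cmod w < 1"
  shows "cmod z < 1 \<Longrightarrow> cmod (shrink N w z) < 1"
    "cmod z \<le> 9/10 \<Longrightarrow> cmod (shrink N w z - w) \<le> 2 * (9/10) ^ N"
proof -
  have cm: "cmod (of_real (cmod z ^ (N - 1)) * z) = cmod z ^ N"
    using N by (cases N) (simp_all add: norm_mult norm_power mult.commute)
  show "cmod (shrink N w z) < 1" if z: "cmod z < 1"
  proof -
    have p: "cmod z ^ N < 1"
      using z N by (simp add: power_less_one_iff)
    have "cmod (shrink N w z) \<le> cmod z ^ N + cmod (of_real (1 - cmod z ^ N) * w)"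
      unfolding shrink_def using norm_triangle_ineq cm by metis
    also have "cmod (of_real (1 - cmod z ^ N) * w) = (1 - cmod z ^ N) * cmod w"
      unfolding norm_mult norm_of_real using p by simp
    also have "\<dots> < (1 - cmod z ^ N) * 1"
      using p w by (intro mult_strict_left_mono) auto
    finally show ?thesis
      by simp
  qed
  show "cmod (shrink N w z - w) \<le> 2 * (9/10) ^ N" if z: "cmod z \<le> 9/10"
  proof -
    have "shrink N w z - w = of_real (cmod z ^ (N - 1)) * z - of_real (cmod z ^ N) * w"
      by (simp add: shrink_def algebra_simps)
    then have "cmod (shrink N w z - w) \<le> cmod z ^ N + cmod (of_real (cmod z ^ N) * w)"
      using norm_triangle_ineq4 cm by metis
    also have "cmod (of_real (cmod z ^ N) * w) \<le> cmod z ^ N * 1"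
      unfolding norm_mult norm_of_real using w by (intro mult_mono) auto
    also have "cmod z ^ N \<le> (9/10) ^ N"
      using z by (intro power_mono) auto
    finally show ?thesis
      by linarith
  qed
qed

text \<open>An invariant of the identification that tells the open sides of type \<open>a\<close>
  from the rest of the boundary; corners count with the rest. As the whole boundary has length
  \<open>4 g\<close>, a condition modulo 4 does not depend on the parameter chosen for a
  point.\<close>

definition a_side :: "real \<Rightarrow> bool" where
  "a_side u \<longleftrightarrow> (\<exists>m::int. (4 * of_int m < u \<and> u < 4 * of_int m + 1) \<or> (4 * of_int m + 2 < u \<and> u < 4 * of_int m + 3))"

lemma a_side_shift: "a_side (u + 4 * of_int i) \<longleftrightarrow> a_side u"
proof -
  have imp: "a_side (u + 4 * of_int i)" if u: "a_side u" for u and i :: int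
  proof -
    obtain m :: int where "(4 * of_int m < u \<and> u < 4 * of_int m + 1) \<or> (4 * of_int m + 2 < u \<and> u < 4 * of_int m + 3)"
      using u unfolding a_side_def by blast
    then show ?thesis
      unfolding a_side_def by (intro exI[of _ "m + i"]) auto
  qed
  show ?thesis
    using imp[of u i] imp[of "u + 4 * of_int i" "- i"] by auto
qed

lemma a_side_rim:
  assumes g: "g > 0" and eq: "rim g u = rim g v"
  shows "a_side u \<longleftrightarrow> a_side v"
proof -
  have "exp (\<i> * of_real (2 * pi * u / (4 * real g))) = exp (\<i> * of_real (2 * pi * v / (4 * real g)))"
    using eq by (simp only: rim_def cis_conv_exp)
  then obtain i :: int where "\<i> * of_real (2 * pi * u / (4 * real g)) = \<i> * of_real (2 * pi * v / (4 * real g)) + of_real (real_of_int (2 * i) * pi) * \<i>"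
    unfolding exp_eq by blast
  then have "Im (\<i> * of_real (2 * pi * u / (4 * real g))) = Im (\<i> * of_real (2 * pi * v / (4 * real g)) + of_real (real_of_int (2 * i) * pi) * \<i>)"
    by (rule arg_cong)
  then have "2 * pi * u / (4 * real g) = 2 * pi * v / (4 * real g) + 2 * of_int i * pi"
    by simp
  then have "2 * pi * u = 2 * pi * (v + 4 * real g * of_int i)"
    using g by (simp add: field_simps)
  then have "u = v + 4 * of_int (int g * i)"
    by simp
  then show ?thesis
    using a_side_shift[of v "int g * i"] by metis
qed

lemma a_side_bounds:
  fixes k :: int
  shows "4 * of_int k < u \<Longrightarrow> u < 4 * of_int k + 1 \<Longrightarrow> a_side u"
    "4 * of_int k + 2 < u \<Longrightarrow> u < 4 * of_int k + 3 \<Longrightarrow> a_side u"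
    "4 * of_int k + 1 \<le> u \<Longrightarrow> u \<le> 4 * of_int k + 2 \<Longrightarrow> \<not> a_side u"
    "4 * of_int k + 3 \<le> u \<Longrightarrow> u \<le> 4 * of_int k + 4 \<Longrightarrow> \<not> a_side u"
proof -
  show "4 * of_int k < u \<Longrightarrow> u < 4 * of_int k + 1 \<Longrightarrow> a_side u"
    "4 * of_int k + 2 < u \<Longrightarrow> u < 4 * of_int k + 3 \<Longrightarrow> a_side u"
    unfolding a_side_def by blast+
  have int: "real_of_int m < real_of_int l + 1 \<longleftrightarrow> m \<le> l" for m l
    by linarith
  show "\<not> a_side u" if "4 * of_int k + 1 \<le> u" "u \<le> 4 * of_int k + 2"
  proof
    assume "a_side u"
    then obtain m :: int where m: "(4 * of_int m < u \<and> u < 4 * of_int m + 1) \<or> (4 * of_int m + 2 < u \<and> u < 4 * of_int m + 3)"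
      unfolding a_side_def by blast
    consider "m < k" | "m = k" | "k < m"
      by linarith
    then show False
    proof cases
      case 1
      then have "real_of_int m + 1 \<le> of_int k" by linarith
      then show False using m that by linarith
    next
      case 2
      then show False using m that by linarith
    next
      case 3
      then have "real_of_int k + 1 \<le> of_int m" by linarith
      then show False using m that by linarith
    qed
  qed
  show "\<not> a_side u" if "4 * of_int k + 3 \<le> u" "u \<le> 4 * of_int k + 4"
  proof
    assume "a_side u"
    then obtain m :: int where m: "(4 * of_int m < u \<and> u < 4 * of_int m + 1) \<or> (4 * of_int m + 2 < u \<and> u < 4 * of_int m + 3)"
      unfolding a_side_def by blast
    consider "m < k" | "m = k" | "k < m"
      by linarith
    then show False
    proof cases
      case 1
      then have "real_of_int m + 1 \<le> of_int k" by linarith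
      then show False using m that by linarith
    next
      case 2
      then show False using m that by linarith
    next
      case 3
      then have "real_of_int k + 1 \<le> of_int m" by linarith
      then show False using m that by linarith
    qed
  qed
qed

lemma side_pairing_a_side:
  assumes "side_pairing g z w"
  obtains u v where "z = rim g u" "w = rim g v" "a_side u \<longleftrightarrow> a_side v"
  using assms
proof cases
  case (side_a k t)
  have "a_side (4 * real k + t) \<longleftrightarrow> a_side (4 * real k + 3 - t)"
  proof (cases "0 < t \<and> t < 1")
    case True
    then show ?thesis
      using a_side_bounds(1)[of "int k" "4 * real k + t"] a_side_bounds(2)[of "int k" "4 * real k + 3 - t"] by auto
  next
    case False
    then have "t = 0 \<or> t = 1"
      using side_a by linarith
    moreover have "\<not> a_side (4 * real k)" "\<not> a_side (4 * real k + 1)" "\<not> a_side (4 * real k + 2)" "\<not> a_side (4 * real k + 3)"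
      using a_side_bounds(4)[of "int k - 1" "4 * real k"] a_side_bounds(3)[of "int k" "4 * real k + 1"]
        a_side_bounds(3)[of "int k" "4 * real k + 2"] a_side_bounds(4)[of "int k" "4 * real k + 3"] by auto
    moreover have "t = 1 \<Longrightarrow> 4 * real k + t = 4 * real k + 1" "t = 1 \<Longrightarrow> 4 * real k + 3 - t = 4 * real k + 2"
      "t = 0 \<Longrightarrow> 4 * real k + t = 4 * real k" "t = 0 \<Longrightarrow> 4 * real k + 3 - t = 4 * real k + 3"
      by simp_all
    ultimately show ?thesis
      by metis
  qed
  then show ?thesis
    using that side_a(1,2) by blast
next
  case (side_b k t)
  have "\<not> a_side (4 * real k + 1 + t)" "\<not> a_side (4 * real k + 4 - t)"
    using a_side_bounds(3)[of "int k" "4 * real k + 1 + t"] a_side_bounds(4)[of "int k" "4 * real k + 4 - t"] side_b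
    by auto
  then show ?thesis
    using that side_b(1,2) by blast
qed

text \<open>The invariant is carried along a chain of identifications. Successive links may use
  different parameters for the same point, which \<open>a_side_rim\<close> allows.\<close>

lemma equivclp_side_pairing_a_side:
  assumes g: "g > 0" and eq: "equivclp (side_pairing g) (rim g u) (rim g v)"
  shows "a_side u \<longleftrightarrow> a_side v"
proof -
  have "\<forall>v. w = rim g v \<longrightarrow> (a_side v \<longleftrightarrow> a_side u)" if "equivclp (side_pairing g) (rim g u) w" for w
    using that
  proof (induction rule: equivclp_induct)
    case base
    then show ?case
      using a_side_rim[OF g] by metis
  next
    case (step y z)
    then show ?case
      using a_side_rim[OF g] side_pairing_a_side by metis
  qed
  then show ?thesis
    using eq by blast
qed

lemma side_pairing_sphere: "side_pairing g z w \<Longrightarrow> cmod z = 1 \<and> cmod w = 1"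
  by (induction rule: side_pairing.induct) (simp_all add: rim_def)

text \<open>Sides are paired on the boundary only, so a chain that starts in the interior cannot
  leave its point.\<close>

lemma equivclp_side_pairing_interior:
  assumes "equivclp (side_pairing g) z w" "cmod z < 1"
  shows "w = z"
  using assms
proof (induction rule: equivclp_induct)
  case (step y w)
  then show ?case
    using side_pairing_sphere by (metis less_irrefl)
qed simp

section \<open>The length function does not extend\<close>

theorem proposition4p5:
  fixes n g :: nat
    and \<Sigma> :: "'a topology"
    and e :: "complex \<Rightarrow> 'a"
    and len :: "(real \<Rightarrow> (nat \<Rightarrow> complex) set) set \<Rightarrow> int"
  assumes "n \<ge> 3"
    and "surface_without_boundary \<Sigma>" and "compact_space \<Sigma>" and "orientable_surface \<Sigma>"
    and "has_genus \<Sigma> g" and "g > 0"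
    and "embedding_map disc \<Sigma> e"
    and "is_length_function n len"
  shows "\<not> (\<exists>(F :: 'f monoid) len_\<Sigma> j.
            group F \<and>
            len_\<Sigma> \<in> epi (braid_group n \<Sigma> (conf_map n e (disc_base n))) F \<and>
            j \<in> mon integer_group F \<and>
            (\<forall>\<beta> \<in> carrier (artin_braid_group n).
               len_\<Sigma> (braid_map n \<Sigma> e (disc_base n) \<beta>) = j (len \<beta>)))"
proof (rule notI, elim exE conjE)
  fix F :: "'f monoid" and l\<Sigma> j
  assume F: "group F" and l\<Sigma>: "l\<Sigma> \<in> epi (braid_group n \<Sigma> (conf_map n e (disc_base n))) F"
    and j: "j \<in> mon integer_group F"
    and comm: "\<forall>\<beta> \<in> carrier (artin_braid_group n). l\<Sigma> (braid_map n \<Sigma> e (disc_base n) \<beta>) = j (len \<beta>)"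
  let ?U = "ball (0::complex) 1"
  have n2: "n \<ge> 2" "n \<ge> 1"
    using assms(1) by auto
  obtain e' where "homeomorphic_maps disc (subtopology \<Sigma> (e ` cball 0 1)) e e'"
    using assms(7) unfolding embedding_map_def homeomorphic_map_maps topspace_euclidean_subtopology by blast
  then have e'_cont: "continuous_map (subtopology \<Sigma> (e ` cball 0 1)) disc e'"
    and e_cont': "continuous_map disc (subtopology \<Sigma> (e ` cball 0 1)) e"
    and e'e: "\<And>z. z \<in> cball 0 1 \<Longrightarrow> e' (e z) = z"
    unfolding homeomorphic_maps_def topspace_euclidean_subtopology by blast+
  have e_cont: "continuous_map disc \<Sigma> e"
    by (rule continuous_map_into_fulltopology[OF e_cont'])
  have e_inj: "inj_on e (cball 0 1)"
    by (rule inj_on_inverseI[of _ e']) (rule e'e)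
  have W: "openin \<Sigma> (e ` ?U)"
    by (rule openin_embedded_ball[OF assms(2) e_cont e_inj])
  obtain q where q: "quotient_map disc \<Sigma> q"
    and q_eq: "\<And>z w. z \<in> cball 0 1 \<Longrightarrow> w \<in> cball 0 1 \<Longrightarrow> q z = q w \<longleftrightarrow> equivclp (side_pairing g) z w"
    using assms(5,6) unfolding has_genus_def by auto
  have q_cont: "continuous_map disc \<Sigma> q"
    using q by (rule quotient_imp_continuous_map)
  \<comment> \<open>The preimage of the embedded open disc is nonempty and relatively open in the
    closed polygon, so it also has points in the interior.\<close>
  obtain w0 r where w0: "w0 \<in> ?U" and r: "r > 0" "\<And>z. z \<in> cball w0 r \<Longrightarrow> z \<in> ?U \<and> q z \<in> e ` ?U"
  proof -
    have "openin disc {z \<in> cball 0 1. q z \<in> e ` ?U}"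
      using openin_continuous_map_preimage[OF q_cont W] by simp
    then obtain V where V: "open V" "{z \<in> cball 0 1. q z \<in> e ` ?U} = cball 0 1 \<inter> V"
      unfolding openin_open by blast
    have "e 0 \<in> topspace \<Sigma>"
      using openin_subset[OF W] by auto
    moreover have "q ` cball 0 1 = topspace \<Sigma>"
      using quotient_imp_surjective_map[OF q] by simp
    ultimately obtain z1 where "z1 \<in> cball 0 1" "q z1 = e 0"
      by (metis imageE)
    then have "z1 \<in> V"
      using V(2) by auto
    moreover have "z1 \<in> closure ?U"
      using \<open>z1 \<in> cball 0 1\<close> by simp
    ultimately have "V \<inter> ?U \<noteq> {}"
      using open_Int_closure_eq_empty[OF V(1), of ?U] by blast
    then obtain w0 where w0: "w0 \<in> V \<inter> ?U"
      by blast
    moreover have "open (V \<inter> ?U)"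
      using V(1) by auto
    ultimately obtain r where r: "r > 0" "cball w0 r \<subseteq> V \<inter> ?U"
      using open_contains_cball by metis
    have "z \<in> ?U \<and> q z \<in> e ` ?U" if "z \<in> cball w0 r" for z
    proof -
      have "z \<in> ?U" "z \<in> cball 0 1 \<inter> V"
        using that r(2) by auto
      then show ?thesis
        unfolding V(2)[symmetric] by blast
    qed
    then show thesis
      using that w0 r(1) by blast
  qed
  \<comment> \<open>Large enough for \<open>shrink\<close> to map the disc of radius 9/10 into
    \<open>cball w0 r\<close>.\<close>
  obtain N0 :: nat where N0: "(9/10::real) ^ N0 < r / 2"
    using real_arch_pow_inv[of "r / 2" "9/10"] r(1) by auto
  define N where "N = Suc N0"
  have N: "N > 0" "2 * (9/10) ^ N \<le> r"
  proof -
    show "N > 0"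
      by (simp add: N_def)
    have "(9/10::real) ^ N \<le> (9/10) ^ N0"
      unfolding N_def by (rule power_decreasing) auto
    then show "2 * (9/10) ^ N \<le> r"
      using N0 by linarith
  qed
  have w1: "cmod w0 < 1"
    using w0 by simp
  let ?H = "shrink N w0"
  \<comment> \<open>The new polygon chart. As \<open>shrink\<close> fixes the unit circle, the sides
    are identified as before.\<close>
  define p where "p = (\<lambda>z. q (?H z))"
  have H_cont: "continuous_on X ?H" for X
    unfolding shrink_def by (intro continuous_intros)
  have H_cball: "?H z \<in> cball 0 1" if "z \<in> cball 0 1" for z
    using shrink_cmod(1)[OF N(1) w1, of z] shrink_sphere[of z N w0] that by (cases "cmod z = 1") auto
  have H_ball: "?H z \<in> ?U" if "z \<in> ?U" for z
    using shrink_cmod(1)[OF N(1) w1, of z] that by simp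
  have p_cont: "continuous_map disc \<Sigma> p"
    unfolding p_def by (rule continuous_map_top_of_set_compose[OF q_cont H_cont H_cball])
  have p_sphere: "p z = q z" if "cmod z = 1" for z
    using shrink_sphere[OF that] by (simp add: p_def)
  have interior: "z = w" if "z \<in> ?U" "w \<in> cball 0 1" "q z = q w" for z w
    using q_eq[of z w] equivclp_side_pairing_interior[of g z w] that by auto
  have p_inj: "inj_on p ?U"
  proof (rule inj_onI)
    fix z w assume zw: "z \<in> ?U" "w \<in> ?U" "p z = p w"
    have "?H w \<in> cball 0 1"
      using H_ball[OF zw(2)] by simp
    then have "?H z = ?H w"
      using zw(3) by (intro interior[OF H_ball[OF zw(1)]]) (simp_all add: p_def)
    then show "z = w"
      by (rule shrink_inj[OF N(1) w1])
  qed
  have p_sep: "p z \<noteq> p w" if "z \<in> ?U" "w \<in> sphere 0 1" for z w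
  proof
    assume "p z = p w"
    then have "q (?H z) = q w"
      using that p_sphere[of w] by (simp add: p_def)
    then have "?H z = w"
      using that by (intro interior[OF H_ball[OF that(1)]]) auto
    then show False
      using H_ball[OF that(1)] that(2) by simp
  qed
  have p_W: "p z \<in> e ` ?U" if "z \<in> ball 0 (9/10)" for z
  proof -
    have "?H z \<in> cball w0 r"
      using shrink_cmod(2)[OF N(1) w1, of z] that N(2) by (simp add: dist_norm norm_minus_commute)
    then show ?thesis
      using r(2) by (simp add: p_def)
  qed
  define \<psi> where "\<psi> z = e' (p z)" for z
  have \<psi>: "\<psi> z \<in> ?U" "p z = e (\<psi> z)" if z: "z \<in> ball 0 (9/10)" for z
  proof -
    obtain w where "w \<in> ?U" "p z = e w"
      using p_W[OF z] by blast
    then show "\<psi> z \<in> ?U" "p z = e (\<psi> z)"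
      using e'e[of w] by (simp_all add: \<psi>_def)
  qed
  have \<psi>_cont: "continuous_on (ball 0 (9/10)) \<psi>"
  proof -
    have "continuous_map (top_of_set (ball 0 (9/10))) \<Sigma> p"
      by (rule continuous_map_top_of_set_compose[OF p_cont continuous_on_id]) simp
    moreover have "p z \<in> e ` cball 0 1" if "z \<in> ball 0 (9/10)" for z
      using p_W[OF that] by auto
    ultimately have "continuous_map (top_of_set (ball 0 (9/10))) (subtopology \<Sigma> (e ` cball 0 1)) p"
      by (simp add: continuous_map_in_subtopology Pi_iff)
    from continuous_map_compose[OF this e'_cont] show ?thesis
      by (simp add: continuous_map_in_subtopology \<psi>_def[abs_def] o_def)
  qed
  have l\<Sigma>': "l\<Sigma> \<in> hom (braid_group n \<Sigma> (conf_map n e (disc_base n))) F"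
    using l\<Sigma> by (simp add: epi_def)
  obtain \<Phi> where rep: "conf_rep F n \<Sigma> \<Phi> (e ` ?U) j"
    and \<Phi>_loop: "\<And>B. moving_set (top_of_set ?U) n (top_of_set {0..1}) B \<Longrightarrow>
       B 0 = disc_base n ` {1..n} \<Longrightarrow> B 1 = disc_base n ` {1..n} \<Longrightarrow>
       \<Phi> (\<lambda>t. conf_of n (e ` B t)) =
       j (len (loop_class (unordered_conf n disc) (sym_orbit n (disc_base n)) (\<lambda>t. conf_of n (B t))))"
    using length_extension_functor[OF n2(2) F j l\<Sigma>' bspec[OF comm] assms(7) disc_base_inj disc_base_ball] by blast
  interpret C: conf_rep F n \<Sigma> \<Phi> "e ` ?U" j
    by (rule rep)
  have chart_e: "C.chart ?U e"
    unfolding C.chart_def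
  proof (intro conjI)
    show "continuous_map (top_of_set ?U) \<Sigma> e"
      by (rule continuous_map_top_of_set_compose[OF e_cont continuous_on_id]) simp
    show "inj_on e ?U"
      by (rule inj_on_subset[OF e_inj]) auto
  qed auto
  let ?w = "twist_centre n" and ?R = "disc_base n ` {1..n-2}" and ?\<delta> = "twist_radius n"
  have iso: "isolated ?U n ?R ?w ?\<delta>"
    by (rule twist_isolated[OF n2(1)])
  have \<delta>: "0 < ?\<delta>"
    by (simp add: twist_radius_def)
  \<comment> \<open>The half turn of the last two base points is the generator
    \<open>artin_gen n (n - 1)\<close>, whose length is 1.\<close>
  have "C.exchange e ?R ?w ?\<delta> = 1"
  proof -
    let ?l = "complex_of_real (ln ?\<delta>)"
    define B where "B t = half_twist n (n - 1) t ` {1..n}" for t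
    have B: "B t = pair 1 ?w ?R (?l + of_real t * (of_real pi * \<i>))" for t
      unfolding B_def by (rule half_twist_apply[OF n2(1)])
    have "moving_set (top_of_set ?U) (card ?R + 2) (top_of_set UNIV) (\<lambda>t. pair 1 ?w ?R (?l + of_real t * (of_real pi * \<i>)))"
    proof (rule moving_set_pair[OF moving_set_const])
      show "cball ?w (exp (Re (?l + of_real t * (of_real pi * \<i>)))) \<subseteq> ?U - ?R" for t
        using \<delta> by (intro isolated_cball[OF iso]) simp
    qed (use iso in \<open>auto simp: isolated_def intro!: continuous_intros\<close>)
    then have movB: "moving_set (top_of_set ?U) n (top_of_set UNIV) B"
      using iso by (simp add: isolated_def B[abs_def])
    have movB': "moving_set (top_of_set ?U) n (top_of_set {0..1}) B"
      using moving_set_compose[OF movB, of "top_of_set {0..1}" "\<lambda>t. t"] by simp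
    have orbit: "sym_orbit n (half_twist n (n - 1) t) = conf_of n (B t)" for t
      unfolding B_def using moving_set_card(2)[OF movB, of t] by (intro half_twist_orbit[OF n2(1)]) (simp add: B_def)
    have "half_twist n (n - 1) 0 k = disc_base n k" if "k \<in> {1..n}" for k
      using that by (auto simp: half_twist_def Let_def field_simps)
    then have B0: "B 0 = disc_base n ` {1..n}"
      unfolding B_def by (rule image_cong[OF refl])
    have B1: "B 1 = disc_base n ` {1..n}"
      unfolding B0[symmetric] B using pair_half_turn[of ?w ?R ?l] by simp
    have mem: "?l \<in> log_disc ?\<delta>" "?l + of_real pi * \<i> \<in> log_disc ?\<delta>"
      using \<delta> by (simp_all add: log_disc_def)
    have loc: "C.local_on (log_disc ?\<delta>) (\<lambda>z. e ` pair 1 ?w ?R z)"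
      by (rule C.pair_local_on[OF chart_e iso]) simp
    have "j (C.exchange e ?R ?w ?\<delta>) = C.motion (\<lambda>z. e ` pair 1 ?w ?R z) ?l (?l + of_real pi * \<i>)"
      unfolding C.orbit_degree_def by (rule C.j_degree[OF convex_log_disc[OF \<delta>] loc mem])
    also have "\<dots> = \<Phi> (\<lambda>t. conf_of n (e ` B t))"
    proof -
      have "(1 - t) *\<^sub>R ?l + t *\<^sub>R (?l + of_real pi * \<i>) = ?l + of_real t * (of_real pi * \<i>)" for t
        by (simp add: scaleR_conv_of_real algebra_simps)
      then show ?thesis
        unfolding C.motion_def C.seg_def B by (simp only:)
    qed
    also have "\<dots> = j (len (loop_class (unordered_conf n disc) (sym_orbit n (disc_base n)) (\<lambda>t. conf_of n (B t))))"
      by (rule \<Phi>_loop[OF movB' B0 B1])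
    also have "loop_class (unordered_conf n disc) (sym_orbit n (disc_base n)) (\<lambda>t. conf_of n (B t)) = artin_gen n (n - 1)"
      by (simp only: artin_gen_def orbit)
    also have "len (artin_gen n (n - 1)) = 1"
      using assms(8) n2 unfolding is_length_function_def by auto
    finally show ?thesis
      by (simp add: C.j_eq_iff)
  qed
  then have exch: "\<exists>R w \<delta>. isolated ?U n R w \<delta> \<and> C.exchange e R w \<delta> = 1"
    using iso by blast
  have rim: "rim g u \<in> cball 0 1" "p (rim g u) = q (rim g u)" for u
    using p_sphere[of "rim g u"] by (simp_all add: rim_def)
  have paired: "p (rim g u) = p (rim g v)" if "side_pairing g (rim g u) (rim g v)" for u v
    unfolding rim(2) using q_eq[OF rim(1) rim(1)] that r_into_equivclp by metis
  interpret polygon_rep F n \<Sigma> \<Phi> "e ` ?U" j p e \<psi> g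
  proof (intro polygon_rep.intro rep polygon_rep_axioms.intro)
    show "\<psi> ` ball 0 (9/10) \<subseteq> ?U"
      using \<psi>(1) by blast
    show "p (rim g (4 * real k + t)) = p (rim g (4 * real k + 3 - t))" if "k < g" "0 \<le> t" "t \<le> 1" for k t
      by (rule paired) (rule side_pairing.side_a[OF that])
    show "p (rim g (4 * real k + 1 + t)) = p (rim g (4 * real k + 4 - t))" if "k < g" "0 \<le> t" "t \<le> 1" for k t
      by (rule paired) (rule side_pairing.side_b[OF that])
    \<comment> \<open>The midpoints of an \<open>a\<close> side and of the following
      \<open>b\<close> side, told apart by \<open>a_side\<close>.\<close>
    show "p (rim g (4 * real k + 1/2)) \<noteq> p (rim g (4 * real k + 3/2))" for k
    proof
      assume "p (rim g (4 * real k + 1/2)) = p (rim g (4 * real k + 3/2))"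
      then have "equivclp (side_pairing g) (rim g (4 * real k + 1/2)) (rim g (4 * real k + 3/2))"
        unfolding rim(2) q_eq[OF rim(1) rim(1)] .
      then have "a_side (4 * real k + 1/2) \<longleftrightarrow> a_side (4 * real k + 3/2)"
        by (rule equivclp_side_pairing_a_side[OF assms(6)])
      then show False
        using a_side_bounds(1)[of "int k" "4 * real k + 1/2"] a_side_bounds(3)[of "int k" "4 * real k + 3/2"] by simp
    qed
  qed (use assms chart_e exch p_cont p_inj p_sep \<psi>_cont \<psi>(2) in auto)
  show False
    by (rule no_extension)
qed

end
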